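(* Let $\Bbbk$ be a field of characteristic zero and let $n\ge 1$ be an integer. For all $a,b\in\Bbbk$ the point schemes of $R(n,a)$ and $R(n,b)$ are isomorphic. For every $a\in\Bbbk$, the point modules of $R=R(n,a)$ are parameterised by a union $C_1\cup\dots\cup C_n$, where $C_k$ is a rational normal curve of degree $k$ in $\mathbb{P}(R_1^* )\cong\mathbb{P}^n$.
   Context: Let $A=\Bbbk[X_0,\dots,X_n]$ be the commutative polynomial ring, $\partial_i=\partial/\partial X_i$, and define the derivations $\Delta=\sum_{i=1}^{n}X_{i-1}\partial_i$ and $\Gamma_a=\sum_{i=0}^n (a+i)X_i\partial_i$ of $A$. For $k\in\mathbb{N}$ put $\binom{\Gamma_a}{k}=\frac{1}{k!}\Gamma_a(\Gamma_a-1)\cdots(\Gamma_a-(k-1))$. Then $R(n,a)$ is the associative $\Bbbk$-algebra with underlying vector space $A$ and multiplication $f\ast g=\sum_{k\ge 0}\Delta^k(f)\binom{\Gamma_a}{k}(g)$. It is $\mathbb{N}$-graded by the usual polynomial degree ($\deg X_i=1$), and $R_1=\operatorname{span}_\Bbbk(X_0,\dots,X_n)$. A point module over an $\mathbb{N}$-graded ring $R$ is a cyclic graded module $M$ with Hilbert series $1/(1-t)$. The point scheme of $R$ is the projective scheme parameterising point modules of $R$ up to isomorphism. A point module $R/J$ is associated with the point of $\mathbb{P}(R_1^* )$ corresponding to the codimension-one subspace $J_1\subseteq R_1$. A rational normal curve of degree $k$ is a curve spanning a linear subspace $\mathbb{P}^k\subseteq\mathbb{P}^n$ that is, up to linear change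 of coordinates, the image of the degree $k$ Veronese embedding $\mathbb{P}^1\to\mathbb{P}^k$. "Parameterised" refers to the underlying reduced point scheme. *)

theory Defs
  imports
    "HOL-Library.Poly_Mapping"
    "HOL-Library.FuncSet"
    "HOL-Algebra.QuotRing"
    "HOL-Analysis.Abstract_Topology"
begin

section \<open>Polynomial rings\<close>

type_synonym 'a mpoly = "(nat \<Rightarrow>\<^sub>0 nat) \<Rightarrow>\<^sub>0 'a"

definition Cst :: "'a::zero \<Rightarrow> 'a mpoly" where
  "Cst c = Poly_Mapping.single 0 c"

definition mono :: "(nat \<Rightarrow>\<^sub>0 nat) \<Rightarrow> 'a::zero_neq_one mpoly" where
  "mono u = Poly_Mapping.single u 1"

definition Var :: "nat \<Rightarrow> 'a::zero_neq_one mpoly" where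
  "Var i = mono (Poly_Mapping.single i 1)"

definition polys :: "nat set \<Rightarrow> 'a::zero mpoly set" where
  "polys V = {p. \<forall>u\<in>Poly_Mapping.keys p. Poly_Mapping.keys u \<subseteq> V}"

definition mpoly_ring :: "nat set \<Rightarrow> 'a::comm_ring_1 mpoly ring" where
  "mpoly_ring V =
    \<lparr>carrier = polys V, mult = (*), one = 1, zero = 0, add = (+)\<rparr>"

definition mono_deg :: "(nat \<Rightarrow>\<^sub>0 nat) \<Rightarrow> nat" where
  "mono_deg u = (\<Sum>i\<in>Poly_Mapping.keys u. Poly_Mapping.lookup u i)"

definition forms :: "nat \<Rightarrow> nat \<Rightarrow> 'a::zero mpoly set" where
  "forms n d = {p \<in> polys {..n}. \<forall>u\<in>Poly_Mapping.keys p. mono_deg u = d}"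

definition hom_part :: "nat \<Rightarrow> 'a::comm_monoid_add mpoly \<Rightarrow> 'a mpoly" where
  "hom_part d p =
    (\<Sum>u\<in>{u \<in> Poly_Mapping.keys p. mono_deg u = d}.
       Poly_Mapping.single u (Poly_Mapping.lookup p u))"

definition pdiff :: "nat \<Rightarrow> 'a::semiring_1 mpoly \<Rightarrow> 'a mpoly" where
  "pdiff i p =
    (\<Sum>u\<in>Poly_Mapping.keys p.
       Poly_Mapping.single (u - Poly_Mapping.single i 1)
         (of_nat (Poly_Mapping.lookup u i) * Poly_Mapping.lookup p u))"

definition poly_subst ::
    "(nat \<Rightarrow> 'a::comm_ring_1 mpoly) \<Rightarrow> 'a mpoly \<Rightarrow> 'a mpoly" where
  "poly_subst \<sigma> p =
    (\<Sum>u\<in>Poly_Mapping.keys p.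
       Cst (Poly_Mapping.lookup p u) *
       (\<Prod>i\<in>Poly_Mapping.keys u. \<sigma> i ^ Poly_Mapping.lookup u i))"

section \<open>The algebra $R(n,a)$\<close>

definition Delta :: "nat \<Rightarrow> 'k::field_char_0 mpoly \<Rightarrow> 'k mpoly" where
  "Delta n f = (\<Sum>i = 1..n. Var (i - 1) * pdiff i f)"

definition Gam :: "nat \<Rightarrow> 'k::field_char_0 \<Rightarrow> 'k mpoly \<Rightarrow> 'k mpoly" where
  "Gam n a f = (\<Sum>i = 0..n. Cst (a + of_nat i) * Var i * pdiff i f)"

primrec Gam_falling ::
    "nat \<Rightarrow> 'k::field_char_0 \<Rightarrow> nat \<Rightarrow> 'k mpoly \<Rightarrow> 'k mpoly" where
  "Gam_falling n a 0 g = g"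
| "Gam_falling n a (Suc k) g =
     Gam n a (Gam_falling n a k g) - of_nat k * Gam_falling n a k g"

definition Gam_binom ::
    "nat \<Rightarrow> 'k::field_char_0 \<Rightarrow> nat \<Rightarrow> 'k mpoly \<Rightarrow> 'k mpoly" where
  "Gam_binom n a k g = Cst (1 / fact k) * Gam_falling n a k g"

text \<open>The sum over all \<open>k\<close> is finite because \<open>Delta n\<close> is locally nilpotent;
  \<^const>\<open>Sum_any\<close> adds up the nonzero terms.\<close>

definition star ::
    "nat \<Rightarrow> 'k::field_char_0 \<Rightarrow> 'k mpoly \<Rightarrow> 'k mpoly \<Rightarrow> 'k mpoly" where
  "star n a f g = Sum_any (\<lambda>k. (Delta n ^^ k) f * Gam_binom n a k g)"

definition R_alg :: "nat \<Rightarrow> 'k::field_char_0 \<Rightarrow> 'k mpoly ring" where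
  "R_alg n a =
    \<lparr>carrier = polys {..n}, mult = star n a, one = 1, zero = 0, add = (+)\<rparr>"

section \<open>Families of point modules\<close>

text \<open>
  Below, \<open>R\<close> is a graded \<open>k\<close>-algebra whose underlying graded vector space is
  \<open>A = k[X_0,...,X_n]\<close>.  Test algebras are the commutative \<open>k\<close>-algebras
  \<open>S = B / K\<close>, where \<open>B = k[y_0, y_1, ...]\<close> is the polynomial ring in countably many
  variables (the type \<open>'k mpoly\<close>) and \<open>K\<close> an ideal of \<open>B\<close>: up to isomorphism,
  these are all countably generated commutative \<open>k\<close>-algebras, in particular all finitely
  generated ones, on which a scheme of finite type over \<open>k\<close> is determined by its functor of
  points.  An \<open>S\<close>-submodule of the base change of \<open>A\<close> (or of a graded piece) to \<open>S\<close> is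
  represented by its preimage in the base change to \<open>B\<close> (the type \<open>'k mpoly mpoly\<close>), which
  is a \<open>B\<close>-submodule containing \<open>K\<close> times the ambient module.
\<close>

definition map_coeffs :: "'k::comm_ring_1 mpoly \<Rightarrow> 'k mpoly mpoly" where
  "map_coeffs f = Poly_Mapping.map Cst f"

definition base_mult ::
    "'k::comm_ring_1 mpoly ring \<Rightarrow> 'k mpoly mpoly \<Rightarrow> 'k mpoly mpoly \<Rightarrow> 'k mpoly mpoly" where
  "base_mult R F G =
    (\<Sum>u\<in>Poly_Mapping.keys F. \<Sum>v\<in>Poly_Mapping.keys G.
       Cst (Poly_Mapping.lookup F u * Poly_Mapping.lookup G v) *
       map_coeffs (mono u \<otimes>\<^bsub>R\<^esub> mono v))"

definition S_submodule ::
    "'b::comm_ring_1 set \<Rightarrow> 'b mpoly set \<Rightarrow> 'b mpoly set \<Rightarrow> bool" where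
  "S_submodule K M N \<longleftrightarrow>
     N \<subseteq> M \<and> 0 \<in> N \<and>
     (\<forall>v\<in>N. \<forall>w\<in>N. v + w \<in> N) \<and>
     (\<forall>b. \<forall>v\<in>N. Cst b * v \<in> N) \<and>
     (\<forall>b\<in>K. \<forall>v\<in>M. Cst b * v \<in> N)"

text \<open>
  The \<open>S\<close>-module \<open>Q = M / N\<close> is locally free of rank one: \<open>Spec S\<close> is covered by finitely many
  basic open sets \<open>D(t)\<close> such that the localisation \<open>Q_t\<close> is free over \<open>S_t\<close> on one generator,
  which may be taken to be the image of some \<open>e\<close> in \<open>M\<close>.  The two conditions on \<open>e\<close> say that its
  image generates \<open>Q_t\<close> and has zero annihilator in \<open>S_t\<close>.
\<close>

definition invertible_quot ::
    "'k::comm_ring_1 mpoly set \<Rightarrow> 'k mpoly mpoly set \<Rightarrow> 'k mpoly mpoly set \<Rightarrow> bool" where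
  "invertible_quot K M N \<longleftrightarrow>
     (\<exists>T. finite T \<and> Idl\<^bsub>mpoly_ring UNIV\<^esub> (K \<union> T) = UNIV \<and>
        (\<forall>t\<in>T. \<exists>e\<in>M.
           (\<forall>v\<in>M. \<exists>j b. Cst (t ^ j) * v - Cst b * e \<in> N) \<and>
           (\<forall>b. Cst b * e \<in> N \<longrightarrow> (\<exists>j. t ^ j * b \<in> K))))"

text \<open>
  Modules are right modules.  A point module over \<open>R\<close>, being cyclic and generated in degree zero,
  is \<open>R / J\<close> for the graded right ideal \<open>J\<close> annihilating its generator, and \<open>J\<close> is determined by,
  and determines, the isomorphism class.  Likewise a family over \<open>S\<close> is a graded cyclic right module
  over the base change of \<open>R\<close> to \<open>S\<close> each of whose graded pieces is locally free of rank one over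
  \<open>S\<close>; for \<open>S\<close> a field this says that the Hilbert series is \<open>1/(1-t)\<close>.
\<close>

definition point_ideals ::
    "nat \<Rightarrow> 'k::comm_ring_1 mpoly ring \<Rightarrow> 'k mpoly set \<Rightarrow> 'k mpoly mpoly set set" where
  "point_ideals n R K =
    {J. S_submodule K (polys {..n}) J \<and>
        (\<forall>f\<in>J. \<forall>g\<in>polys {..n}. base_mult R f g \<in> J) \<and>
        (\<forall>f\<in>J. \<forall>d. hom_part d f \<in> J) \<and>
        (\<forall>d. invertible_quot K (forms n d) (J \<inter> forms n d))}"

section \<open>Closed subschemes of projective space\<close>

text \<open>Closed subschemes of \<open>P^n\<close> correspond to saturated homogeneous ideals.\<close>

definition closed_subscheme :: "nat \<Rightarrow> 'k::comm_ring_1 mpoly set \<Rightarrow> bool" where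
  "closed_subscheme n I \<longleftrightarrow>
     ideal I (mpoly_ring {..n}) \<and>
     (\<forall>f\<in>I. \<forall>d. hom_part d f \<in> I) \<and>
     (\<forall>f\<in>polys {..n}. (\<forall>i\<le>n. \<exists>m. Var i ^ m * f \<in> I) \<longrightarrow> f \<in> I)"

text \<open>
  The \<open>S\<close>-points of \<open>Proj(A/I)\<close> inside \<open>P(V^*) = Proj Sym V\<close>, where \<open>V = A_1\<close>: quotients of
  the base change \<open>V_S\<close> by a submodule \<open>N\<close>, such that \<open>L = V_S / N\<close> is locally free of rank
  one and \<open>I\<close> maps to zero in \<open>Sym L\<close>.  Here \<open>Sym L\<close> is the quotient of \<open>Sym V_S\<close> by the ideal
  generated by \<open>N\<close>.
\<close>

definition proj_points ::
    "nat \<Rightarrow> 'k::comm_ring_1 mpoly set \<Rightarrow> 'k mpoly set \<Rightarrow> 'k mpoly mpoly set set" where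
  "proj_points n I K =
    {N. S_submodule K (forms n 1) N \<and>
        invertible_quot K (forms n 1) N \<and>
        map_coeffs ` I \<subseteq> Idl\<^bsub>mpoly_ring {..n}\<^esub> (N \<union> Cst ` K)}"

text \<open>
  \<open>Proj(A/I)\<close>, embedded in \<open>P(R_1^*)\<close>, is the point scheme of \<open>R\<close>: it parameterises families of
  point modules, \<open>R_S / J\<close> corresponding to the point given by \<open>J_1\<close>.  (This bijection is
  automatically compatible with base change.)
\<close>

definition point_scheme ::
    "nat \<Rightarrow> 'k::comm_ring_1 mpoly ring \<Rightarrow> 'k mpoly set \<Rightarrow> bool" where
  "point_scheme n R I \<longleftrightarrow>
     closed_subscheme n I \<and>
     (\<forall>K. ideal K (mpoly_ring UNIV) \<longrightarrow>
        bij_betw (\<lambda>J. J \<inter> forms n 1) (point_ideals n R K) (proj_points n I K))"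

section \<open>\<open>Proj\<close> as a ringed space\<close>

definition Proj :: "nat \<Rightarrow> 'k::comm_ring_1 mpoly set \<Rightarrow> 'k mpoly set set" where
  "Proj n I =
    {P. primeideal P (mpoly_ring {..n}) \<and> (\<forall>f\<in>P. \<forall>d. hom_part d f \<in> P) \<and>
        I \<subseteq> P \<and> (\<exists>i\<le>n. Var i \<notin> P)}"

definition Proj_open ::
    "nat \<Rightarrow> 'k::comm_ring_1 mpoly set \<Rightarrow> 'k mpoly set set \<Rightarrow> bool" where
  "Proj_open n I U \<longleftrightarrow> (\<exists>E \<subseteq> polys {..n}. U = {P \<in> Proj n I. \<not> E \<subseteq> P})"

lemma istopology_Proj: "istopology (Proj_open n I)"
  unfolding istopology_def
proof (intro conjI allI impI)
  fix U W
  assume "Proj_open n I U" "Proj_open n I W"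
  then obtain E F where E: "E \<subseteq> polys {..n}" "U = {P \<in> Proj n I. \<not> E \<subseteq> P}"
    and F: "F \<subseteq> polys {..n}" "W = {P \<in> Proj n I. \<not> F \<subseteq> P}"
    unfolding Proj_open_def by auto
  define G where "G = {e * f |e f. e \<in> E \<and> f \<in> F} \<inter> polys {..n}"
  have "U \<inter> W = {P \<in> Proj n I. \<not> G \<subseteq> P}"
  proof (intro equalityI subsetI)
    fix P assume P: "P \<in> U \<inter> W"
    then have PI: "P \<in> Proj n I" using E by auto
    then interpret P: primeideal P "mpoly_ring {..n}"
      unfolding Proj_def by auto
    obtain e f where ef: "e \<in> E" "e \<notin> P" "f \<in> F" "f \<notin> P"
      using P E F by auto
    have mem: "e \<in> carrier (mpoly_ring {..n})" "f \<in> carrier (mpoly_ring {..n})"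
      using ef E F by (auto simp: mpoly_ring_def)
    have "e * f \<notin> P"
      using P.I_prime[OF mem] ef by (auto simp: mpoly_ring_def)
    moreover have "e * f \<in> polys {..n}"
      using P.m_closed[OF mem] by (simp add: mpoly_ring_def)
    ultimately show "P \<in> {P \<in> Proj n I. \<not> G \<subseteq> P}"
      using PI ef unfolding G_def by blast
  next
    fix P assume "P \<in> {P \<in> Proj n I. \<not> G \<subseteq> P}"
    then have PI: "P \<in> Proj n I" and "\<not> G \<subseteq> P" by auto
    then obtain e f where ef: "e \<in> E" "f \<in> F" "e * f \<notin> P"
      unfolding G_def by auto
    from PI interpret P: primeideal P "mpoly_ring {..n}"
      unfolding Proj_def by auto
    have mem: "e \<in> carrier (mpoly_ring {..n})" "f \<in> carrier (mpoly_ring {..n})"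
      using ef E F by (auto simp: mpoly_ring_def)
    have "e \<notin> P" "f \<notin> P"
      using P.I_l_closed[of f e] P.I_r_closed[of e f] mem ef
      by (auto simp: mpoly_ring_def)
    then show "P \<in> U \<inter> W"
      using PI ef E F by auto
  qed
  then show "Proj_open n I (U \<inter> W)"
    unfolding Proj_open_def G_def by (intro exI[of _ G]) (auto simp: G_def)
next
  fix \<U>
  assume *: "\<forall>U\<in>\<U>. Proj_open n I U"
  then obtain E where E: "\<And>U. U \<in> \<U> \<Longrightarrow>
      E U \<subseteq> polys {..n} \<and> U = {P \<in> Proj n I. \<not> E U \<subseteq> P}"
    unfolding Proj_open_def by metis
  have "\<Union>\<U> = {P \<in> Proj n I. \<not> (\<Union>U\<in>\<U>. E U) \<subseteq> P}"
    using E by blast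
  then show "Proj_open n I (\<Union>\<U>)"
    unfolding Proj_open_def using E by (intro exI[of _ "\<Union>U\<in>\<U>. E U"]) auto
qed

definition Proj_top :: "nat \<Rightarrow> 'k::comm_ring_1 mpoly set \<Rightarrow> 'k mpoly set topology" where
  "Proj_top n I = topology (Proj_open n I)"

lemma openin_Proj_top: "openin (Proj_top n I) = Proj_open n I"
  unfolding Proj_top_def using istopology_Proj by (rule topology_inverse')

text \<open>Elements of the stalk at \<open>P\<close>, the degree zero part of the homogeneous localisation of \<open>A/I\<close>,
  are represented by equivalence classes of pairs (numerator, denominator).\<close>

definition frac ::
    "nat \<Rightarrow> 'k::comm_ring_1 mpoly set \<Rightarrow> 'k mpoly set \<Rightarrow> 'k mpoly \<Rightarrow> 'k mpoly \<Rightarrow>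
     ('k mpoly \<times> 'k mpoly) set" where
  "frac n I P f g =
    {(f', g'). (\<exists>d. f' \<in> forms n d \<and> g' \<in> forms n d) \<and> g' \<notin> P \<and>
       (\<exists>e. \<exists>h\<in>forms n e. h \<notin> P \<and> h * (f * g' - f' * g) \<in> I)}"

definition stalk_add ::
    "nat \<Rightarrow> 'k::comm_ring_1 mpoly set \<Rightarrow> 'k mpoly set \<Rightarrow>
     ('k mpoly \<times> 'k mpoly) set \<Rightarrow> ('k mpoly \<times> 'k mpoly) set \<Rightarrow> ('k mpoly \<times> 'k mpoly) set" where
  "stalk_add n I P c c' =
    (\<Union>(f, g)\<in>c. \<Union>(f', g')\<in>c'. frac n I P (f * g' + f' * g) (g * g'))"

definition stalk_mult ::
    "nat \<Rightarrow> 'k::comm_ring_1 mpoly set \<Rightarrow> 'k mpoly set \<Rightarrow>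
     ('k mpoly \<times> 'k mpoly) set \<Rightarrow> ('k mpoly \<times> 'k mpoly) set \<Rightarrow> ('k mpoly \<times> 'k mpoly) set" where
  "stalk_mult n I P c c' =
    (\<Union>(f, g)\<in>c. \<Union>(f', g')\<in>c'. frac n I P (f * f') (g * g'))"

type_synonym 'k proj_section = "'k mpoly set \<Rightarrow> ('k mpoly \<times> 'k mpoly) set"

definition const_section ::
    "nat \<Rightarrow> 'k::comm_ring_1 mpoly set \<Rightarrow> 'k mpoly set set \<Rightarrow> 'k \<Rightarrow> 'k proj_section" where
  "const_section n I U c = (\<lambda>P\<in>U. frac n I P (Cst c) 1)"

definition sections ::
    "nat \<Rightarrow> 'k::comm_ring_1 mpoly set \<Rightarrow> 'k mpoly set set \<Rightarrow> 'k proj_section ring" where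
  "sections n I U =
    \<lparr>carrier =
       {s \<in> extensional U. \<forall>P\<in>U. \<exists>W. openin (Proj_top n I) W \<and> P \<in> W \<and> W \<subseteq> U \<and>
          (\<exists>d. \<exists>f\<in>forms n d. \<exists>g\<in>forms n d. \<forall>Q\<in>W. g \<notin> Q \<and> s Q = frac n I Q f g)},
     mult = (\<lambda>s s'. \<lambda>P\<in>U. stalk_mult n I P (s P) (s' P)),
     one = const_section n I U 1,
     zero = const_section n I U 0,
     add = (\<lambda>s s'. \<lambda>P\<in>U. stalk_add n I P (s P) (s' P))\<rparr>"

text \<open>Isomorphism of \<open>k\<close>-schemes: a homeomorphism \<open>\<phi>\<close> with an isomorphism \<open>\<psi>\<close> of sheaves of
  \<open>k\<close>-algebras over it (isomorphisms of stalks are automatically local).\<close>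

definition scheme_iso ::
    "nat \<Rightarrow> 'k::comm_ring_1 mpoly set \<Rightarrow> nat \<Rightarrow> 'k mpoly set \<Rightarrow> bool" where
  "scheme_iso n I m I' \<longleftrightarrow>
     (\<exists>\<phi> \<psi>. homeomorphic_map (Proj_top n I) (Proj_top m I') \<phi> \<and>
        (\<forall>U. openin (Proj_top m I') U \<longrightarrow>
           (let pre = (\<lambda>U. {P \<in> Proj n I. \<phi> P \<in> U}) in
              \<psi> U \<in> ring_iso (sections m I' U) (sections n I (pre U)) \<and>
              (\<forall>c. \<psi> U (const_section m I' U c) = const_section n I (pre U) c) \<and>
              (\<forall>W. openin (Proj_top m I') W \<and> W \<subseteq> U \<longrightarrow>
                 (\<forall>s\<in>carrier (sections m I' U).
                    \<psi> W (restrict s W) = restrict (\<psi> U s) (pre W))))))"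

section \<open>Rational normal curves\<close>

text \<open>
  The composite of the Veronese embedding \<open>[s:t] \<mapsto> [s^k : s^(k-1) t : ... : t^k]\<close> with the linear
  embedding of \<open>P^k\<close> into \<open>P^n\<close> given by the injective matrix \<open>c\<close>, as a substitution on
  coordinates; \<open>s\<close> and \<open>t\<close> are the variables \<open>0\<close> and \<open>1\<close>.
\<close>

definition veronese_subst ::
    "nat \<Rightarrow> (nat \<Rightarrow> nat \<Rightarrow> 'k::comm_ring_1) \<Rightarrow> 'k mpoly \<Rightarrow> 'k mpoly" where
  "veronese_subst k c =
     poly_subst (\<lambda>i. \<Sum>j\<le>k. Cst (c i j) * (Var 0 ^ (k - j) * Var 1 ^ j))"

definition rational_normal_curve ::
    "nat \<Rightarrow> nat \<Rightarrow> 'k::comm_ring_1 mpoly set set \<Rightarrow> bool" where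
  "rational_normal_curve n k C \<longleftrightarrow>
     (\<exists>c :: nat \<Rightarrow> nat \<Rightarrow> 'k.
        (\<forall>u. (\<forall>i\<le>n. (\<Sum>j\<le>k. c i j * u j) = 0) \<longrightarrow> (\<forall>j\<le>k. u j = 0)) \<and>
        C = (\<lambda>Q. {f \<in> polys {..n}. veronese_subst k c f \<in> Q}) ` Proj 1 {0})"

end

theory Submission
  imports Defs "HOL-Computational_Algebra.Formal_Power_Series"
begin

text \<open>
  In \<open>R(n, a)\<close> one has \<open>f * X\<^sub>i = X\<^sub>i (1 + \<Delta>)\<^bsup>a + i\<^esup> f\<close>, so that \<open>((1 + \<Delta>)\<^bsup>- a - j\<^esup> X\<^sub>i) * X\<^sub>j = X\<^sub>i X\<^sub>j\<close>
  is symmetric in \<open>i\<close> and \<open>j\<close>.  Locally on the base, a point module is therefore a sequence of points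
  \<open>p\<^sub>0, p\<^sub>1, \<dots>\<close> of projective space, written as polynomials in \<open>z\<close>, such that the matrix with entries
  \<open>p\<^bsub>d + 1, j\<^esub> ((1 + z)\<^bsup>- a - j\<^esup> p\<^sub>d)\<^sub>i\<close> is symmetric.  Conversely every such chain defines a right ideal,
  because its functionals twisted by \<open>(1 + \<Delta>)\<^sup>s\<close> are multiplicative.  At a prime, the relations can be
  solved for \<open>p\<^bsub>d + 1\<^esub>\<close> at the first index where \<open>p\<^sub>d\<close> is invertible, so \<open>p\<^sub>0\<close> determines the module,
  and the forms that vanish at \<open>p\<^sub>0\<close> for all chains form the ideal of the point scheme.

  Multiplying the generating function of a symmetric matrix by \<open>(1 + z + w)\<^sup>s\<close> keeps it symmetric;
  hence replacing \<open>p\<^sub>d\<close> by \<open>(1 + z)\<^bsup>d (a - b)\<^esup> p\<^sub>d\<close> turns chains for \<open>a\<close> into chains for \<open>b\<close> with the same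
  \<open>p\<^sub>0\<close>, and the ideal does not depend on \<open>a\<close>.  For points with leading index \<open>m\<close> one may thus take
  \<open>a = - m\<close>.  Then \<open>p\<^sub>1\<close> is proportional to \<open>p\<^sub>0\<close>, and the relations become a recursion that forces
  \<open>p\<^sub>0\<close> to be \<open>z\<^sup>m (1 + z)\<^sup>b\<close> up to a scalar: a point of the curve \<open>C\<^bsub>n - m\<^esub>\<close>.  Conversely, the constant
  sequences at points of this curve are chains.
\<close>

section \<open>Polynomials, substitutions, ideals and primes over the base ring\<close>

section \<open>Linear extension on polynomials\<close>

text \<open>In generating functions, a link between \<open>p\<close> and \<open>q\<close> says that
  \<open>(1 + z)^(- a) p(z) q(w / (1 + z))\<close> is symmetric in \<open>z\<close> and
  \<open>w\<close>. Since \<open>(1 + z + w)^s = (1 + z)^s (1 + w / (1 + z))^s\<close>, the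
  symmetric factor multiplies \<open>p\<close> and \<open>q\<close> alike by
  \<open>(1 + z)^s\<close>. Passing from \<open>a\<close> to \<open>b\<close> changes the balance
  between the two sides of each link by one factor \<open>(1 + z)^(a - b)\<close>, hence the
  exponent that grows with \<open>d\<close> and vanishes for the first point. The curve point
  \<open>z^m (1 + z)^b\<close> solves the relations because a product of two binomial coefficients
  becomes a symmetric trinomial coefficient. The obstacle is the base: a test algebra
  \<open>B / K\<close> may be non-reduced, line bundles on it need not be trivial, and a chart for
  the next point that works at one prime fails at another. No quotient or localised ring is formed.
  All statements are congruences modulo ideals of \<open>B\<close>, localisation at a prime becomes
  the preimage \<open>loc K P\<close>, and membership is tested prime by prime. Points are known
  only up to a factor, so proportionality is kept as \<open>H * c - e * v\<close> with factors on
  both sides, and faithfulness replaces division.\<close>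

abbreviation lookup :: "('a \<Rightarrow>\<^sub>0 'b::zero) \<Rightarrow> 'a \<Rightarrow> 'b" where
  "lookup \<equiv> Poly_Mapping.lookup"
abbreviation keys :: "('a \<Rightarrow>\<^sub>0 'b::zero) \<Rightarrow> 'a set" where
  "keys \<equiv> Poly_Mapping.keys"
abbreviation single :: "'a \<Rightarrow> 'b::zero \<Rightarrow> 'a \<Rightarrow>\<^sub>0 'b" where
  "single \<equiv> Poly_Mapping.single"

lemma Cst_add: "Cst (a + b) = Cst a + Cst b"
  by (simp add: Cst_def single_add)

lemma Cst_mult: "Cst (a * b) = Cst a * (Cst b :: 'a::comm_ring_1 mpoly)"
  by (simp add: Cst_def mult_single)

lemma Cst_0 [simp]: "Cst 0 = 0"
  by (simp add: Cst_def)

lemma Cst_1 [simp]: "Cst 1 = (1 :: 'a::comm_ring_1 mpoly)"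
  by (simp add: Cst_def)

lemma Cst_uminus: "Cst (- a) = - (Cst a :: 'a::comm_ring_1 mpoly)"
  by (simp add: Cst_def single_uminus)

lemma Cst_diff: "Cst (a - b) = (Cst a :: 'a::comm_ring_1 mpoly) - Cst b"
  by (simp add: Cst_def single_diff)

lemma Cst_sum: "Cst (sum f A) = (\<Sum>x\<in>A. Cst (f x))"
  by (induction A rule: infinite_finite_induct) (simp_all add: Cst_add)

lemma Cst_of_nat: "Cst (of_nat k) = (of_nat k :: 'a::comm_ring_1 mpoly)"
  by (simp add: Cst_def)

lemma Cst_eq_0_iff [simp]: "Cst b = 0 \<longleftrightarrow> b = 0"
  by (metis Cst_0 Cst_def lookup_single_eq)

lemma lookup_Cst_mult [simp]: "lookup (Cst b * F) u = b * lookup (F :: 'a::comm_ring_1 mpoly) u"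
proof -
  have "Cst b * F = Poly_Mapping.map ((*) b) F"
    by (simp add: Cst_def mult_map_scale_conv_mult)
  then show ?thesis by (simp add: Poly_Mapping.map.rep_eq when_def)
qed

lemma mono_0 [simp]: "mono 0 = 1"
  by (simp add: mono_def)

lemma mono_add: "mono (u + v) = (mono u * mono v :: 'a::comm_ring_1 mpoly)"
  by (simp add: mono_def mult_single)

lemma single_eq_Cst_mono: "single u b = (Cst b * mono u :: 'a::comm_ring_1 mpoly)"
  by (simp add: Cst_def mono_def mult_single)

lemma keys_mono [simp]: "keys (mono u :: 'a::zero_neq_one mpoly) = {u}"
  by (simp add: mono_def)

lemma lookup_mono: "lookup (mono u :: 'a::zero_neq_one mpoly) v = (if u = v then 1 else 0)"
  by (simp add: mono_def lookup_single when_def)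

lemma mpoly_expand: "F = (\<Sum>u\<in>keys F. Cst (lookup F u) * mono u :: 'a::comm_ring_1 mpoly)"
  by (rule poly_mapping_eqI)
     (auto simp: lookup_sum lookup_mono in_keys_iff if_distrib[of "(*) _"] sum.delta' cong: if_cong)

text \<open>The semilinear extension of \<open>g\<close> from monomials, with \<open>h\<close>
  acting on coefficients. Derivations, homogeneous parts, substitutions and the functionals of
  chains all have this form, so their linearity is proved once.\<close>

definition lsum :: "('a::zero \<Rightarrow> 'c::comm_ring_1) \<Rightarrow> ((nat \<Rightarrow>\<^sub>0 nat) \<Rightarrow> 'c) \<Rightarrow> 'a mpoly \<Rightarrow> 'c" where
  "lsum h g F = (\<Sum>u\<in>keys F. h (lookup F u) * g u)"

lemma lsum_superset:
  assumes "finite A" "keys F \<subseteq> A" "h 0 = 0"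
  shows "lsum h g F = (\<Sum>u\<in>A. h (lookup F u) * g u)"
  unfolding lsum_def using assms by (intro sum.mono_neutral_left) (auto simp: in_keys_iff)

lemma lsum_0 [simp]: "lsum h g 0 = 0"
  by (simp add: lsum_def)

lemma lsum_add:
  fixes h :: "'a::comm_ring_1 \<Rightarrow> 'c::comm_ring_1"
  assumes "\<And>x y. h (x + y) = h x + h y"
  shows "lsum h g (F + G) = lsum h g F + lsum h g G"
proof -
  let ?A = "keys F \<union> keys G"
  have h0: "h 0 = 0" using assms[of 0 0] by simp
  have "lsum h g (F + G) = (\<Sum>u\<in>?A. h (lookup (F + G) u) * g u)"
    by (rule lsum_superset) (use keys_add[of F G] in \<open>auto simp: h0\<close>)
  moreover have "lsum h g F = (\<Sum>u\<in>?A. h (lookup F u) * g u)"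
    by (rule lsum_superset) (auto simp: h0)
  moreover have "lsum h g G = (\<Sum>u\<in>?A. h (lookup G u) * g u)"
    by (rule lsum_superset) (auto simp: h0)
  ultimately show ?thesis
    by (simp add: lookup_add assms distrib_right sum.distrib)
qed

lemma lsum_Cst_mult:
  fixes h :: "'a::comm_ring_1 \<Rightarrow> 'c::comm_ring_1"
  assumes "\<And>x y. h (x + y) = h x + h y" "\<And>x y. h (x * y) = h x * h y"
  shows "lsum h g (Cst b * F) = h b * lsum h g F"
proof -
  have h0: "h 0 = 0" using assms(1)[of 0 0] by simp
  have "keys (Cst b * F) \<subseteq> keys F" by (auto simp: in_keys_iff)
  then have "lsum h g (Cst b * F) = (\<Sum>u\<in>keys F. h (lookup (Cst b * F) u) * g u)"
    by (intro lsum_superset) (auto simp: h0)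
  then show ?thesis
    by (simp add: assms lsum_def sum_distrib_left mult.assoc)
qed

lemma lsum_mono: "h 1 = 1 \<Longrightarrow> lsum h g (mono u) = g u"
  by (simp add: lsum_def lookup_mono)

lemma lsum_sum:
  fixes h :: "'a::comm_ring_1 \<Rightarrow> 'c::comm_ring_1"
  assumes "\<And>x y. h (x + y) = h x + h y"
  shows "lsum h g (sum f A) = (\<Sum>x\<in>A. lsum h g (f x))"
  by (induction A rule: infinite_finite_induct) (simp_all add: lsum_add[of h, OF assms])

lemma lsum_diff:
  fixes h :: "'a::comm_ring_1 \<Rightarrow> 'c::comm_ring_1"
  assumes "\<And>x y. h (x + y) = h x + h y"
  shows "lsum h g (F - G) = lsum h g F - lsum h g G"
  using lsum_add[of h g "F - G" G, OF assms] by (simp add: algebra_simps)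

lemma linear_eq_lsum:
  fixes L :: "'a::comm_ring_1 mpoly \<Rightarrow> 'c::comm_ring_1"
  assumes "\<And>F G. L (F + G) = L F + L G" "\<And>b F. L (Cst b * F) = h b * L F"
  shows "L F = lsum h (\<lambda>u. L (mono u)) F"
proof -
  have L0: "L 0 = 0" using assms(1)[of 0 0] by simp
  have "L (sum f A) = (\<Sum>x\<in>A. L (f x))" for f and A :: "(nat \<Rightarrow>\<^sub>0 nat) set"
    by (induction A rule: infinite_finite_induct) (simp_all add: assms(1) L0)
  then show ?thesis
    by (subst mpoly_expand[of F]) (simp add: assms(2) lsum_def)
qed

lemma lsum_mult:
  fixes h :: "'a::comm_ring_1 \<Rightarrow> 'c::comm_ring_1"
  assumes h: "\<And>x y. h (x + y) = h x + h y" "\<And>x y. h (x * y) = h x * h y" "h 1 = 1"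
    and g: "\<And>u v. g (u + v) = g u * g v"
  shows "lsum h g (F * G) = lsum h g F * lsum h g G"
proof -
  have 1: "lsum h g (mono u * G) = g u * lsum h g G" for u
  proof -
    have "lsum h g (mono u * G) = lsum h (\<lambda>v. lsum h g (mono u * mono v)) G"
      by (rule linear_eq_lsum[of "\<lambda>G. lsum h g (mono u * G)"])
         (simp_all add: distrib_left lsum_add h lsum_Cst_mult mult.left_commute[of "mono u"])
    also have "\<dots> = lsum h (\<lambda>v. g u * g v) G"
      by (simp add: lsum_mono h g flip: mono_add)
    finally show ?thesis by (simp add: lsum_def sum_distrib_left mult.left_commute)
  qed
  have "lsum h g (F * G) = lsum h (\<lambda>u. lsum h g (mono u * G)) F"
    by (rule linear_eq_lsum[of "\<lambda>F. lsum h g (F * G)"])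
       (simp_all add: distrib_right lsum_add h lsum_Cst_mult mult.assoc)
  also have "\<dots> = lsum h (\<lambda>u. g u * lsum h g G) F" by (simp only: 1)
  finally show ?thesis by (simp add: lsum_def sum_distrib_right mult.assoc)
qed

lemma lsum_cong: "(\<And>u. u \<in> keys F \<Longrightarrow> g u = g' u) \<Longrightarrow> lsum h g F = lsum h g' F"
  by (simp add: lsum_def)

lemmas lsum_Cst_simps [simp] =
  lsum_add[of Cst, OF Cst_add] lsum_diff[of Cst, OF Cst_add]
  lsum_Cst_mult[of Cst, OF Cst_add Cst_mult] lsum_mono[of Cst, OF Cst_1]
  lsum_sum[of Cst, OF Cst_add]

lemmas lsum_id_simps [simp] =
  lsum_add[of "\<lambda>x. x", OF refl] lsum_diff[of "\<lambda>x. x", OF refl]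
  lsum_Cst_mult[of "\<lambda>x. x", OF refl refl] lsum_mono[of "\<lambda>x. x", OF refl]
  lsum_sum[of "\<lambda>x. x", OF refl]

section \<open>Monomials as words\<close>

text \<open>Words replace monomials as the object of induction: the functionals of a chain read the
  letters one at a time, each at its own point.\<close>

primrec mol :: "nat list \<Rightarrow> (nat \<Rightarrow>\<^sub>0 nat)" where
  "mol [] = 0"
| "mol (i # is) = single i 1 + mol is"

lemma mono_mol_Cons: "mono (mol (i # is)) = (Var i * mono (mol is) :: 'a::comm_ring_1 mpoly)"
  by (simp add: mono_add Var_def)

lemma lookup_mol: "lookup (mol is) i = count_list is i"
  by (induction "is") (auto simp: lookup_add lookup_single when_def)

lemma keys_mol: "keys (mol is) = set is"
  by (auto simp: in_keys_iff lookup_mol count_list_0_iff)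

lemma keys_add_nat: "keys (u + v) = keys u \<union> keys (v :: nat \<Rightarrow>\<^sub>0 nat)"
  by (auto simp: in_keys_iff lookup_add)

lemma mono_deg_superset:
  "finite A \<Longrightarrow> keys u \<subseteq> A \<Longrightarrow> mono_deg u = (\<Sum>i\<in>A. lookup u i)"
  unfolding mono_deg_def by (intro sum.mono_neutral_left) (auto simp: in_keys_iff)

lemma mono_deg_add: "mono_deg (u + v) = mono_deg u + mono_deg v"
  using mono_deg_superset[of "keys u \<union> keys v" "u + v"]
    mono_deg_superset[of "keys u \<union> keys v" u] mono_deg_superset[of "keys u \<union> keys v" v]
  by (simp add: keys_add_nat lookup_add sum.distrib)

lemma mono_deg_0 [simp]: "mono_deg 0 = 0"
  by (simp add: mono_deg_def)

lemma mono_deg_single [simp]: "mono_deg (single i 1) = 1"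
  by (simp add: mono_deg_def)

lemma mono_deg_mol: "mono_deg (mol is) = length is"
  by (induction "is") (simp_all add: mono_deg_add flip: One_nat_def)

lemma mol_surj: "\<exists>is. mol is = u"
proof (induction "mono_deg u" arbitrary: u)
  case 0
  then have "lookup u i = 0" for i
    by (cases "i \<in> keys u") (auto simp: mono_deg_def in_keys_iff)
  then have "u = 0" by (intro poly_mapping_eqI) simp
  then show ?case by (intro exI[of _ "[]"]) simp
next
  case (Suc d)
  then obtain i where i: "lookup u i > 0"
    by (metis gr0I mono_deg_def sum.not_neutral_contains_not_neutral nat.distinct(1))
  define v where "v = u - single i 1"
  have u: "u = single i 1 + v"
    by (rule poly_mapping_eqI) (use i in \<open>auto simp: v_def lookup_add lookup_minus lookup_single when_def\<close>)
  then have "mono_deg v = d" using Suc(2) by (simp add: mono_deg_add flip: One_nat_def)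
  then obtain "is" where "mol is = v" using Suc(1) by blast
  then show ?case using u by (intro exI[of _ "i # is"]) simp
qed

lemma mset_eq_of_mol_eq: "mol is = mol js \<Longrightarrow> mset is = mset js"
  by (metis lookup_mol count_mset multiset_eqI)

text \<open>An arbitrary ordering of the letters. Whatever is computed from it has to be shown
  independent of the order; for chains this is \<open>wval_mset\<close>.\<close>

definition word :: "(nat \<Rightarrow>\<^sub>0 nat) \<Rightarrow> nat list" where
  "word u = (SOME is. mol is = u)"

lemma mol_word [simp]: "mol (word u) = u"
  unfolding word_def by (rule someI_ex[OF mol_surj])

lemma length_word: "length (word u) = mono_deg u"
  by (metis mol_word mono_deg_mol)

lemma set_word: "set (word u) = keys u"
  by (metis mol_word keys_mol)

lemma mset_word_mol: "mset (word (mol is)) = mset is"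
  by (rule mset_eq_of_mol_eq) simp

section \<open>Polynomial subrings, forms and homogeneous parts\<close>

lemma polysD: "p \<in> polys V \<Longrightarrow> u \<in> keys p \<Longrightarrow> keys u \<subseteq> V"
  by (auto simp: polys_def)

lemma polys_UNIV [simp]: "polys UNIV = UNIV"
  by (auto simp: polys_def)

lemma polys_0 [simp]: "0 \<in> polys V"
  by (simp add: polys_def)

lemma polys_add: "p \<in> polys V \<Longrightarrow> q \<in> polys V \<Longrightarrow> p + q \<in> polys V"
  unfolding polys_def using keys_add[of p q] by blast

lemma polys_mult:
  fixes p q :: "'a::comm_ring_1 mpoly"
  shows "p \<in> polys V \<Longrightarrow> q \<in> polys V \<Longrightarrow> p * q \<in> polys V"
  unfolding polys_def using keys_mult[of p q] by (fastforce simp: keys_add_nat)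

lemma polys_Cst [simp]: "Cst b \<in> polys V"
  by (auto simp: polys_def Cst_def split: if_splits)

lemma polys_1 [simp]: "(1 :: 'a::comm_ring_1 mpoly) \<in> polys V"
  using polys_Cst[of "1::'a" V] by (simp del: polys_Cst)

lemma polys_mono: "keys u \<subseteq> V \<Longrightarrow> mono u \<in> polys V"
  by (auto simp: polys_def)

lemma polys_Var: "i \<in> V \<Longrightarrow> Var i \<in> polys V"
  by (auto simp: Var_def intro!: polys_mono split: if_splits)

lemma polys_uminus:
  fixes p :: "'a::comm_ring_1 mpoly"
  shows "p \<in> polys V \<Longrightarrow> - p \<in> polys V"
  by (auto simp: polys_def in_keys_iff)

lemma polys_sum: "(\<And>x. x \<in> A \<Longrightarrow> f x \<in> polys V) \<Longrightarrow> sum f A \<in> polys V"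
  by (induction A rule: infinite_finite_induct) (auto intro: polys_add)

lemma polys_prod:
  fixes f :: "'b \<Rightarrow> 'a::comm_ring_1 mpoly"
  shows "(\<And>x. x \<in> A \<Longrightarrow> f x \<in> polys V) \<Longrightarrow> prod f A \<in> polys V"
  by (induction A rule: infinite_finite_induct) (auto intro: polys_mult)

lemma polys_power:
  fixes p :: "'a::comm_ring_1 mpoly"
  shows "p \<in> polys V \<Longrightarrow> p ^ k \<in> polys V"
  by (induction k) (auto intro: polys_mult)

lemma formsD: "p \<in> forms n d \<Longrightarrow> p \<in> polys {..n}"
  "p \<in> forms n d \<Longrightarrow> u \<in> keys p \<Longrightarrow> mono_deg u = d"
  by (auto simp: forms_def)

lemma forms_0 [simp]: "0 \<in> forms n d"
  by (simp add: forms_def)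

lemma forms_add: "p \<in> forms n d \<Longrightarrow> q \<in> forms n d \<Longrightarrow> p + q \<in> forms n d"
  unfolding forms_def using keys_add[of p q] by (auto intro: polys_add)

lemma forms_mult:
  fixes p q :: "'a::comm_ring_1 mpoly"
  shows "p \<in> forms n d \<Longrightarrow> q \<in> forms n e \<Longrightarrow> p * q \<in> forms n (d + e)"
  unfolding forms_def using keys_mult[of p q] by (fastforce simp: mono_deg_add intro: polys_mult)

lemma forms_mono: "keys u \<subseteq> {..n} \<Longrightarrow> mono_deg u = d \<Longrightarrow> mono u \<in> forms n d"
  by (auto simp: forms_def intro!: polys_mono)

lemma forms_Var: "i \<le> n \<Longrightarrow> Var i \<in> forms n 1"
  unfolding Var_def by (rule forms_mono) (auto split: if_splits simp del: One_nat_def)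

lemma forms_Cst [simp]: "Cst b \<in> forms n 0"
  by (cases "b = 0") (auto simp: forms_def, simp add: Cst_def)

lemma forms_1 [simp]: "(1 :: 'a::comm_ring_1 mpoly) \<in> forms n 0"
  using forms_Cst[of "1::'a" n] by (simp del: forms_Cst)

lemma forms_Cst_mult:
  fixes p :: "'a::comm_ring_1 mpoly"
  shows "p \<in> forms n d \<Longrightarrow> Cst b * p \<in> forms n d"
  using forms_mult[of "Cst b" n 0 p d] by simp

lemma forms_diff:
  fixes p q :: "'a::comm_ring_1 mpoly"
  shows "p \<in> forms n d \<Longrightarrow> q \<in> forms n d \<Longrightarrow> p - q \<in> forms n d"
  using forms_add[of p n d "Cst (-1) * q"] forms_Cst_mult[of q n d "-1"]
  by (simp add: Cst_uminus)

lemma forms_sum: "(\<And>x. x \<in> A \<Longrightarrow> f x \<in> forms n d) \<Longrightarrow> sum f A \<in> forms n d"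
  by (induction A rule: infinite_finite_induct) (auto intro: forms_add)

lemma forms_prod:
  fixes f :: "'b \<Rightarrow> 'a::comm_ring_1 mpoly"
  assumes "finite A" "\<And>x. x \<in> A \<Longrightarrow> f x \<in> forms n d"
  shows "prod f A \<in> forms n (card A * d)"
  using assms by (induction A rule: finite_induct) (auto intro: forms_mult)

lemma forms_power:
  fixes p :: "'a::comm_ring_1 mpoly"
  shows "p \<in> forms n d \<Longrightarrow> p ^ k \<in> forms n (k * d)"
  by (induction k) (auto intro: forms_mult)

lemma hom_part_lsum: "hom_part d p = lsum Cst (\<lambda>u. if mono_deg u = d then mono u else 0) p"
  for p :: "'a::comm_ring_1 mpoly"
  unfolding hom_part_def lsum_def
  by (simp add: single_eq_Cst_mono if_distrib[of "(*) _"] sum.inter_filter cong: if_cong)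

lemma lookup_hom_part:
  "lookup (hom_part d p) u = (if mono_deg u = d then lookup p u else 0)"
  for p :: "'a::comm_ring_1 mpoly"
  unfolding hom_part_def
  by (auto simp: lookup_sum lookup_single when_def sum.delta' in_keys_iff)

lemma hom_part_add: "hom_part d (p + q) = hom_part d p + hom_part d (q :: 'a::comm_ring_1 mpoly)"
  by (simp add: hom_part_lsum)

lemma hom_part_Cst_mult: "hom_part d (Cst b * p) = Cst b * hom_part d (p :: 'a::comm_ring_1 mpoly)"
  by (simp add: hom_part_lsum)

lemma hom_part_0 [simp]: "hom_part d 0 = 0"
  by (simp add: hom_part_def)

lemma hom_part_sum: "hom_part d (sum f A) = (\<Sum>x\<in>A. hom_part d (f x :: 'a::comm_ring_1 mpoly))"
  by (simp add: hom_part_lsum)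

lemma keys_hom_part: "keys (hom_part d p) = {u \<in> keys p. mono_deg u = d}"
  for p :: "'a::comm_ring_1 mpoly"
  by (auto simp: in_keys_iff lookup_hom_part split: if_splits)

lemma hom_part_polys: "p \<in> polys V \<Longrightarrow> hom_part d p \<in> polys V"
  for p :: "'a::comm_ring_1 mpoly"
  by (auto simp: polys_def keys_hom_part)

lemma hom_part_forms: "p \<in> polys {..n} \<Longrightarrow> hom_part d p \<in> forms n d"
  for p :: "'a::comm_ring_1 mpoly"
  by (auto simp: forms_def keys_hom_part hom_part_polys)

lemma hom_part_form: "p \<in> forms n d \<Longrightarrow> hom_part e p = (if e = d then p else 0)"
  for p :: "'a::comm_ring_1 mpoly"
  by (auto intro!: poly_mapping_eqI simp: lookup_hom_part forms_def in_keys_iff)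

lemma hom_part_expand:
  fixes p :: "'a::comm_ring_1 mpoly"
  assumes "\<And>u. u \<in> keys p \<Longrightarrow> mono_deg u < D"
  shows "p = (\<Sum>d<D. hom_part d p)"
  by (rule poly_mapping_eqI)
     (use assms in \<open>fastforce simp: lookup_sum lookup_hom_part in_keys_iff sum.delta'\<close>)

lemma mono_deg_bound: "\<exists>D. \<forall>u\<in>keys p. mono_deg u < D"
proof
  show "\<forall>u\<in>keys p. mono_deg u < Suc (Max (mono_deg ` keys p))"
    by (auto simp: less_Suc_eq_le)
qed

lemma hom_part_mult_form:
  fixes p q :: "'a::comm_ring_1 mpoly"
  assumes "q \<in> forms n d"
  shows "hom_part e (p * q) = (if d \<le> e then hom_part (e - d) p * q else 0)"
proof -
  have *: "hom_part e (mono u * q) = (if d + mono_deg u = e then mono u * q else 0)" for u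
  proof -
    have "mono u * q = (\<Sum>v\<in>keys q. Cst (lookup q v) * mono (u + v))"
      by (subst mpoly_expand[of q]) (simp add: sum_distrib_left mono_add mult.left_commute)
    moreover have "hom_part e (mono (u + v) :: 'a mpoly) = (if d + mono_deg u = e then mono (u + v) else 0)"
      if "v \<in> keys q" for v
      using formsD(2)[OF assms that] by (simp add: hom_part_lsum mono_deg_add add.commute)
    ultimately show ?thesis
      by (simp add: hom_part_sum hom_part_Cst_mult)
  qed
  have "hom_part e (p * q) = lsum Cst (\<lambda>u. hom_part e (mono u * q)) p"
    by (rule linear_eq_lsum[of "\<lambda>p. hom_part e (p * q)"])
       (simp_all add: distrib_right hom_part_add hom_part_Cst_mult mult.assoc)
  also have "\<dots> = lsum Cst (\<lambda>u. if d + mono_deg u = e then mono u * q else 0) p"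
    by (simp only: *)
  also have "\<dots> = (if d \<le> e then hom_part (e - d) p * q else 0)"
    unfolding hom_part_lsum lsum_def sum_distrib_right
    by (auto intro!: sum.cong sum.neutral)
  finally show ?thesis .
qed

section \<open>Substitution\<close>

definition monov :: "(nat \<Rightarrow> 'b::comm_ring_1) \<Rightarrow> (nat \<Rightarrow>\<^sub>0 nat) \<Rightarrow> 'b" where
  "monov \<sigma> u = (\<Prod>i\<in>keys u. \<sigma> i ^ lookup u i)"

lemma monov_superset:
  "finite A \<Longrightarrow> keys u \<subseteq> A \<Longrightarrow> monov \<sigma> u = (\<Prod>i\<in>A. \<sigma> i ^ lookup u i)"
  unfolding monov_def by (intro prod.mono_neutral_left) (auto simp: in_keys_iff)

lemma monov_add: "monov \<sigma> (u + v) = monov \<sigma> u * monov \<sigma> v"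
  using monov_superset[of "keys u \<union> keys v" "u + v" \<sigma>]
    monov_superset[of "keys u \<union> keys v" u \<sigma>] monov_superset[of "keys u \<union> keys v" v \<sigma>]
  by (simp add: keys_add_nat lookup_add prod.distrib power_add)

lemma monov_0 [simp]: "monov \<sigma> 0 = 1"
  by (simp add: monov_def)

lemma monov_single [simp]: "monov \<sigma> (single i 1) = \<sigma> i"
  by (simp add: monov_def)

lemma poly_subst_lsum: "poly_subst \<sigma> p = lsum Cst (monov \<sigma>) p"
  by (simp add: poly_subst_def lsum_def monov_def)

lemma poly_subst_add: "poly_subst \<sigma> (p + q) = poly_subst \<sigma> p + poly_subst \<sigma> q"
  by (simp add: poly_subst_lsum)

lemma poly_subst_diff: "poly_subst \<sigma> (p - q) = poly_subst \<sigma> p - poly_subst \<sigma> q"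
  by (simp add: poly_subst_lsum)

lemma poly_subst_mult: "poly_subst \<sigma> (p * q) = poly_subst \<sigma> p * poly_subst \<sigma> q"
  unfolding poly_subst_lsum by (rule lsum_mult) (simp_all add: Cst_add Cst_mult monov_add)

lemma poly_subst_Cst [simp]: "poly_subst \<sigma> (Cst b) = Cst b"
proof -
  have "lsum Cst (monov \<sigma>) (Cst b * mono 0) = Cst b"
    by (simp del: mono_0)
  then show ?thesis by (simp add: poly_subst_lsum)
qed

lemma poly_subst_0 [simp]: "poly_subst \<sigma> 0 = 0"
  by (simp add: poly_subst_lsum)

lemma poly_subst_1 [simp]: "poly_subst \<sigma> 1 = 1"
  using poly_subst_Cst[of \<sigma> 1] by simp

lemma poly_subst_Var [simp]: "poly_subst \<sigma> (Var i) = \<sigma> i"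
  by (simp add: poly_subst_lsum Var_def del: One_nat_def)

lemma poly_subst_sum: "poly_subst \<sigma> (sum f A) = (\<Sum>x\<in>A. poly_subst \<sigma> (f x))"
  by (simp add: poly_subst_lsum)

lemma poly_subst_prod: "poly_subst \<sigma> (prod f A) = (\<Prod>x\<in>A. poly_subst \<sigma> (f x))"
  by (induction A rule: infinite_finite_induct) (simp_all add: poly_subst_mult)

lemma poly_subst_power: "poly_subst \<sigma> (p ^ k) = poly_subst \<sigma> p ^ k"
  by (induction k) (simp_all add: poly_subst_mult)

lemmas poly_subst_simps =
  poly_subst_add poly_subst_diff poly_subst_mult poly_subst_sum poly_subst_prod poly_subst_power

lemma lookup_map_coeffs [simp]: "lookup (map_coeffs f) u = Cst (lookup f u)"
  by (simp add: map_coeffs_def Poly_Mapping.map.rep_eq when_def)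

lemma keys_map_coeffs [simp]: "keys (map_coeffs f) = keys f"
  by (auto simp: in_keys_iff)

lemma map_coeffs_add: "map_coeffs (f + g) = map_coeffs f + map_coeffs g"
  by (rule poly_mapping_eqI) (simp add: lookup_add Cst_add)

lemma map_coeffs_0 [simp]: "map_coeffs 0 = 0"
  by (rule poly_mapping_eqI) simp

lemma map_coeffs_sum: "map_coeffs (sum f A) = (\<Sum>x\<in>A. map_coeffs (f x))"
  by (induction A rule: infinite_finite_induct) (simp_all add: map_coeffs_add)

lemma map_coeffs_mono [simp]: "map_coeffs (mono u) = mono u"
  by (rule poly_mapping_eqI) (simp add: lookup_mono)

lemma map_coeffs_Var [simp]: "map_coeffs (Var i) = Var i"
  by (simp add: Var_def)

lemma map_coeffs_Cst_mult: "map_coeffs (Cst b * f) = Cst (Cst b) * map_coeffs f"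
  by (rule poly_mapping_eqI) (simp add: Cst_mult)

lemma map_coeffs_polys: "f \<in> polys V \<Longrightarrow> map_coeffs f \<in> polys V"
  by (simp add: polys_def)

lemma map_coeffs_forms: "f \<in> forms n d \<Longrightarrow> map_coeffs f \<in> forms n d"
  by (simp add: forms_def map_coeffs_polys)

lemma lsum_map_coeffs: "lsum (\<lambda>x. x) g (map_coeffs f) = lsum Cst g f"
  by (simp add: lsum_def)

lemma lsum_Cst_map_coeffs: "lsum Cst g (map_coeffs f) = lsum (\<lambda>x. Cst (Cst x)) g f"
  by (simp add: lsum_def)

section \<open>Ideals and primes\<close>

text \<open>Ideals of a whole ring type, without a carrier; \<open>ideal_UNIV_iff\<close> identifies
  them with the ideals of \<open>mpoly_ring UNIV\<close>.\<close>

definition ideal_set :: "'b::comm_ring_1 set \<Rightarrow> bool" where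
  "ideal_set A \<longleftrightarrow> 0 \<in> A \<and> (\<forall>x\<in>A. \<forall>y\<in>A. x + y \<in> A) \<and> (\<forall>b. \<forall>x\<in>A. b * x \<in> A)"

lemma ideal_setI:
  "0 \<in> A \<Longrightarrow> (\<And>x y. x \<in> A \<Longrightarrow> y \<in> A \<Longrightarrow> x + y \<in> A) \<Longrightarrow> (\<And>b x. x \<in> A \<Longrightarrow> b * x \<in> A) \<Longrightarrow> ideal_set A"
  by (auto simp: ideal_set_def)

context
  fixes A :: "'b::comm_ring_1 set"
  assumes A: "ideal_set A"
begin

lemma ideal_set_0: "0 \<in> A"
  using A by (simp add: ideal_set_def)

lemma ideal_set_add: "x \<in> A \<Longrightarrow> y \<in> A \<Longrightarrow> x + y \<in> A"
  using A by (simp add: ideal_set_def)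

lemma ideal_set_mult: "x \<in> A \<Longrightarrow> b * x \<in> A"
  using A by (simp add: ideal_set_def)

lemma ideal_set_mult_right: "x \<in> A \<Longrightarrow> x * b \<in> A"
  using ideal_set_mult[of x b] by (simp add: mult.commute)

lemma ideal_set_uminus: "x \<in> A \<Longrightarrow> - x \<in> A"
  using ideal_set_mult[of x "-1"] by simp

lemma ideal_set_diff: "x \<in> A \<Longrightarrow> y \<in> A \<Longrightarrow> x - y \<in> A"
  using ideal_set_add[of x "- y"] ideal_set_uminus[of y] by simp

lemma ideal_set_sum: "(\<And>x. x \<in> B \<Longrightarrow> f x \<in> A) \<Longrightarrow> sum f B \<in> A"
  by (induction B rule: infinite_finite_induct) (auto intro: ideal_set_0 ideal_set_add)

lemma ideal_set_cong_trans: "x - y \<in> A \<Longrightarrow> y - z \<in> A \<Longrightarrow> x - z \<in> A"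
  using ideal_set_add[of "x - y" "y - z"] by simp

lemma ideal_set_cong_sym: "x - y \<in> A \<Longrightarrow> y - x \<in> A"
  using ideal_set_uminus[of "x - y"] by simp

lemma ideal_set_cong_mult: "x - y \<in> A \<Longrightarrow> x' - y' \<in> A \<Longrightarrow> x * x' - y * y' \<in> A"
  using ideal_set_add[OF ideal_set_mult_right[of "x - y" x'] ideal_set_mult[of "x' - y'" y]]
  by (simp add: algebra_simps)

lemma ideal_set_cong_sum: "(\<And>x. x \<in> B \<Longrightarrow> f x - g x \<in> A) \<Longrightarrow> sum f B - sum g B \<in> A"
  by (simp add: ideal_set_sum flip: sum_subtractf)

lemma ideal_set_cong_mem: "x - y \<in> A \<Longrightarrow> y \<in> A \<Longrightarrow> x \<in> A"
  using ideal_set_add[of "x - y" y] by simp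

lemma ideal_set_cong_prod: "(\<And>x. x \<in> B \<Longrightarrow> f x - g x \<in> A) \<Longrightarrow> prod f B - prod g B \<in> A"
  by (induction B rule: infinite_finite_induct) (auto intro: ideal_set_0 ideal_set_cong_mult)

end

definition prime_set :: "'b::comm_ring_1 set \<Rightarrow> bool" where
  "prime_set P \<longleftrightarrow> ideal_set P \<and> 1 \<notin> P \<and> (\<forall>a b. a * b \<in> P \<longrightarrow> a \<in> P \<or> b \<in> P)"

lemma prime_set_ideal: "prime_set P \<Longrightarrow> ideal_set P"
  by (simp add: prime_set_def)

lemma prime_set_1: "prime_set P \<Longrightarrow> 1 \<notin> P"
  by (simp add: prime_set_def)

lemma prime_set_mult: "prime_set P \<Longrightarrow> a \<notin> P \<Longrightarrow> b \<notin> P \<Longrightarrow> a * b \<notin> P"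
  by (auto simp: prime_set_def)

lemma prime_set_prod: "prime_set P \<Longrightarrow> (\<And>x. x \<in> B \<Longrightarrow> f x \<notin> P) \<Longrightarrow> prod f B \<notin> P"
  by (induction B rule: infinite_finite_induct) (auto simp: prime_set_1 dest: prime_set_mult[rotated 2])

lemma prime_set_power: "prime_set P \<Longrightarrow> a \<notin> P \<Longrightarrow> a ^ k \<notin> P"
  by (induction k) (auto simp: prime_set_1 dest: prime_set_mult[rotated 2])

lemma prime_set_multD:
  assumes "prime_set P" "a * b \<notin> P"
  shows "a \<notin> P" "b \<notin> P"
  using assms ideal_set_mult[of P b a] ideal_set_mult_right[of P a b] prime_set_ideal by blast+

lemma prime_set_cong: "prime_set P \<Longrightarrow> x - y \<in> P \<Longrightarrow> y \<notin> P \<Longrightarrow> x \<notin> P"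
  using ideal_set_cong_mem ideal_set_cong_sym prime_set_ideal by blast

text \<open>For ideals \<open>K\<close> and primes \<open>P\<close>, the kernel of the map from the
  ring to the localisation at \<open>P\<close> of its quotient by \<open>K\<close>. Working modulo
  \<open>loc K P\<close> is working over that local ring.\<close>

definition loc :: "'b::comm_ring_1 set \<Rightarrow> 'b set \<Rightarrow> 'b set" where
  "loc K P = {b. \<exists>s. s \<notin> P \<and> s * b \<in> K}"

context
  fixes K P :: "'b::comm_ring_1 set"
  assumes K: "ideal_set K" and P: "prime_set P"
begin

lemma ideal_set_loc: "ideal_set (loc K P)"
proof (rule ideal_setI)
  show "0 \<in> loc K P"
    using prime_set_1[OF P] ideal_set_0[OF K] by (auto simp: loc_def)
next
  fix x y assume "x \<in> loc K P" "y \<in> loc K P"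
  then obtain s r where "s \<notin> P" "s * x \<in> K" "r \<notin> P" "r * y \<in> K"
    by (auto simp: loc_def)
  moreover have "(s * r) * (x + y) = r * (s * x) + s * (r * y)" by (simp add: algebra_simps)
  ultimately show "x + y \<in> loc K P"
    unfolding loc_def using prime_set_mult[OF P]
    by (metis (mono_tags, lifting) ideal_set_add[OF K] ideal_set_mult[OF K] mem_Collect_eq)
next
  fix b x assume "x \<in> loc K P"
  then obtain s where "s \<notin> P" "s * x \<in> K" by (auto simp: loc_def)
  moreover have "s * (b * x) = b * (s * x)" by (simp add: mult.left_commute)
  ultimately show "b * x \<in> loc K P"
    unfolding loc_def using ideal_set_mult[OF K, of "s * x" b] by (intro CollectI exI[of _ s]) (simp add: mult_ac)
qed

lemma loc_superset: "K \<subseteq> loc K P"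
  using prime_set_1[OF P] by (auto simp: loc_def intro!: exI[of _ 1])

lemma loc_subset: "K \<subseteq> P \<Longrightarrow> loc K P \<subseteq> P"
  using P by (auto simp: loc_def prime_set_def)

lemma loc_cancel: "s \<notin> P \<Longrightarrow> s * b \<in> loc K P \<Longrightarrow> b \<in> loc K P"
  unfolding loc_def using prime_set_mult[OF P] by (auto simp flip: mult.assoc)

end

text \<open>Zorn's lemma gives an ideal maximal among those that contain \<open>A\<close> and avoid
  all powers of \<open>t\<close>; such an ideal is prime.\<close>

lemma ex_prime_avoiding:
  fixes A :: "'b::comm_ring_1 set"
  assumes A: "ideal_set A" and t: "\<And>j. t ^ j \<notin> A"
  shows "\<exists>P. prime_set P \<and> A \<subseteq> P \<and> t \<notin> P"
proof -
  define \<A> where "\<A> = {B. ideal_set B \<and> A \<subseteq> B \<and> (\<forall>j. t ^ j \<notin> B)}"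
  have "\<exists>M\<in>\<A>. \<forall>X\<in>\<A>. M \<subseteq> X \<longrightarrow> X = M"
  proof (rule subset_Zorn_nonempty)
    show "\<A> \<noteq> {}" using A t by (auto simp: \<A>_def)
  next
    fix \<C> assume C: "\<C> \<noteq> {}" "subset.chain \<A> \<C>"
    then have sub: "\<C> \<subseteq> \<A>" and lin: "\<And>X Y. X \<in> \<C> \<Longrightarrow> Y \<in> \<C> \<Longrightarrow> X \<subseteq> Y \<or> Y \<subseteq> X"
      by (auto simp: subset.chain_def)
    have id: "ideal_set X" if "X \<in> \<C>" for X using sub that by (auto simp: \<A>_def)
    have "ideal_set (\<Union>\<C>)"
    proof (rule ideal_setI)
      show "0 \<in> \<Union>\<C>" using C(1) ideal_set_0[OF id] by blast
    next
      fix x y assume "x \<in> \<Union>\<C>" "y \<in> \<Union>\<C>"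
      then obtain X Y where "X \<in> \<C>" "Y \<in> \<C>" "x \<in> X" "y \<in> Y" by blast
      then obtain Z where "Z \<in> \<C>" "x \<in> Z" "y \<in> Z" using lin[of X Y] by blast
      then show "x + y \<in> \<Union>\<C>" using ideal_set_add[OF id] by blast
    next
      fix b x assume "x \<in> \<Union>\<C>"
      then show "b * x \<in> \<Union>\<C>" using ideal_set_mult[OF id] by blast
    qed
    moreover have "A \<subseteq> \<Union>\<C>" using C(1) sub by (auto simp: \<A>_def)
    moreover have "t ^ j \<notin> \<Union>\<C>" for j using sub by (auto simp: \<A>_def)
    ultimately show "\<Union>\<C> \<in> \<A>" by (simp add: \<A>_def)
  qed
  then obtain P where P: "P \<in> \<A>" and max: "\<And>X. X \<in> \<A> \<Longrightarrow> P \<subseteq> X \<Longrightarrow> X = P" by blast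
  have iP: "ideal_set P" and tP: "\<And>j. t ^ j \<notin> P" and AP: "A \<subseteq> P"
    using P by (auto simp: \<A>_def)
  \<comment> \<open>By maximality, adjoining an element outside \<open>P\<close> produces a power of
    \<open>t\<close>.\<close>
  have ext: "\<exists>j b p. p \<in> P \<and> t ^ j = p + b * a" if "a \<notin> P" for a
  proof -
    define X where "X = {p + b * a |p b. p \<in> P}"
    have "ideal_set X"
    proof (rule ideal_setI)
      show "0 \<in> X" unfolding X_def using ideal_set_0[OF iP] by (auto intro!: exI[of _ 0])
    next
      fix x y assume "x \<in> X" "y \<in> X"
      then obtain p b q c where "x = p + b * a" "y = q + c * a" "p \<in> P" "q \<in> P"
        by (auto simp: X_def)
      then show "x + y \<in> X" unfolding X_def
        using ideal_set_add[OF iP]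
        by (intro CollectI exI[of _ "p + q"] exI[of _ "b + c"]) (simp add: algebra_simps)
    next
      fix c x assume "x \<in> X"
      then obtain p b where "x = p + b * a" "p \<in> P" by (auto simp: X_def)
      then show "c * x \<in> X" unfolding X_def
        using ideal_set_mult[OF iP]
        by (intro CollectI exI[of _ "c * p"] exI[of _ "c * b"]) (simp add: distrib_left mult.assoc)
    qed
    moreover have "P \<subseteq> X"
    proof
      fix p assume "p \<in> P"
      then show "p \<in> X" unfolding X_def by (intro CollectI exI[of _ p] exI[of _ 0]) simp
    qed
    moreover have "a \<in> X" unfolding X_def
      using ideal_set_0[OF iP] by (intro CollectI exI[of _ 0] exI[of _ 1]) simp
    ultimately have "X \<notin> \<A>" using max[of X] that by blast
    then obtain j where "t ^ j \<in> X"
      using \<open>ideal_set X\<close> \<open>P \<subseteq> X\<close> AP by (auto simp: \<A>_def)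
    then show ?thesis by (auto simp: X_def)
  qed
  have "prime_set P"
    unfolding prime_set_def
  proof (intro conjI allI impI iP)
    show "1 \<notin> P" using tP[of 0] by simp
  next
    fix a b assume ab: "a * b \<in> P"
    show "a \<in> P \<or> b \<in> P"
    proof (rule ccontr)
      assume "\<not> (a \<in> P \<or> b \<in> P)"
      then obtain j c p k d q where *: "p \<in> P" "t ^ j = p + c * a" "q \<in> P" "t ^ k = q + d * b"
        using ext by metis
      have "t ^ (j + k) = p * (q + d * b) + c * a * q + c * d * (a * b)"
        by (simp add: power_add * algebra_simps)
      also have "\<dots> \<in> P"
        using * ab
        by (intro ideal_set_add[OF iP]) (auto intro: ideal_set_mult[OF iP] ideal_set_mult_right[OF iP])
      finally show False using tP by blast
    qed
  qed
  then show ?thesis using AP tP[of 1] by auto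
qed

text \<open>Applied to ideals such as \<open>{r. Cst r * v \<in> N}\<close>, this passes from
  membership of \<open>v\<close> after localising at each prime to \<open>v \<in> N\<close>.\<close>

lemma local_global:
  fixes A :: "'b::comm_ring_1 set"
  assumes "ideal_set A" "\<And>P. prime_set P \<Longrightarrow> A \<subseteq> P \<Longrightarrow> \<exists>s\<in>A. s \<notin> P"
  shows "1 \<in> A"
proof (rule ccontr)
  assume "1 \<notin> A"
  then obtain P where "prime_set P" "A \<subseteq> P" using ex_prime_avoiding[of A 1] assms(1) by auto
  then show False using assms(2) by blast
qed

lemma power_mem_local:
  fixes A :: "'b::comm_ring_1 set"
  assumes "ideal_set A" "\<And>P. prime_set P \<Longrightarrow> A \<subseteq> P \<Longrightarrow> t \<notin> P \<Longrightarrow> \<exists>s\<in>A. s \<notin> P"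
  shows "\<exists>j. t ^ j \<in> A"
  using ex_prime_avoiding[of A t] assms by blast

text \<open>The coordinates have no common annihilator modulo \<open>A\<close>. This is what
  cancellation needs, and it is weaker than generating the unit ideal.\<close>

definition faithful :: "nat \<Rightarrow> 'b::comm_ring_1 set \<Rightarrow> (nat \<Rightarrow> 'b) \<Rightarrow> bool" where
  "faithful n A v \<longleftrightarrow> (\<forall>b. (\<forall>i\<le>n. b * v i \<in> A) \<longrightarrow> b \<in> A)"

lemma faithfulD: "faithful n A v \<Longrightarrow> (\<And>i. i \<le> n \<Longrightarrow> b * v i \<in> A) \<Longrightarrow> b \<in> A"
  by (auto simp: faithful_def)

text \<open>If \<open>m k \<ge> 2\<close>, then \<open>v k ^ (m k - 1) * b\<close> satisfies the
  hypotheses with exponent 1 at \<open>k\<close>, so it lies in \<open>A\<close> by induction; hence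
  the exponent at \<open>k\<close> drops to \<open>m k - 1\<close>. This makes
  \<open>chain_ideal\<close> saturated.\<close>

lemma faithful_power:
  assumes A: "ideal_set A" and v: "faithful n A v" and "\<And>i. i \<le> n \<Longrightarrow> v i ^ m i * b \<in> A"
  shows "b \<in> A"
  using assms(3)
proof (induction "\<Sum>i\<le>n. m i" arbitrary: m b rule: less_induct)
  case (less m)
  show ?case
  proof (cases "\<forall>i\<le>n. m i \<le> 1")
    case True
    then have "b * v i \<in> A" if "i \<le> n" for i
      using less(2)[OF that] that ideal_set_mult_right[OF A, of b "v i"]
      by (cases "m i = 0") (force simp: mult.commute le_Suc_eq)+
    then show ?thesis by (rule faithfulD[OF v])
  next
    case False
    then obtain k where k: "k \<le> n" "m k \<ge> 2" by force
    have sum: "(\<Sum>i\<le>n. (m(k := x)) i) = (\<Sum>i\<in>{..n}-{k}. m i) + x" for x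
      using k by (subst sum.remove[of _ k]) auto
    have lt: "(\<Sum>i\<le>n. (m(k := x)) i) < (\<Sum>i\<le>n. m i)" if "x < m k" for x
      using sum[of x] sum[of "m k"] that by simp
    have 1: "v k ^ (m k - 1) * b \<in> A"
    proof (rule less(1)[of "m(k := 1)"])
      show "(\<Sum>i\<le>n. (m(k := 1)) i) < (\<Sum>i\<le>n. m i)" using lt k by simp
      fix i assume "i \<le> n"
      show "v i ^ (m(k := 1)) i * (v k ^ (m k - 1) * b) \<in> A"
      proof (cases "i = k")
        case True
        have "v k * (v k ^ (m k - 1) * b) = v k ^ m k * b"
          using k by (simp flip: mult.assoc power_Suc)
        then show ?thesis using True less(2)[OF k(1)] by simp
      next
        case False
        then show ?thesis
          using ideal_set_mult[OF A less(2)[OF \<open>i \<le> n\<close>], of "v k ^ (m k - 1)"]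
          by (simp add: mult.left_commute)
      qed
    qed
    show ?thesis
    proof (rule less(1)[of "m(k := m k - 1)"])
      show "(\<Sum>i\<le>n. (m(k := m k - 1)) i) < (\<Sum>i\<le>n. m i)" using lt k by simp
      fix i assume "i \<le> n"
      then show "v i ^ (m(k := m k - 1)) i * b \<in> A" using 1 less(2) by simp
    qed
  qed
qed

section \<open>Chains of points and independence of the parameter\<close>

section \<open>Multiplication by powers of \<open>1 + z\<close>\<close>

text \<open>A vector \<open>v\<close> is read as the power series \<open>\<Sum>i. v i * z ^ i\<close>.\<close>

definition tw :: "'k::field_char_0 \<Rightarrow> (nat \<Rightarrow> 'k mpoly) \<Rightarrow> nat \<Rightarrow> 'k mpoly" where
  "tw s v i = (\<Sum>k\<le>i. Cst (s gchoose k) * v (i - k))"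

lemma tw_0 [simp]: "tw 0 v = v"
  by (rule ext) (simp add: tw_def gbinomial_0_left if_distrib[of Cst] if_distrib[of "\<lambda>x. x * _"] sum.delta cong: if_cong)

lemma sum_atMost_triangle:
  fixes f :: "nat \<Rightarrow> nat \<Rightarrow> 'b::comm_monoid_add"
  shows "(\<Sum>k\<le>i. \<Sum>l\<le>i - k. f k l) = (\<Sum>m\<le>i. \<Sum>k\<le>m. f k (m - k))"
proof -
  have "(\<Sum>k\<le>i. \<Sum>l\<le>i - k. f k l) = (\<Sum>(k, l)\<in>(SIGMA k:{..i}. {..i - k}). f k l)"
    by (simp add: sum.Sigma)
  also have "(SIGMA k:{..i}. {..i - k}) = {(k, l). k + l \<le> i}" by auto
  also have "(\<Sum>(k, l)\<in>{(k, l). k + l \<le> i}. f k l) = (\<Sum>m\<le>i. \<Sum>k\<le>m. f k (m - k))"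
    by (rule sum.triangle_reindex_eq)
  finally show ?thesis .
qed

lemma tw_tw: "tw s (tw r v) = tw (s + r) v"
proof
  fix i
  have "tw s (tw r v) i
      = (\<Sum>k\<le>i. \<Sum>l\<le>i - k. Cst (s gchoose k) * (Cst (r gchoose l) * v (i - k - l)))"
    by (simp add: tw_def sum_distrib_left)
  also have "\<dots> = (\<Sum>m\<le>i. \<Sum>k\<le>m. Cst (s gchoose k) * (Cst (r gchoose (m - k)) * v (i - k - (m - k))))"
    by (rule sum_atMost_triangle)
  also have "\<dots> = (\<Sum>m\<le>i. Cst (\<Sum>k\<le>m. (s gchoose k) * (r gchoose (m - k))) * v (i - m))"
    by (simp add: Cst_sum Cst_mult sum_distrib_right mult.assoc)
  also have "\<dots> = tw (s + r) v i"
    by (simp add: tw_def gbinomial_Vandermonde flip: atLeast0AtMost)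
  finally show "tw s (tw r v) i = tw (s + r) v i" .
qed

lemma tw_mult: "tw s (\<lambda>i. b * v i) i = b * tw s v i"
  by (simp add: tw_def sum_distrib_left mult.left_commute)

lemma tw_mem:
  "ideal_set A \<Longrightarrow> (\<And>k. k \<le> i \<Longrightarrow> v k \<in> A) \<Longrightarrow> tw s v i \<in> A"
  unfolding tw_def by (rule ideal_set_sum) (auto intro: ideal_set_mult)

lemma tw_diff: "tw s (\<lambda>i. v i - w i) i = tw s v i - tw s w i"
  by (simp add: tw_def right_diff_distrib sum_subtractf)

lemma tw_cong_ideal:
  assumes A: "ideal_set A" and "\<And>k. k \<le> i \<Longrightarrow> h * v k - e * w k \<in> A"
  shows "h * tw s v i - e * tw s w i \<in> A"
  using tw_mem[OF A, of i "\<lambda>i. h * v i - e * w i" s] assms(2) by (simp add: tw_diff tw_mult)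

text \<open>The series \<open>(1 + z) ^ s\<close> has constant term 1, so it fixes the leading
  coefficient of \<open>v\<close> modulo \<open>A\<close>.\<close>

lemma tw_lead:
  assumes "ideal_set A" "\<And>k. k < i \<Longrightarrow> v k \<in> A"
  shows "tw s v i - v i \<in> A"
proof -
  have "tw s v i - v i = (\<Sum>k\<in>{..i}-{0}. Cst (s gchoose k) * v (i - k))"
    unfolding tw_def by (subst sum.remove[of _ 0]) auto
  also have "\<dots> \<in> A"
    by (rule ideal_set_sum[OF assms(1)]) (auto intro!: ideal_set_mult[OF assms(1)] assms(2))
  finally show ?thesis .
qed

text \<open>Multiplication by \<open>(1 + z) ^ s\<close> is undone by
  \<open>(1 + z) ^ (- s)\<close>, and both are triangular, so only coordinates up to
  \<open>n\<close> are involved.\<close>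

lemma faithful_tw:
  assumes A: "ideal_set A" and v: "faithful n A v"
  shows "faithful n A (tw s v)"
  unfolding faithful_def
proof (intro allI impI)
  fix b assume b: "\<forall>i\<le>n. b * tw s v i \<in> A"
  show "b \<in> A"
  proof (rule faithfulD[OF v])
    fix i assume "i \<le> n"
    then have "tw (- s) (\<lambda>i. b * tw s v i) i \<in> A" using b by (intro tw_mem[OF A]) auto
    then show "b * v i \<in> A" by (simp add: tw_mult tw_tw)
  qed
qed

section \<open>Chains of points\<close>

text \<open>\<open>link n a A p q\<close> says that, modulo \<open>A\<close>, the pair \<open>(p, q)\<close> annihilates the quadratic
  relations \<open>((1 + \<Delta>)\<^bsup>- a - j\<^esup> X\<^sub>i) * X\<^sub>j = ((1 + \<Delta>)\<^bsup>- a - i\<^esup> X\<^sub>j) * X\<^sub>i\<close> of \<open>R(n, a)\<close>.\<close>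

definition link ::
    "nat \<Rightarrow> 'k::field_char_0 \<Rightarrow> 'k mpoly set \<Rightarrow> (nat \<Rightarrow> 'k mpoly) \<Rightarrow> (nat \<Rightarrow> 'k mpoly) \<Rightarrow> bool" where
  "link n a A p q \<longleftrightarrow>
     (\<forall>i\<le>n. \<forall>j\<le>n. q j * tw (- (a + of_nat j)) p i - q i * tw (- (a + of_nat i)) p j \<in> A)"

text \<open>A link says that \<open>\<Sum>i j. q j * tw (- (a + j)) p i * z ^ i * w ^ j\<close> is symmetric in \<open>z\<close> and
  \<open>w\<close>, and this survives multiplication by \<open>(1 + z + w) ^ s\<close>.\<close>

lemma link_tw:
  assumes A: "ideal_set A" and l: "link n a A p q"
  shows "link n a A (tw s p) (tw s q)"
  unfolding link_def
proof (intro allI impI)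
  fix i j assume ij: "i \<le> n" "j \<le> n"
  define b where "b i j = q j * tw (- (a + of_nat j)) p i" for i j
  \<comment> \<open>The coefficient of \<open>w ^ k * z ^ l\<close> in
    \<open>(1 + z + w) ^ s\<close>, symmetric in \<open>k\<close> and \<open>l\<close>.\<close>
  define c where "c k l = (s gchoose k) * (s - of_nat k gchoose l)" for k l
  have sym: "c k l = c l k" for k l
  proof -
    have "c k l = (s gchoose (k + l)) * (of_nat (k + l) gchoose k)"
      using gbinomial_trinomial_revision[of k "k + l" s] by (simp add: c_def)
    moreover have "c l k = (s gchoose (k + l)) * (of_nat (k + l) gchoose l)"
      using gbinomial_trinomial_revision[of l "k + l" s] by (simp add: c_def)
    moreover have "(of_nat (k + l) gchoose k) = (of_nat (k + l) gchoose l :: 'a)"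
      using gbinomial_of_nat_symmetric[of k "k + l"] by simp
    ultimately show ?thesis by simp
  qed
  have T: "tw s q j * tw (- (a + of_nat j)) (tw s p) i
      = (\<Sum>k\<le>j. \<Sum>l\<le>i. Cst (c k l) * b (i - l) (j - k))" for i j
  proof -
    \<comment> \<open>The shift by \<open>w ^ k\<close> lowers \<open>j\<close> by \<open>k\<close>
      and so raises the exponent \<open>- (a + j)\<close> by \<open>k\<close>; the remaining twist
      is \<open>s - k\<close>, as in the expansion of \<open>(1 + z + w) ^ s\<close> in powers of
      \<open>w\<close>.\<close>
    have "tw (- (a + of_nat j)) (tw s p) i
        = tw (s - of_nat k) (tw (- (a + of_nat (j - k))) p) i" if "k \<le> j" for k
      using that by (simp add: tw_tw of_nat_diff algebra_simps)
    then have "tw s q j * tw (- (a + of_nat j)) (tw s p) i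
      = (\<Sum>k\<le>j. Cst (s gchoose k) * q (j - k) *
           tw (s - of_nat k) (tw (- (a + of_nat (j - k))) p) i)"
      by (simp add: tw_def[of s q] sum_distrib_right)
    then show ?thesis
      by (simp add: tw_def[of "s - of_nat _"] sum_distrib_left b_def c_def Cst_mult mult_ac)
  qed
  have "tw s q i * tw (- (a + of_nat i)) (tw s p) j
      = (\<Sum>k\<le>j. \<Sum>l\<le>i. Cst (c k l) * b (j - k) (i - l))"
    unfolding T by (subst sum.swap) (simp add: sym)
  then have "tw s q j * tw (- (a + of_nat j)) (tw s p) i - tw s q i * tw (- (a + of_nat i)) (tw s p) j
      = (\<Sum>k\<le>j. \<Sum>l\<le>i. Cst (c k l) * (b (i - l) (j - k) - b (j - k) (i - l)))"
    unfolding T by (simp add: sum_subtractf right_diff_distrib)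
  also have "\<dots> \<in> A"
  proof (intro ideal_set_sum[OF A] ideal_set_mult[OF A])
    fix k k' assume "k \<in> {..j}" "k' \<in> {..i}"
    then have "i - k' \<le> n" "j - k \<le> n" using ij by auto
    then show "b (i - k') (j - k) - b (j - k) (i - k') \<in> A"
      using l unfolding link_def b_def by blast
  qed
  finally show "tw s q j * tw (- (a + of_nat j)) (tw s p) i
      - tw s q i * tw (- (a + of_nat i)) (tw s p) j \<in> A" .
qed

lemma link_param: "link n a A (tw (a - b) p) q \<longleftrightarrow> link n b A p q"
  by (simp add: link_def tw_tw algebra_simps)

text \<open>Models a point module over the quotient by \<open>A\<close> with a chosen generator in
  each degree: \<open>c d i\<close> is the action of the variable \<open>i\<close> from degree
  \<open>d\<close> to \<open>d + 1\<close>. The ideal \<open>A\<close> varies, so that one notion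
  covers all base rings.\<close>

definition chain ::
    "nat \<Rightarrow> 'k::field_char_0 \<Rightarrow> 'k mpoly set \<Rightarrow> (nat \<Rightarrow> nat \<Rightarrow> 'k mpoly) \<Rightarrow> bool" where
  "chain n a A c \<longleftrightarrow>
     ideal_set A \<and> (\<forall>d. faithful n A (c d)) \<and> (\<forall>d. link n a A (c d) (c (Suc d)))"

lemma chainD:
  assumes "chain n a A c"
  shows "ideal_set A" "faithful n A (c d)" "link n a A (c d) (c (Suc d))"
  using assms by (auto simp: chain_def)

lemma chain_param:
  assumes "chain n a A c"
  shows "chain n b A (\<lambda>d. tw (of_nat d * (a - b)) (c d))"
  unfolding chain_def
proof (intro conjI allI)
  note c = chainD[OF assms]
  show "ideal_set A" by (rule c)
  fix d
  show "faithful n A (tw (of_nat d * (a - b)) (c d))" by (rule faithful_tw[OF c(1,2)])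
  have "link n a A (tw (of_nat (Suc d) * (a - b)) (c d)) (tw (of_nat (Suc d) * (a - b)) (c (Suc d)))"
    by (rule link_tw[OF c(1,3)])
  moreover have "tw (of_nat (Suc d) * (a - b)) (c d) = tw (a - b) (tw (of_nat d * (a - b)) (c d))"
    by (simp add: tw_tw algebra_simps)
  ultimately show "link n b A (tw (of_nat d * (a - b)) (c d)) (tw (of_nat (Suc d) * (a - b)) (c (Suc d)))"
    by (simp add: link_param)
qed

text \<open>Equations valid at the first point of every chain over every quotient of
  \<open>B\<close>, so that the scheme structure is captured and not only the set of points. Each
  homogeneous part is tested, since the coordinates of a point are defined only up to a
  factor.\<close>

definition chain_ideal :: "nat \<Rightarrow> 'k::field_char_0 \<Rightarrow> 'k mpoly set" where
  "chain_ideal n a =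
     {f \<in> polys {..n}. \<forall>A c. chain n a A c \<longrightarrow> (\<forall>e. poly_subst (c 0) (hom_part e f) \<in> A)}"

lemma chain_ideal_param: "chain_ideal n a = chain_ideal n b"
proof -
  have "chain_ideal n a \<subseteq> chain_ideal n b" for a b :: 'a
  proof
    fix f assume f: "f \<in> chain_ideal n a"
    have "poly_subst (c 0) (hom_part e f) \<in> A" if "chain n b A c" for A c e
      using f chain_param[OF that, of a] by (force simp: chain_ideal_def)
    then show "f \<in> chain_ideal n b" using f by (auto simp: chain_ideal_def)
  qed
  then show ?thesis by blast
qed

section \<open>The product of the algebra and the functionals of a chain\<close>

section \<open>The product of \<open>R(n, a)\<close> on monomials\<close>

lemma pdiff_lsum:
  "pdiff i p = lsum Cst (\<lambda>u. single (u - single i 1) (of_nat (lookup u i))) p"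
  for p :: "'a::comm_ring_1 mpoly"
  unfolding pdiff_def lsum_def
  by (simp add: single_eq_Cst_mono Cst_mult mult_ac)

lemma pdiff_mono: "pdiff i (mono u :: 'a::comm_ring_1 mpoly) = single (u - single i 1) (of_nat (lookup u i))"
  by (simp add: pdiff_lsum)

lemma pdiff_add: "pdiff i (p + q) = pdiff i p + pdiff i (q :: 'a::comm_ring_1 mpoly)"
  by (simp add: pdiff_lsum)

lemma pdiff_Cst_mult: "pdiff i (Cst b * p) = Cst b * pdiff i (p :: 'a::comm_ring_1 mpoly)"
  by (simp add: pdiff_lsum)

lemma pdiff_Var_mult_mono:
  "pdiff i (Var j * mono u) = (if i = j then mono u else 0) + Var j * pdiff i (mono u :: 'a::comm_ring_1 mpoly)"
proof -
  have V: "Var j * mono v = (mono (single j 1 + v) :: 'a mpoly)" for v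
    by (simp add: Var_def mono_add)
  show ?thesis
  proof (cases "lookup u i = 0")
    case True
    then have "single i 1 + u - single i 1 = u" by simp
    then show ?thesis
      using True by (auto simp: V pdiff_mono lookup_add lookup_single when_def single_eq_Cst_mono)
  next
    case False
    then have *: "single i 1 + (u - single i 1) = u"
      by (intro poly_mapping_eqI) (auto simp: lookup_add lookup_minus lookup_single when_def)
    have "single j 1 + u - single i 1 = single j 1 + (u - single i 1)" if "i \<noteq> j"
      by (intro poly_mapping_eqI) (use False that in \<open>auto simp: lookup_add lookup_minus lookup_single when_def\<close>)
    then show ?thesis
      using * False
      by (auto simp: V pdiff_mono lookup_add lookup_single when_def single_eq_Cst_mono
          mult.left_commute[of "Var j"] Cst_add algebra_simps)
  qed
qed

lemma pdiff_Var_mult: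
  "pdiff i (Var j * p) = (if i = j then p else 0) + Var j * pdiff i (p :: 'a::comm_ring_1 mpoly)"
proof -
  have "pdiff i (Var j * p) = lsum Cst (\<lambda>u. pdiff i (Var j * mono u)) p"
    by (rule linear_eq_lsum[of "\<lambda>p. pdiff i (Var j * p)"])
       (simp_all add: distrib_left pdiff_add mult.left_commute[of "Var j"] pdiff_Cst_mult)
  also have "\<dots> = lsum Cst (\<lambda>u. (if i = j then mono u else 0) + Var j * pdiff i (mono u)) p"
    by (simp only: pdiff_Var_mult_mono)
  also have "\<dots> = (if i = j then p else 0) + Var j * pdiff i p"
    by (rule linear_eq_lsum[of "\<lambda>p. (if i = j then p else 0) + Var j * pdiff i p" Cst, symmetric])
       (simp_all add: distrib_left pdiff_add pdiff_Cst_mult mult.left_commute[of "Var j"] add_ac)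
  finally show ?thesis .
qed

lemma pdiff_1 [simp]: "pdiff i (1 :: 'a::comm_ring_1 mpoly) = 0"
  using pdiff_mono[of i 0] by simp

lemma Delta_add: "Delta n (f + g) = Delta n f + Delta n g"
  by (simp add: Delta_def pdiff_add distrib_left sum.distrib)

lemma Delta_Cst_mult: "Delta n (Cst b * f) = Cst b * Delta n f"
  by (simp add: Delta_def pdiff_Cst_mult sum_distrib_left mult.left_commute)

lemma Delta_0 [simp]: "Delta n 0 = 0"
  using Delta_Cst_mult[of n 0 0] by simp

lemma Delta_sum: "Delta n (sum f A) = (\<Sum>x\<in>A. Delta n (f x))"
  by (induction A rule: infinite_finite_induct) (simp_all add: Delta_add)

lemma Delta_Var_mult:
  "Delta n (Var i * f) = (if 1 \<le> i \<and> i \<le> n then Var (i - 1) * f else 0) + Var i * Delta n f"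
proof -
  have "Delta n (Var i * f) = (\<Sum>j = 1..n. if j = i then Var (j - 1) * f else 0) + Var i * Delta n f"
    by (simp add: Delta_def pdiff_Var_mult distrib_left sum.distrib sum_distrib_left
        mult.left_commute[of "Var i"] if_distrib[of "(*) _"] cong: if_cong)
  then show ?thesis by (simp add: sum.delta)
qed

lemma Delta_1 [simp]: "Delta n 1 = 0"
  by (simp add: Delta_def)

lemma Delta_pow_add: "(Delta n ^^ k) (f + g) = (Delta n ^^ k) f + (Delta n ^^ k) g"
  by (induction k) (simp_all add: Delta_add)

lemma Delta_pow_Cst_mult: "(Delta n ^^ k) (Cst b * f) = Cst b * (Delta n ^^ k) f"
  by (induction k) (simp_all add: Delta_Cst_mult)

lemma Delta_pow_0 [simp]: "(Delta n ^^ k) 0 = 0"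
  by (induction k) simp_all

lemma Delta_pow_mono: "(Delta n ^^ N) f = 0 \<Longrightarrow> N \<le> k \<Longrightarrow> (Delta n ^^ k) f = 0"
  by (metis Delta_pow_0 funpow_add le_add_diff_inverse2 o_apply)

text \<open>In \<open>Delta (X_(i+1) f) = X_i f + X_(i+1) Delta f\<close> the first term has a
  smaller index and the second a smaller order of nilpotency, hence the nested induction.\<close>

lemma Delta_nilpotent_Var:
  assumes "(Delta n ^^ N) f = 0"
  shows "\<exists>M. (Delta n ^^ M) (Var i * f) = 0"
  using assms
proof (induction i arbitrary: N f)
  case 0
  have "(Delta n ^^ k) (Var 0 * f) = Var 0 * (Delta n ^^ k) f" for k
    by (induction k) (simp_all add: Delta_Var_mult)
  then show ?case using 0 by (intro exI[of _ N]) simp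
next
  case (Suc i)
  from Suc.prems show ?case
  proof (induction N arbitrary: f)
    case 0
    then show ?case by simp
  next
    case (Suc N)
    define g where "g = (if Suc i \<le> n then Var i * f else 0)"
    have "\<exists>M. (Delta n ^^ M) g = 0"
      using \<open>\<And>N f. (Delta n ^^ N) f = 0 \<Longrightarrow> \<exists>M. (Delta n ^^ M) (Var i * f) = 0\<close>[OF Suc.prems]
      by (cases "Suc i \<le> n") (simp_all add: g_def)
    then obtain M1 where "(Delta n ^^ M1) g = 0" by blast
    moreover obtain M2 where "(Delta n ^^ M2) (Var (Suc i) * Delta n f) = 0"
      using Suc.IH[of "Delta n f"] Suc.prems by (auto simp: funpow_swap1)
    ultimately have "(Delta n ^^ max M1 M2) (g + Var (Suc i) * Delta n f) = 0"
      using Delta_pow_mono[of M1 n g "max M1 M2"]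
        Delta_pow_mono[of M2 n "Var (Suc i) * Delta n f" "max M1 M2"]
      by (simp add: Delta_pow_add)
    moreover have "Delta n (Var (Suc i) * f) = g + Var (Suc i) * Delta n f"
      by (simp add: Delta_Var_mult g_def)
    ultimately have "(Delta n ^^ Suc (max M1 M2)) (Var (Suc i) * f) = 0"
      by (simp add: funpow_Suc_right del: funpow.simps)
    then show ?case by blast
  qed
qed

lemma Delta_nilpotent:
  fixes f :: "'k::field_char_0 mpoly"
  shows "\<exists>N. (Delta n ^^ N) f = 0"
proof -
  have mono: "\<exists>N. (Delta n ^^ N) (mono (mol is) :: 'k mpoly) = 0" for "is"
  proof (induction "is")
    case Nil
    show ?case by (intro exI[of _ 1]) simp
  next
    case (Cons i "is")
    then show ?case using Delta_nilpotent_Var by (auto simp: mono_mol_Cons simp del: mol.simps)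
  qed
  have "\<exists>N. (Delta n ^^ N) (\<Sum>u\<in>A. Cst (lookup f u) * mono u) = 0" if "finite A" for A
    using that
  proof (induction A rule: finite_induct)
    case empty
    then show ?case by simp
  next
    case (insert u A)
    then obtain N where N: "(Delta n ^^ N) (\<Sum>u\<in>A. Cst (lookup f u) * mono u) = 0" by blast
    obtain M where M: "(Delta n ^^ M) (mono u :: 'k mpoly) = 0" using mono[of "word u"] by auto
    have "(Delta n ^^ max N M) (\<Sum>u\<in>insert u A. Cst (lookup f u) * mono u) = 0"
      using insert(1,2) Delta_pow_mono[OF N, of "max N M"] Delta_pow_mono[OF M, of "max N M"]
      by (simp add: Delta_pow_add Delta_pow_Cst_mult)
    then show ?case by blast
  qed
  from this[of "keys f"] show ?thesis by (simp flip: mpoly_expand)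
qed

text \<open>The operator \<open>(1 + Delta) ^ s\<close> for an arbitrary scalar exponent, by the
  binomial series, which is finite on every polynomial.\<close>

definition sh :: "nat \<Rightarrow> 'k::field_char_0 \<Rightarrow> 'k mpoly \<Rightarrow> 'k mpoly" where
  "sh n s f = Sum_any (\<lambda>k. Cst (s gchoose k) * (Delta n ^^ k) f)"

lemma sh_eq:
  assumes "(Delta n ^^ N) f = 0"
  shows "sh n s f = (\<Sum>k<N. Cst (s gchoose k) * (Delta n ^^ k) f)"
  unfolding sh_def
proof (rule Sum_any.expand_superset)
  show "{k. Cst (s gchoose k) * (Delta n ^^ k) f \<noteq> 0} \<subseteq> {..<N}"
    using Delta_pow_mono[OF assms] by (force simp: not_less[symmetric])
qed simp

lemma sh_add: "sh n s (f + g) = sh n s f + sh n s g"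
proof -
  obtain N M where "(Delta n ^^ N) f = 0" "(Delta n ^^ M) g = 0" using Delta_nilpotent by metis
  then have "(Delta n ^^ max N M) f = 0" "(Delta n ^^ max N M) g = 0"
    using Delta_pow_mono by (metis max.cobounded1, metis max.cobounded2)
  then show ?thesis
    by (simp add: sh_eq[where N = "max N M"] Delta_pow_add distrib_left sum.distrib)
qed

lemma sh_Cst_mult: "sh n s (Cst b * f) = Cst b * sh n s f"
proof -
  obtain N where "(Delta n ^^ N) f = 0" using Delta_nilpotent by metis
  then show ?thesis
    by (simp add: sh_eq[where N = N] Delta_pow_Cst_mult sum_distrib_left mult.left_commute)
qed

lemma sh_0 [simp]: "sh n s 0 = 0"
  using sh_Cst_mult[of n s 0 0] by simp

lemma sh_sum: "sh n s (sum f A) = (\<Sum>x\<in>A. sh n s (f x))"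
  by (induction A rule: infinite_finite_induct) (simp_all add: sh_add)

lemma sh_1 [simp]: "sh n s 1 = 1"
  by (subst sh_eq[where N = 1]) simp_all

text \<open>Leibniz's rule: \<open>Delta ^ r\<close> sends \<open>Var i\<close> to
  \<open>Var (i - r)\<close>, and to 0 for \<open>r > i\<close>. For \<open>r > k\<close> the
  truncated \<open>k - r\<close> is harmless because the binomial coefficient is zero.\<close>

lemma Delta_pow_Var_mult:
  assumes "i \<le> n"
  shows "(Delta n ^^ k) (Var i * f)
    = (\<Sum>r\<le>i. of_nat (k choose r) * (Var (i - r) * (Delta n ^^ (k - r)) f))"
proof (induction k)
  case 0
  have "(\<Sum>r\<le>i. of_nat (0 choose r) * (Var (i - r) * f)) = (\<Sum>r\<le>i. if r = 0 then Var i * f else 0)"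
    by (rule sum.cong) (auto simp: binomial_eq_0)
  then show ?case by (simp add: sum.delta)
next
  case (Suc k)
  define D where "D = (\<lambda>r. (Delta n ^^ r) f)"
  have D: "Delta n (D r) = D (Suc r)" for r by (simp add: D_def)
  have step: "of_nat (k choose r) * D (Suc (k - r)) = of_nat (k choose r) * D (Suc k - r)" for r
    by (cases "r \<le> k") (simp_all add: Suc_diff_le binomial_eq_0)
  have "(Delta n ^^ Suc k) (Var i * f)
      = (\<Sum>r\<le>i. of_nat (k choose r) * Delta n (Var (i - r) * D (k - r)))"
    using Suc by (simp add: D_def Delta_sum Delta_Cst_mult flip: Cst_of_nat)
  also have "\<dots> = (\<Sum>r\<le>i. of_nat (k choose r) * (if r < i then Var (i - Suc r) * D (k - r) else 0))
      + (\<Sum>r\<le>i. of_nat (k choose r) * (Var (i - r) * D (Suc k - r)))"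
    unfolding sum.distrib[symmetric]
  proof (rule sum.cong)
    fix r assume "r \<in> {..i}"
    then show "of_nat (k choose r) * Delta n (Var (i - r) * D (k - r)) =
        of_nat (k choose r) * (if r < i then Var (i - Suc r) * D (k - r) else 0) +
        of_nat (k choose r) * (Var (i - r) * D (Suc k - r))"
      using assms step[of r]
      by (simp add: Delta_Var_mult D distrib_left mult.left_commute[of "of_nat _" "Var _"]) auto
  qed simp
  also have "(\<Sum>r\<le>i. of_nat (k choose r) * (if r < i then Var (i - Suc r) * D (k - r) else 0))
      = (\<Sum>r<i. of_nat (k choose r) * (Var (i - Suc r) * D (k - r)))"
    by (cases i) (simp_all add: lessThan_Suc_atMost)
  also have "\<dots> = (\<Sum>r\<le>i. if r = 0 then 0 else of_nat (k choose (r - 1)) * (Var (i - r) * D (Suc k - r)))"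
    by (cases i) (simp_all add: lessThan_Suc_atMost sum.atMost_Suc_shift del: sum.atMost_Suc)
  also have "\<dots> + (\<Sum>r\<le>i. of_nat (k choose r) * (Var (i - r) * D (Suc k - r)))
      = (\<Sum>r\<le>i. of_nat (Suc k choose r) * (Var (i - r) * D (Suc k - r)))"
    unfolding sum.distrib[symmetric]
  proof (rule sum.cong)
    fix r
    show "(if r = 0 then 0 else of_nat (k choose (r - 1)) * (Var (i - r) * D (Suc k - r)))
        + of_nat (k choose r) * (Var (i - r) * D (Suc k - r))
      = of_nat (Suc k choose r) * (Var (i - r) * D (Suc k - r))"
      by (cases r) (simp_all add: distrib_right)
  qed simp
  finally show ?case by (simp add: D_def)
qed

text \<open>The binomial series and Leibniz's rule, with the sums exchanged. Unlike an exponential,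
  \<open>(1 + Delta) ^ s\<close> is not multiplicative: the exponent on \<open>f\<close> drops by
  \<open>r\<close>. In \<open>twLval_sh_mol\<close> this drop cancels against the shift of the
  index.\<close>

lemma sh_Var_mult:
  assumes "i \<le> n"
  shows "sh n s (Var i * f) = (\<Sum>r\<le>i. Cst (s gchoose r) * (Var (i - r) * sh n (s - of_nat r) f))"
proof -
  obtain N where N: "(Delta n ^^ N) f = 0" using Delta_nilpotent by metis
  \<comment> \<open>At most \<open>i\<close> of the \<open>N + i\<close> derivations can fall on
    \<open>Var i\<close>, so at least \<open>N\<close> fall on \<open>f\<close>.\<close>
  have NN: "(Delta n ^^ (N + i)) (Var i * f) = 0"
    by (auto simp: Delta_pow_Var_mult[OF assms] intro!: sum.neutral Delta_pow_mono[OF N])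
  have coeff: "(s gchoose k) * of_nat (k choose r) = (s gchoose r) * (s - of_nat r gchoose (k - r))"
    if "r \<le> k" for k r
    using gbinomial_trinomial_revision[OF that, of s] by (simp add: binomial_gbinomial)
  have "sh n s (Var i * f)
      = (\<Sum>k<N + i. \<Sum>r\<le>i. Cst (s gchoose k) * (of_nat (k choose r) * (Var (i - r) * (Delta n ^^ (k - r)) f)))"
    by (simp add: sh_eq[OF NN] Delta_pow_Var_mult[OF assms] sum_distrib_left)
  also have "\<dots> = (\<Sum>r\<le>i. \<Sum>k<N + i. Cst ((s gchoose k) * of_nat (k choose r)) * (Var (i - r) * (Delta n ^^ (k - r)) f))"
    by (subst sum.swap) (simp add: Cst_mult Cst_of_nat mult.assoc)
  also have "\<dots> = (\<Sum>r\<le>i. Cst (s gchoose r) * (Var (i - r) * sh n (s - of_nat r) f))"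
  proof (rule sum.cong)
    fix r assume r: "r \<in> {..i}"
    have N': "(Delta n ^^ (N + i - r)) f = 0" using r by (intro Delta_pow_mono[OF N]) auto
    have "(\<Sum>k<N + i. Cst ((s gchoose k) * of_nat (k choose r)) * (Var (i - r) * (Delta n ^^ (k - r)) f))
        = (\<Sum>k\<in>{r..<N + i}. Cst ((s gchoose k) * of_nat (k choose r)) * (Var (i - r) * (Delta n ^^ (k - r)) f))"
      by (rule sum.mono_neutral_right) (auto simp: binomial_eq_0)
    also have "\<dots> = (\<Sum>k\<in>{r..<N + i}. Cst ((s gchoose r) * (s - of_nat r gchoose (k - r))) * (Var (i - r) * (Delta n ^^ (k - r)) f))"
      by (simp add: coeff)
    also have "\<dots> = (\<Sum>m<N + i - r. Cst ((s gchoose r) * (s - of_nat r gchoose m)) * (Var (i - r) * (Delta n ^^ m) f))"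
      by (rule sum.reindex_bij_witness[of _ "\<lambda>m. m + r" "\<lambda>k. k - r"]) auto
    also have "\<dots> = Cst (s gchoose r) * (Var (i - r) * sh n (s - of_nat r) f)"
      by (simp add: sh_eq[OF N'] sum_distrib_left Cst_mult mult_ac)
    finally show "(\<Sum>k<N + i. Cst ((s gchoose k) * of_nat (k choose r)) * (Var (i - r) * (Delta n ^^ (k - r)) f))
      = Cst (s gchoose r) * (Var (i - r) * sh n (s - of_nat r) f)" .
  qed simp
  finally show ?thesis .
qed

lemma sh_mol_forms: "set is \<subseteq> {..n} \<Longrightarrow> sh n s (mono (mol is)) \<in> forms n (length is)"
proof (induction "is" arbitrary: s)
  case Nil
  then show ?case by simp
next
  case (Cons i "is")
  have "Var (i - r) * sh n (s - of_nat r) (mono (mol is)) \<in> forms n (1 + length is)" for r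
    using Cons by (intro forms_mult forms_Var) auto
  then show ?case
    using Cons.prems
    by (simp add: mono_mol_Cons sh_Var_mult forms_sum forms_Cst_mult del: mol.simps)
qed

lemma forms_induct_mono:
  fixes f :: "'a::comm_ring_1 mpoly"
  assumes f: "f \<in> forms n d"
    and "Q 0" "\<And>f g. Q f \<Longrightarrow> Q g \<Longrightarrow> Q (f + g)" "\<And>b f. Q f \<Longrightarrow> Q (Cst b * f)"
    and "\<And>is. set is \<subseteq> {..n} \<Longrightarrow> length is = d \<Longrightarrow> Q (mono (mol is))"
  shows "Q f"
proof -
  have "Q (\<Sum>u\<in>A. Cst (lookup f u) * mono u)" if "finite A" "A \<subseteq> keys f" for A
    using that
  proof (induction A rule: finite_induct)
    case empty
    then show ?case by (simp add: assms)
  next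
    case (insert u A)
    have "Q (mono (mol (word u)))"
      using insert.prems formsD(2)[OF f, of u] polysD[OF formsD(1)[OF f], of u]
      by (intro assms(5)) (auto simp: length_word set_word)
    then show ?case using insert assms(3,4) by simp
  qed
  from this[of "keys f"] show ?thesis by (simp flip: mpoly_expand)
qed

lemma sh_forms: "f \<in> forms n d \<Longrightarrow> sh n s f \<in> forms n d"
  by (erule forms_induct_mono)
     (auto simp: sh_add sh_Cst_mult intro: forms_add forms_Cst_mult sh_mol_forms)

text \<open>Splitting off a letter twice leaves Vandermonde's convolution, since the exponent on the
  remaining word depends only on \<open>m = k + l\<close>.\<close>

lemma sh_sh_mol:
  fixes s r :: "'k::field_char_0"
  shows "set is \<subseteq> {..n} \<Longrightarrow> sh n s (sh n r (mono (mol is))) = sh n (s + r) (mono (mol is))"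
proof (induction "is" arbitrary: s r)
  case Nil
  then show ?case by simp
next
  case (Cons i "is")
  define F where "F t = sh n t (mono (mol is))" for t :: 'k
  have IH: "sh n s (F r) = F (s + r)" for s r using Cons by (simp add: F_def)
  have le: "i - k \<le> n" for k using Cons.prems by auto
  have "sh n s (sh n r (mono (mol (i # is))))
      = (\<Sum>k\<le>i. \<Sum>l\<le>i - k. Cst (r gchoose k) * (Cst (s gchoose l) * (Var (i - k - l) * F (s - of_nat l + (r - of_nat k)))))"
    using Cons.prems le
    by (simp add: mono_mol_Cons sh_Var_mult sh_sum sh_Cst_mult sum_distrib_left IH flip: F_def del: mol.simps)
  also have "\<dots> = (\<Sum>m\<le>i. \<Sum>k\<le>m. Cst (r gchoose k) * (Cst (s gchoose (m - k)) * (Var (i - k - (m - k)) * F (s - of_nat (m - k) + (r - of_nat k)))))"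
    by (rule sum_atMost_triangle)
  also have "\<dots> = (\<Sum>m\<le>i. Cst (\<Sum>k\<le>m. (r gchoose k) * (s gchoose (m - k))) * (Var (i - m) * F (s + r - of_nat m)))"
  proof (rule sum.cong)
    fix m
    have "s - of_nat (m - k) + (r - of_nat k) = s + r - of_nat m" if "k \<le> m" for k
      using that by (simp add: of_nat_diff)
    then show "(\<Sum>k\<le>m. Cst (r gchoose k) * (Cst (s gchoose (m - k)) * (Var (i - k - (m - k)) * F (s - of_nat (m - k) + (r - of_nat k)))))
      = Cst (\<Sum>k\<le>m. (r gchoose k) * (s gchoose (m - k))) * (Var (i - m) * F (s + r - of_nat m))"
      by (simp add: Cst_sum Cst_mult sum_distrib_right mult.assoc add_diff_eq)
  qed simp
  also have "\<dots> = (\<Sum>m\<le>i. Cst (s + r gchoose m) * (Var (i - m) * F (s + r - of_nat m)))"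
    using gbinomial_Vandermonde[of r s] by (simp add: add.commute flip: atLeast0AtMost)
  also have "\<dots> = sh n (s + r) (mono (mol (i # is)))"
    using Cons.prems by (simp add: mono_mol_Cons sh_Var_mult F_def del: mol.simps)
  finally show ?case .
qed

lemma sh_sh: "f \<in> forms n d \<Longrightarrow> sh n s (sh n r f) = sh n (s + r) f"
  by (erule forms_induct_mono) (simp_all add: sh_add sh_Cst_mult sh_sh_mol)

lemma sh_zero: "sh n 0 f = f"
proof -
  obtain N where "(Delta n ^^ N) f = 0" using Delta_nilpotent by metis
  then have "(Delta n ^^ Suc N) f = 0" by simp
  then have "sh n 0 f = (\<Sum>k<Suc N. Cst (0 gchoose k) * (Delta n ^^ k) f)" by (rule sh_eq)
  then show ?thesis
    by (simp add: gbinomial_0_left if_distrib[of Cst] if_distrib[of "\<lambda>x. x * _"] sum.delta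
        cong: if_cong del: sum.lessThan_Suc)
qed

text \<open>The eigenvalue of \<open>Gam n a\<close> on the monomial of the word.\<close>

definition weight :: "'k::field_char_0 \<Rightarrow> nat list \<Rightarrow> 'k" where
  "weight a is = (\<Sum>i\<leftarrow>is. a + of_nat i)"

lemma weight_simps [simp]: "weight a [] = 0" "weight a (i # is) = a + of_nat i + weight a is"
  by (simp_all add: weight_def)

lemma Gam_Cst_mult: "Gam n a (Cst b * f) = Cst b * Gam n a f"
  by (simp add: Gam_def pdiff_Cst_mult sum_distrib_left mult.left_commute[of _ "Cst b"])

lemma Gam_mol: "set is \<subseteq> {..n} \<Longrightarrow> Gam n a (mono (mol is)) = Cst (weight a is) * mono (mol is)"
proof (induction "is")
  case Nil
  then show ?case by (simp add: Gam_def)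
next
  case (Cons j "is")
  have "Gam n a (Var j * f) = Cst (a + of_nat j) * (Var j * f) + Var j * Gam n a f" if "j \<le> n" for f
  proof -
    have "Cst (a + of_nat i) * Var i * pdiff i (Var j * f)
        = (if i = j then Cst (a + of_nat i) * (Var i * f) else 0)
          + Var j * (Cst (a + of_nat i) * Var i * pdiff i f)" for i
      unfolding pdiff_Var_mult by (simp add: algebra_simps)
    then have "Gam n a (Var j * f)
        = (\<Sum>i = 0..n. if i = j then Cst (a + of_nat i) * (Var i * f) else 0) + Var j * Gam n a f"
      by (simp add: Gam_def sum.distrib sum_distrib_left)
    then show ?thesis using that by (simp add: sum.delta)
  qed
  from this[of "mono (mol is)"] have "Gam n a (Var j * mono (mol is))
      = Cst (a + of_nat j) * (Var j * mono (mol is)) + Var j * (Cst (weight a is) * mono (mol is))"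
    using Cons by simp
  then show ?case
    by (simp add: mono_mol_Cons Cst_add distrib_right distrib_left mult.left_commute del: mol.simps)
qed

lemma Gam_falling_eigen:
  assumes "Gam n a g = Cst w * g"
  shows "Gam_falling n a k g = Cst (\<Prod>i = 0..<k. w - of_nat i) * g"
proof (induction k)
  case (Suc k)
  let ?c = "\<Prod>i = 0..<k. w - of_nat i"
  have "Gam_falling n a (Suc k) g = Cst ?c * (Cst w * g) - of_nat k * (Cst ?c * g)"
    by (simp add: Suc Gam_Cst_mult assms)
  also have "\<dots> = Cst (?c * (w - of_nat k)) * g"
    by (simp add: Cst_mult Cst_diff Cst_of_nat algebra_simps)
  finally show ?case by simp
qed simp

lemma Gam_binom_mol:
  assumes "set is \<subseteq> {..n}"
  shows "Gam_binom n a k (mono (mol is)) = Cst (weight a is gchoose k) * mono (mol is)"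
  unfolding Gam_binom_def Gam_falling_eigen[OF Gam_mol[OF assms]] gbinomial_prod_rev
  by (simp add: field_simps flip: Cst_mult mult.assoc)

text \<open>A monomial is an eigenvector of \<open>Gam\<close>, so the binomials in
  \<open>Gam\<close> act as scalars and the sum over \<open>k\<close> becomes the series of
  \<open>(1 + Delta) ^ s\<close> with \<open>s\<close> the weight.\<close>

lemma star_mol:
  assumes "set is \<subseteq> {..n}"
  shows "star n a f (mono (mol is)) = mono (mol is) * sh n (weight a is) f"
proof -
  obtain N where N: "(Delta n ^^ N) f = 0" using Delta_nilpotent by metis
  have "star n a f (mono (mol is)) = (\<Sum>k<N. (Delta n ^^ k) f * (Cst (weight a is gchoose k) * mono (mol is)))"
    unfolding star_def Gam_binom_mol[OF assms]
  proof (rule Sum_any.expand_superset)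
    show "{k. (Delta n ^^ k) f * (Cst (weight a is gchoose k) * mono (mol is)) \<noteq> 0} \<subseteq> {..<N}"
      using Delta_pow_mono[OF N] by (force simp: not_less[symmetric])
  qed simp
  then show ?thesis by (simp add: sh_eq[OF N] sum_distrib_left mult_ac)
qed

section \<open>The functional of a chain\<close>

text \<open>If the points of a point module are given by a chain \<open>c\<close>, its degree \<open>d\<close> functional
  \<open>\<phi>\<close> satisfies \<open>\<phi> (f * X\<^sub>i) = \<phi> f \<cdot> c\<^sub>d(X\<^sub>i)\<close>.  For the commutative monomial of a word,
  \<open>wval a c s\<close> is the value of \<open>\<phi> \<circ> (1 + Delta) ^ s\<close>: this two-parameter family of functionals
  is multiplicative.\<close>

fun wval :: "'k::field_char_0 \<Rightarrow> (nat \<Rightarrow> nat \<Rightarrow> 'k mpoly) \<Rightarrow> 'k \<Rightarrow> nat list \<Rightarrow> 'k mpoly" where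
  "wval a c s [] = 1"
| "wval a c s (i # is) = tw s (c (length is)) i * wval a c (s - (a + of_nat i)) is"

definition mval where "mval a c s u = wval a c s (word u)"

text \<open>Proportional points have proportional functionals. Two factors per degree are carried
  because neither \<open>H l\<close> nor \<open>e l\<close> need be invertible modulo
  \<open>A\<close>.\<close>

lemma wval_scale:
  assumes A: "ideal_set A"
    and "\<And>l i. l < length is \<Longrightarrow> i \<le> n \<Longrightarrow> H l * c l i - e l * v l i \<in> A"
    and "set is \<subseteq> {..n}"
  shows "(\<Prod>l<length is. H l) * wval a c s is - (\<Prod>l<length is. e l) * wval a v s is \<in> A"
  using assms(2,3)
proof (induction "is" arbitrary: s)
  case Nil
  then show ?case by (simp add: ideal_set_0[OF A])
next
  case (Cons i "is")
  have "H (length is) * tw s (c (length is)) i - e (length is) * tw s (v (length is)) i \<in> A"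
    using Cons.prems by (intro tw_cong_ideal[OF A]) auto
  moreover have "(\<Prod>l<length is. H l) * wval a c (s - (a + of_nat i)) is
      - (\<Prod>l<length is. e l) * wval a v (s - (a + of_nat i)) is \<in> A"
    using Cons by auto
  ultimately have "(H (length is) * tw s (c (length is)) i)
        * ((\<Prod>l<length is. H l) * wval a c (s - (a + of_nat i)) is)
      - (e (length is) * tw s (v (length is)) i)
        * ((\<Prod>l<length is. e l) * wval a v (s - (a + of_nat i)) is) \<in> A"
    by (rule ideal_set_cong_mult[OF A])
  then show ?case by (simp add: mult_ac)
qed

text \<open>At a leading index every twist is invisible modulo \<open>P\<close>, so the value is a
  product of leading coordinates. The word is reversed because its head is evaluated at the last
  point.\<close>

lemma wval_lead:
  assumes P: "prime_set P"
    and "\<And>l. l < length is \<Longrightarrow> c l (rev is ! l) \<notin> P"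
    and "\<And>l k. l < length is \<Longrightarrow> k < rev is ! l \<Longrightarrow> c l k \<in> P"
  shows "wval a c s is \<notin> P"
  using assms(2,3)
proof (induction "is" arbitrary: s)
  case Nil
  then show ?case by (simp add: prime_set_1[OF P])
next
  case (Cons i "is")
  have "tw s (c (length is)) i - c (length is) i \<in> P"
    using Cons.prems(2)[of "length is"]
    by (intro tw_lead prime_set_ideal[OF P]) (simp add: nth_append)
  moreover have "c (length is) i \<notin> P"
    using Cons.prems(1)[of "length is"] by (simp add: nth_append)
  ultimately have "tw s (c (length is)) i \<notin> P" by (rule prime_set_cong[OF P])
  moreover have "wval a c (s - (a + of_nat i)) is \<notin> P"
  proof (rule Cons.IH)
    fix l assume "l < length is"
    then show "c l (rev is ! l) \<notin> P" "\<And>k. k < rev is ! l \<Longrightarrow> c l k \<in> P"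
      using Cons.prems[of l] by (simp_all add: nth_append)
  qed
  ultimately show ?case by (simp add: prime_set_mult[OF P])
qed

text \<open>The functional on the base change to \<open>B\<close>. It is 0 outside degree
  \<open>d\<close>, so that ideals cut out by such functionals are graded.\<close>

definition Lval ::
    "'k::field_char_0 \<Rightarrow> (nat \<Rightarrow> nat \<Rightarrow> 'k mpoly) \<Rightarrow> nat \<Rightarrow> 'k mpoly mpoly \<Rightarrow> 'k mpoly" where
  "Lval a c d F = lsum (\<lambda>x. x) (\<lambda>u. if mono_deg u = d then mval a c 0 u else 0) F"

lemma Lval_add: "Lval a c d (F + G) = Lval a c d F + Lval a c d G"
  by (simp add: Lval_def)

lemma Lval_diff: "Lval a c d (F - G) = Lval a c d F - Lval a c d G"
  by (simp add: Lval_def)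

lemma Lval_Cst_mult: "Lval a c d (Cst b * F) = b * Lval a c d F"
  by (simp add: Lval_def)

lemma Lval_0 [simp]: "Lval a c d 0 = 0"
  by (simp add: Lval_def)

lemma Lval_mono: "Lval a c d (mono u) = (if mono_deg u = d then mval a c 0 u else 0)"
  by (simp add: Lval_def)

lemma Lval_forms: "F \<in> forms n d \<Longrightarrow> Lval a c d F = lsum (\<lambda>x. x) (mval a c 0) F"
  unfolding Lval_def by (rule lsum_cong) (auto dest: formsD)

lemma Lval_hom_part: "Lval a c e (hom_part d F) = (if e = d then Lval a c d F else 0)"
proof -
  have "Lval a c e (hom_part d F) = lsum (\<lambda>x. x) (\<lambda>u. Lval a c e (hom_part d (mono u))) F"
    by (rule linear_eq_lsum[of "\<lambda>F. Lval a c e (hom_part d F)"])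
       (simp_all add: hom_part_add Lval_add hom_part_Cst_mult Lval_Cst_mult)
  also have "(\<lambda>u. Lval a c e (hom_part d (mono u)))
      = (\<lambda>u. if e = d then (if mono_deg u = d then mval a c 0 u else 0) else 0)"
    by (rule ext) (simp add: hom_part_lsum Lval_mono)
  finally show ?thesis by (simp add: Lval_def lsum_def)
qed

lemma mol_eq_single: "mol is = single i 1 \<longleftrightarrow> is = [i]"
proof
  assume *: "mol is = single i 1"
  then have "length is = 1" by (metis mono_deg_mol mono_deg_single)
  then obtain j where "is = [j]" by (auto simp: length_Suc_conv)
  then show "is = [i]" using * keys_mol[of "is"] by auto
qed simp

lemma word_single [simp]: "word (single i 1) = [i]"
  using mol_eq_single mol_word by blast

lemma mval_single [simp]: "mval a c s (single i 1) = tw s (c 0) i"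
  by (simp add: mval_def del: One_nat_def)

lemma Lval_Var [simp]: "Lval a c 1 (Var i) = c 0 i"
  by (simp add: Var_def Lval_mono del: One_nat_def)

lemma Lval_scale:
  assumes A: "ideal_set A"
    and *: "\<And>l i. l < d \<Longrightarrow> i \<le> n \<Longrightarrow> H l * c l i - e l * v l i \<in> A"
    and F: "F \<in> forms n d"
  shows "(\<Prod>l<d. H l) * Lval a c d F - (\<Prod>l<d. e l) * Lval a v d F \<in> A"
proof -
  have "(\<Prod>l<d. H l) * mval a c 0 u - (\<Prod>l<d. e l) * mval a v 0 u \<in> A" if "u \<in> keys F" for u
    using wval_scale[OF A, of "word u" n H c e v a 0] * formsD(2)[OF F that] polysD[OF formsD(1)[OF F] that]
    by (auto simp: mval_def length_word set_word)
  then have "(\<Sum>u\<in>keys F. lookup F u * ((\<Prod>l<d. H l) * mval a c 0 u - (\<Prod>l<d. e l) * mval a v 0 u)) \<in> A"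
    by (intro ideal_set_sum[OF A] ideal_set_mult[OF A])
  then show ?thesis
    by (simp add: Lval_forms[OF F] lsum_def sum_distrib_left right_diff_distrib sum_subtractf mult_ac)
qed

context
  fixes n and a :: "'k::field_char_0" and A and c :: "nat \<Rightarrow> nat \<Rightarrow> 'k mpoly"
  assumes c: "chain n a A c"
begin

private lemmas A = chainD(1)[OF c]

text \<open>Exchanging two neighbouring letters is exactly the link between their two points,
  twisted by \<open>s\<close>; this is why links must survive twisting.\<close>

lemma wval_swap:
  assumes "i \<le> n" "j \<le> n"
  shows "wval a c s (i # j # is) - wval a c s (j # i # is) \<in> A"
proof -
  let ?d = "length is"
  define W where "W = wval a c (s - (a + of_nat i) - (a + of_nat j)) is"
  have W: "wval a c (s - (a + of_nat j) - (a + of_nat i)) is = W"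
    by (simp add: W_def algebra_simps)
  have "tw s (c (Suc ?d)) i * tw (- (a + of_nat i)) (tw s (c ?d)) j
      - tw s (c (Suc ?d)) j * tw (- (a + of_nat j)) (tw s (c ?d)) i \<in> A"
    using link_tw[OF chainD(1,3)[OF c], of s ?d] assms by (auto simp: link_def)
  then have "(tw s (c (Suc ?d)) i * tw (s - (a + of_nat i)) (c ?d) j
      - tw s (c (Suc ?d)) j * tw (s - (a + of_nat j)) (c ?d) i) * W \<in> A"
    by (intro ideal_set_mult_right[OF A]) (simp only: tw_tw uminus_add_conv_diff)
  then show ?thesis
    by (simp only: wval.simps length_Cons W W_def[symmetric] left_diff_distrib mult.assoc)
qed

lemma wval_cong_Cons:
  assumes "length is = length js" "\<And>s. wval a c s is - wval a c s js \<in> A"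
  shows "wval a c s (i # is) - wval a c s (i # js) \<in> A"
  using ideal_set_mult[OF A assms(2)] assms(1) by (simp flip: right_diff_distrib)

lemma wval_move:
  "set is \<subseteq> {..n} \<Longrightarrow> j \<le> n \<Longrightarrow> wval a c s (is @ j # js) - wval a c s (j # is @ js) \<in> A"
proof (induction "is" arbitrary: s)
  case Nil
  then show ?case by (simp add: ideal_set_0[OF A])
next
  case (Cons i "is")
  have "wval a c s (i # is @ j # js) - wval a c s (i # j # is @ js) \<in> A"
    using Cons by (intro wval_cong_Cons) auto
  moreover have "wval a c s (i # j # is @ js) - wval a c s (j # i # is @ js) \<in> A"
    using Cons.prems by (intro wval_swap) auto
  ultimately show ?case
    using ideal_set_cong_trans[OF A] unfolding append_Cons by blast
qed

text \<open>Bring the first letter of one word to the front of the other and recurse. Hence values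
  modulo \<open>A\<close> depend only on the commutative monomial.\<close>

lemma wval_mset:
  "mset is = mset js \<Longrightarrow> set is \<subseteq> {..n} \<Longrightarrow> wval a c s is - wval a c s js \<in> A"
proof (induction "is" arbitrary: js s)
  case Nil
  then show ?case by (simp add: ideal_set_0[OF A])
next
  case (Cons i "is")
  then have "i \<in> set js" by (metis list.set_intros(1) mset_eq_setD)
  then obtain xs ys where js: "js = xs @ i # ys" by (meson split_list)
  have set: "set js \<subseteq> {..n}" using Cons.prems by (metis mset_eq_setD)
  have m: "mset is = mset (xs @ ys)" using Cons.prems(1) js by simp
  have "wval a c s (i # is) - wval a c s (i # xs @ ys) \<in> A"
    using Cons.IH[OF m] Cons.prems(2) m by (intro wval_cong_Cons) (auto simp flip: size_mset)
  moreover have "wval a c s (i # xs @ ys) - wval a c s js \<in> A"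
    using ideal_set_cong_sym[OF A wval_move[of xs i s ys]] set js by simp
  ultimately show ?case using ideal_set_cong_trans[OF A] by blast
qed

lemma mval_mol: "set is \<subseteq> {..n} \<Longrightarrow> mval a c s (mol is) - wval a c s is \<in> A"
  unfolding mval_def by (rule wval_mset) (auto simp: mset_word_mol set_word keys_mol)

text \<open>The functional of the chain composed with \<open>(1 + Delta) ^ s\<close>, as
  \<open>twLval_sh\<close> justifies.\<close>

definition twLval where "twLval s f = lsum Cst (mval a c s) f"

lemma twLval_add: "twLval s (f + g) = twLval s f + twLval s g"
  by (simp add: twLval_def)

lemma twLval_Cst_mult: "twLval s (Cst b * f) = Cst b * twLval s f"
  by (simp add: twLval_def)

lemma twLval_sum: "twLval s (sum f B) = (\<Sum>x\<in>B. twLval s (f x))"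
  by (simp add: twLval_def)

lemma twLval_Var_mult:
  assumes "j \<le> n" "g \<in> forms n d"
  shows "twLval s (Var j * g) - tw s (c d) j * twLval (s - (a + of_nat j)) g \<in> A"
  using assms(2)
proof (rule forms_induct_mono)
  show "twLval s (Var j * 0) - tw s (c d) j * twLval (s - (a + of_nat j)) 0 \<in> A"
    by (simp add: twLval_def ideal_set_0[OF A])
next
  fix f g
  assume "twLval s (Var j * f) - tw s (c d) j * twLval (s - (a + of_nat j)) f \<in> A"
    "twLval s (Var j * g) - tw s (c d) j * twLval (s - (a + of_nat j)) g \<in> A"
  from ideal_set_add[OF A this]
  show "twLval s (Var j * (f + g)) - tw s (c d) j * twLval (s - (a + of_nat j)) (f + g) \<in> A"
    by (simp add: distrib_left twLval_add algebra_simps)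
next
  fix b f
  assume "twLval s (Var j * f) - tw s (c d) j * twLval (s - (a + of_nat j)) f \<in> A"
  from ideal_set_mult[OF A this, of "Cst b"]
  show "twLval s (Var j * (Cst b * f)) - tw s (c d) j * twLval (s - (a + of_nat j)) (Cst b * f) \<in> A"
    by (simp add: mult.left_commute[of "Var j"] mult.left_commute[of "tw s (c d) j"] twLval_Cst_mult right_diff_distrib)
next
  fix "is" assume "is": "set is \<subseteq> {..n}" "length is = d"
  have "mval a c s (mol (j # is)) - wval a c s (j # is) \<in> A"
    using "is" assms(1) by (intro mval_mol) auto
  moreover have "wval a c s (j # is) - tw s (c d) j * mval a c (s - (a + of_nat j)) (mol is) \<in> A"
    using ideal_set_mult[OF A ideal_set_cong_sym[OF A mval_mol[OF "is"(1)]]] "is"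
    by (simp add: right_diff_distrib)
  ultimately have "mval a c s (mol (j # is)) - tw s (c d) j * mval a c (s - (a + of_nat j)) (mol is) \<in> A"
    by (rule ideal_set_cong_trans[OF A])
  then show "twLval s (Var j * mono (mol is)) - tw s (c d) j * twLval (s - (a + of_nat j)) (mono (mol is)) \<in> A"
    by (simp add: twLval_def del: mol.simps flip: mono_mol_Cons)
qed

text \<open>By \<open>sh_Var_mult\<close> and \<open>twLval_Var_mult\<close>, the exponents on the
  remaining word add up to \<open>s + r - (a + i)\<close> for every \<open>k\<close>. Taking out
  this common factor leaves \<open>tw r (tw s (c d)) i\<close>, the coordinate twisted by
  \<open>s + r\<close>.\<close>

lemma twLval_sh_mol:
  "set is \<subseteq> {..n} \<Longrightarrow> twLval s (sh n r (mono (mol is))) - twLval (s + r) (mono (mol is)) \<in> A"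
proof (induction "is" arbitrary: s r)
  case Nil
  have "mval a c s 0 = 1" for s
    using mol_word[of 0] length_word[of 0] by (simp add: mval_def)
  then have "twLval s (mono 0) = 1" for s by (simp add: twLval_def del: mono_0)
  then show ?case by (simp add: ideal_set_0[OF A])
next
  case (Cons i "is")
  define F where "F = (mono (mol is) :: 'k mpoly)"
  let ?d = "length is"
  have i: "i \<le> n" and set: "set is \<subseteq> {..n}" using Cons.prems by auto
  have F: "sh n t F \<in> forms n ?d" "F \<in> forms n ?d" for t
    unfolding F_def using set by (auto intro!: sh_mol_forms forms_mono simp: keys_mol mono_deg_mol)
  have summand: "twLval s (Var (i - k) * sh n (r - of_nat k) F)
      - tw s (c ?d) (i - k) * twLval (s + r - (a + of_nat i)) F \<in> A" if "k \<le> i" for k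
  proof -
    have "twLval s (Var (i - k) * sh n (r - of_nat k) F)
        - tw s (c ?d) (i - k) * twLval (s - (a + of_nat (i - k))) (sh n (r - of_nat k) F) \<in> A"
      using i by (intro twLval_Var_mult F) auto
    moreover have "tw s (c ?d) (i - k) * (twLval (s - (a + of_nat (i - k))) (sh n (r - of_nat k) F)
        - twLval (s - (a + of_nat (i - k)) + (r - of_nat k)) F) \<in> A"
      using Cons.IH set unfolding F_def by (intro ideal_set_mult[OF A])
    moreover have "s - (a + of_nat (i - k)) + (r - of_nat k) = s + r - (a + of_nat i)"
      using that by (simp add: of_nat_diff)
    ultimately show ?thesis
      unfolding right_diff_distrib by (metis ideal_set_cong_trans[OF A])
  qed
  have e1: "twLval s (sh n r (Var i * F))
      = (\<Sum>k\<le>i. Cst (r gchoose k) * twLval s (Var (i - k) * sh n (r - of_nat k) F))"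
    by (simp add: sh_Var_mult[OF i] twLval_sum twLval_Cst_mult)
  have "(\<Sum>k\<le>i. Cst (r gchoose k) * twLval s (Var (i - k) * sh n (r - of_nat k) F))
      - (\<Sum>k\<le>i. Cst (r gchoose k) * (tw s (c ?d) (i - k) * twLval (s + r - (a + of_nat i)) F)) \<in> A"
  proof (rule ideal_set_cong_sum[OF A])
    fix k assume "k \<in> {..i}"
    then have "Cst (r gchoose k) * (twLval s (Var (i - k) * sh n (r - of_nat k) F)
        - tw s (c ?d) (i - k) * twLval (s + r - (a + of_nat i)) F) \<in> A"
      by (intro ideal_set_mult[OF A] summand) simp
    then show "Cst (r gchoose k) * twLval s (Var (i - k) * sh n (r - of_nat k) F)
        - Cst (r gchoose k) * (tw s (c ?d) (i - k) * twLval (s + r - (a + of_nat i)) F) \<in> A"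
      by (simp add: right_diff_distrib)
  qed
  moreover have e2: "(\<Sum>k\<le>i. Cst (r gchoose k) * (tw s (c ?d) (i - k) * twLval (s + r - (a + of_nat i)) F))
      = tw r (tw s (c ?d)) i * twLval (s + r - (a + of_nat i)) F"
    by (simp add: tw_def[of r] sum_distrib_right mult.assoc)
  moreover have e3: "tw (s + r) (c ?d) i * twLval (s + r - (a + of_nat i)) F - twLval (s + r) (Var i * F) \<in> A"
    by (intro ideal_set_cong_sym[OF A twLval_Var_mult] i F)
  ultimately have "twLval s (sh n r (Var i * F)) - tw (r + s) (c ?d) i * twLval (s + r - (a + of_nat i)) F \<in> A"
    by (simp only: e1 e2 tw_tw)
  then have "twLval s (sh n r (Var i * F)) - twLval (s + r) (Var i * F) \<in> A"
    using e3 by (subst (asm) add.commute[of r s]) (rule ideal_set_cong_trans[OF A])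
  then show ?case by (simp only: mono_mol_Cons F_def)
qed

lemma twLval_sh: "f \<in> forms n d \<Longrightarrow> twLval s (sh n r f) - twLval (s + r) f \<in> A"
proof (erule forms_induct_mono)
  show "twLval s (sh n r 0) - twLval (s + r) 0 \<in> A" by (simp add: twLval_def ideal_set_0[OF A])
next
  fix f g assume "twLval s (sh n r f) - twLval (s + r) f \<in> A" "twLval s (sh n r g) - twLval (s + r) g \<in> A"
  from ideal_set_add[OF A this] show "twLval s (sh n r (f + g)) - twLval (s + r) (f + g) \<in> A"
    by (simp add: sh_add twLval_add algebra_simps)
next
  fix b f assume "twLval s (sh n r f) - twLval (s + r) f \<in> A"
  from ideal_set_mult[OF A this, of "Cst b"]
  show "twLval s (sh n r (Cst b * f)) - twLval (s + r) (Cst b * f) \<in> A"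
    by (simp add: sh_Cst_mult twLval_Cst_mult right_diff_distrib)
qed (rule twLval_sh_mol)

lemma twLval_mol_mult:
  assumes g: "g \<in> forms n d"
  shows "set js \<subseteq> {..n} \<Longrightarrow> twLval s (mono (mol js) * g)
      - wval a (\<lambda>l. c (l + d)) s js * twLval (s - weight a js) g \<in> A"
proof (induction js arbitrary: s)
  case Nil
  then show ?case by (simp add: ideal_set_0[OF A])
next
  case (Cons j js)
  have "mono (mol js) * g \<in> forms n (length js + d)"
    using Cons.prems by (intro forms_mult g forms_mono) (auto simp: keys_mol mono_deg_mol)
  then have "twLval s (Var j * (mono (mol js) * g))
      - tw s (c (length js + d)) j * twLval (s - (a + of_nat j)) (mono (mol js) * g) \<in> A"
    using Cons.prems by (intro twLval_Var_mult) auto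
  moreover have "tw s (c (length js + d)) j * (twLval (s - (a + of_nat j)) (mono (mol js) * g)
      - wval a (\<lambda>l. c (l + d)) (s - (a + of_nat j)) js * twLval (s - (a + of_nat j) - weight a js) g) \<in> A"
    using Cons by (intro ideal_set_mult[OF A]) auto
  ultimately have "twLval s (Var j * (mono (mol js) * g))
      - tw s (c (length js + d)) j * (wval a (\<lambda>l. c (l + d)) (s - (a + of_nat j)) js
          * twLval (s - (a + of_nat j) - weight a js) g) \<in> A"
    unfolding right_diff_distrib by (rule ideal_set_cong_trans[OF A])
  then show ?case by (simp add: mono_mol_Cons mult.assoc diff_diff_add del: mol.simps)
qed

lemma Lval_map_coeffs:
  assumes "f \<in> forms n d"
  shows "Lval a c e (map_coeffs f) = (if e = d then twLval 0 f else 0)"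
proof -
  have "Lval a c e (map_coeffs f) = Lval a c e (hom_part d (map_coeffs f))"
    using hom_part_form[OF map_coeffs_forms[OF assms], of d] by simp
  also have "\<dots> = (if e = d then twLval 0 f else 0)"
    using map_coeffs_forms[OF assms]
    by (simp add: Lval_hom_part Lval_forms lsum_map_coeffs twLval_def)
  finally show ?thesis .
qed

text \<open>The product is \<open>mono v\<close> times \<open>(1 + Delta) ^ w\<close> applied to
  \<open>mono u\<close>, with \<open>w\<close> the weight of \<open>v\<close>. Evaluating the
  letters of \<open>v\<close> lowers the twist by \<open>w\<close>, so \<open>u\<close> is read
  without a twist, and \<open>v\<close> along the chain shifted by the degree of
  \<open>u\<close>.\<close>

lemma Lval_star:
  assumes "keys u \<subseteq> {..n}" "keys v \<subseteq> {..n}"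
  shows "Lval a c e (map_coeffs (star n a (mono u) (mono v)))
    - (if mono_deg u + mono_deg v = e
       then wval a (\<lambda>l. c (l + mono_deg u)) 0 (word v) * mval a c 0 u else 0) \<in> A"
proof -
  define js where "js = word v"
  have v: "v = mol js" and js: "set js \<subseteq> {..n}" "length js = mono_deg v"
    using assms(2) by (simp_all add: js_def set_word length_word)
  have u: "mono u \<in> forms n (mono_deg u)" using assms(1) by (intro forms_mono) auto
  define g where "g = sh n (weight a js) (mono u)"
  have g: "g \<in> forms n (mono_deg u)" unfolding g_def by (rule sh_forms[OF u])
  have star: "star n a (mono u) (mono v) = mono (mol js) * g"
    by (simp add: v g_def star_mol[OF js(1)])
  have mg: "mono (mol js) * g \<in> forms n (mono_deg u + mono_deg v)"
    using js g forms_mult[of "mono (mol js)" n "mono_deg v" g "mono_deg u"] forms_mono[of "mol js" n "mono_deg v"]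
    by (auto simp: keys_mol mono_deg_mol add.commute)
  have "twLval 0 (mono (mol js) * g) - wval a (\<lambda>l. c (l + mono_deg u)) 0 js * twLval (0 - weight a js) g \<in> A"
    by (rule twLval_mol_mult[OF g js(1)])
  moreover have "wval a (\<lambda>l. c (l + mono_deg u)) 0 js * (twLval (0 - weight a js) g - twLval 0 (mono u)) \<in> A"
    using twLval_sh[OF u, of "0 - weight a js" "weight a js"] by (intro ideal_set_mult[OF A]) (simp add: g_def)
  ultimately have "twLval 0 (mono (mol js) * g) - wval a (\<lambda>l. c (l + mono_deg u)) 0 js * twLval 0 (mono u) \<in> A"
    unfolding right_diff_distrib by (rule ideal_set_cong_trans[OF A])
  moreover have "twLval 0 (mono u) = mval a c 0 u" by (simp add: twLval_def)
  ultimately show ?thesis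
    unfolding star by (auto simp: Lval_map_coeffs[OF mg] ideal_set_0[OF A] simp flip: js_def)
qed

end

lemma base_mult_lsum:
  "base_mult R F G = lsum Cst (\<lambda>u. lsum Cst (\<lambda>v. map_coeffs (mono u \<otimes>\<^bsub>R\<^esub> mono v)) G) F"
  by (simp add: base_mult_def lsum_def Cst_mult sum_distrib_left mult.assoc)

lemma R_alg_mult [simp]: "f \<otimes>\<^bsub>R_alg n a\<^esub> g = star n a f g"
  by (simp add: R_alg_def)

lemma Lval_sum: "Lval a c d (sum f A) = (\<Sum>x\<in>A. Lval a c d (f x))"
  by (simp add: Lval_def)

text \<open>The terms with a fixed \<open>v\<close> add up to a multiple of the functional of
  \<open>F\<close> in degree \<open>e - mono_deg v\<close>; so the common kernel is a right
  ideal.\<close>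

lemma Lval_base_mult:
  assumes c: "chain n a A c" and F: "F \<in> polys {..n}" and G: "G \<in> polys {..n}"
    and L: "\<And>d. Lval a c d F \<in> A"
  shows "Lval a c e (base_mult (R_alg n a) F G) \<in> A"
proof -
  note A = chainD(1)[OF c]
  define X where "X u v = (if mono_deg u + mono_deg v = e
       then wval a (\<lambda>l. c (l + mono_deg u)) 0 (word v) * mval a c 0 u else 0)" for u v
  have "Lval a c e (base_mult (R_alg n a) F G)
      = (\<Sum>u\<in>keys F. \<Sum>v\<in>keys G. lookup F u * (lookup G v *
          Lval a c e (map_coeffs (star n a (mono u) (mono v)))))"
    unfolding base_mult_lsum lsum_def[of Cst] Lval_sum Lval_Cst_mult sum_distrib_left R_alg_mult ..
  moreover have "\<dots> - (\<Sum>u\<in>keys F. \<Sum>v\<in>keys G. lookup F u * (lookup G v * X u v)) \<in> A"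
  proof (intro ideal_set_cong_sum[OF A])
    fix u v assume "u \<in> keys F" "v \<in> keys G"
    then have "Lval a c e (map_coeffs (star n a (mono u) (mono v))) - X u v \<in> A"
      unfolding X_def using polysD[OF F] polysD[OF G] by (intro Lval_star[OF c])
    then have "lookup F u * (lookup G v * (Lval a c e (map_coeffs (star n a (mono u) (mono v))) - X u v)) \<in> A"
      by (intro ideal_set_mult[OF A])
    then show "lookup F u * (lookup G v * Lval a c e (map_coeffs (star n a (mono u) (mono v))))
      - lookup F u * (lookup G v * X u v) \<in> A"
      by (simp add: right_diff_distrib)
  qed
  moreover have "(\<Sum>u\<in>keys F. \<Sum>v\<in>keys G. lookup F u * (lookup G v * X u v))
      = (\<Sum>v\<in>keys G. lookup G v * (\<Sum>u\<in>keys F. lookup F u * X u v))"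
    by (subst sum.swap) (simp add: sum_distrib_left mult.left_commute)
  moreover have "\<dots> \<in> A"
  proof (rule ideal_set_sum[OF A], rule ideal_set_mult[OF A])
    fix v
    have "(\<Sum>u\<in>keys F. lookup F u * X u v)
      = (if mono_deg v \<le> e then wval a (\<lambda>l. c (l + (e - mono_deg v))) 0 (word v) * Lval a c (e - mono_deg v) F else 0)"
      unfolding Lval_def lsum_def sum_distrib_left X_def
      by (auto intro!: sum.cong sum.neutral)
    then show "(\<Sum>u\<in>keys F. lookup F u * X u v) \<in> A"
      using L ideal_set_mult[OF A] ideal_set_0[OF A] by simp
  qed
  ultimately show ?thesis using ideal_set_cong_mem[OF A] by simp
qed

section \<open>Solving for the chain: explicit points and the equations they satisfy\<close>

section \<open>The next point of a chain\<close>

text \<open>On the open set where all \<open>M\<^sub>m\<^sub>i = tw (- (a + i)) p m\<close> are invertible, \<open>link\<close> forces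
  \<open>q\<^sub>i = q\<^sub>m * M\<^sub>i\<^sub>m / M\<^sub>m\<^sub>i\<close>.  Clearing denominators gives \<open>next_pt\<close>.\<close>

definition denom :: "nat \<Rightarrow> 'k::field_char_0 \<Rightarrow> nat \<Rightarrow> (nat \<Rightarrow> 'k mpoly) \<Rightarrow> 'k mpoly" where
  "denom n a m p = (\<Prod>l\<le>n. tw (- (a + of_nat l)) p m)"

definition next_pt ::
    "nat \<Rightarrow> 'k::field_char_0 \<Rightarrow> nat \<Rightarrow> (nat \<Rightarrow> 'k mpoly) \<Rightarrow> nat \<Rightarrow> 'k mpoly" where
  "next_pt n a m p i =
     tw (- (a + of_nat m)) p i * (\<Prod>l\<in>{..n}-{i}. tw (- (a + of_nat l)) p m)"

primrec pts ::
    "nat \<Rightarrow> 'k::field_char_0 \<Rightarrow> (nat \<Rightarrow> nat) \<Rightarrow> (nat \<Rightarrow> 'k mpoly) \<Rightarrow> nat \<Rightarrow> nat \<Rightarrow> 'k mpoly" where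
  "pts n a ms p 0 = p"
| "pts n a ms p (Suc l) = next_pt n a (ms l) (pts n a ms p l)"

text \<open>The accumulated denominators, starting from a given \<open>H\<close>: the factor on
  \<open>c l\<close> in its proportionality with \<open>pts n a ms p l\<close>.\<close>

primrec denoms ::
    "nat \<Rightarrow> 'k::field_char_0 \<Rightarrow> (nat \<Rightarrow> nat) \<Rightarrow> (nat \<Rightarrow> 'k mpoly) \<Rightarrow> 'k mpoly \<Rightarrow> nat \<Rightarrow> 'k mpoly" where
  "denoms n a ms p H 0 = H"
| "denoms n a ms p H (Suc l) = denoms n a ms p H l * denom n a (ms l) (pts n a ms p l)"

lemma next_pt_lead: "m \<le> n \<Longrightarrow> next_pt n a m p m = denom n a m p"
  unfolding next_pt_def denom_def by (subst prod.remove[of "{..n}" m]) auto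

text \<open>After multiplication by a coordinate, \<open>H * b * c i\<close> agrees with
  \<open>e * b * v i\<close>. This moves an annihilation across a proportionality without inverting
  anything.\<close>

lemma faithful_scale:
  assumes A: "ideal_set A" and c: "faithful n A c" and "\<And>i. i \<le> n \<Longrightarrow> H * c i - e * v i \<in> A"
    and "e * b \<in> A"
  shows "H * b \<in> A"
proof (rule faithfulD[OF c])
  fix i assume "i \<le> n"
  have "b * (H * c i - e * v i) + v i * (e * b) \<in> A"
    by (rule ideal_set_add[OF A ideal_set_mult[OF A assms(3)[OF \<open>i \<le> n\<close>]] ideal_set_mult[OF A assms(4)]])
  then show "H * b * c i \<in> A" by (simp add: algebra_simps)
qed

text \<open>Every chain whose first point is proportional to \<open>p\<close> follows the explicit
  sequence, for any choice \<open>ms\<close> of charts, even where their denominators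
  vanish.\<close>

lemma pts_scale:
  assumes c: "chain n a A c" and ms: "\<And>l. ms l \<le> n"
    and 0: "\<And>i. i \<le> n \<Longrightarrow> H * c 0 i - e0 * p i \<in> A"
  shows "\<exists>e. \<forall>i\<le>n. denoms n a ms p H l * c l i - e * pts n a ms p l i \<in> A"
proof (induction l)
  case 0
  then show ?case using assms(3) by auto
next
  case (Suc l)
  note A = chainD(1)[OF c]
  define K where "K = denoms n a ms p H l"
  define v where "v = pts n a ms p l"
  define m where "m = ms l"
  have m: "m \<le> n" using ms by (simp add: m_def)
  obtain e where e: "\<And>i. i \<le> n \<Longrightarrow> K * c l i - e * v i \<in> A"
    using Suc by (auto simp: K_def v_def)
  \<comment> \<open>The new factor is dictated by the index \<open>m\<close>, where
    \<open>next_pt\<close> equals \<open>denom\<close>.\<close>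
  have "denoms n a ms p H (Suc l) * c (Suc l) i - (K * c (Suc l) m) * pts n a ms p (Suc l) i \<in> A"
    if i: "i \<le> n" for i
  proof -
    define x y x' y' where "x = tw (- (a + of_nat i)) (c l) m" and "y = tw (- (a + of_nat m)) (c l) i"
      and "x' = tw (- (a + of_nat i)) v m" and "y' = tw (- (a + of_nat m)) v i"
    have 1: "c (Suc l) i * x - c (Suc l) m * y \<in> A"
      using chainD(3)[OF c, of l] i m by (auto simp: link_def x_def y_def)
    have 2: "K * x - e * x' \<in> A" "K * y - e * y' \<in> A"
      unfolding x_def y_def x'_def y'_def using e i m by (auto intro!: tw_cong_ideal[OF A])
    have "c (Suc l) m * (K * y - e * y') - c (Suc l) i * (K * x - e * x')
        + K * (c (Suc l) i * x - c (Suc l) m * y) \<in> A"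
      by (rule ideal_set_add[OF A ideal_set_diff[OF A ideal_set_mult[OF A 2(2)] ideal_set_mult[OF A 2(1)]]
            ideal_set_mult[OF A 1]])
    then have "e * (c (Suc l) i * x' - c (Suc l) m * y') \<in> A" by (simp add: algebra_simps)
    \<comment> \<open>Faithfulness trades the unknown factor \<open>e\<close> for the known
      denominator \<open>K\<close>.\<close>
    then have "K * (c (Suc l) i * x' - c (Suc l) m * y') \<in> A"
      using e by (intro faithful_scale[OF A chainD(2)[OF c, of l], of K e v]) auto
    then have "(\<Prod>l\<in>{..n}-{i}. tw (- (a + of_nat l)) v m) * (K * (c (Suc l) i * x' - c (Suc l) m * y')) \<in> A"
      by (rule ideal_set_mult[OF A])
    moreover have "denom n a m v = x' * (\<Prod>l\<in>{..n}-{i}. tw (- (a + of_nat l)) v m)"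
      unfolding denom_def x'_def using i by (subst prod.remove[of "{..n}" i]) auto
    ultimately show ?thesis
      by (simp add: next_pt_def K_def v_def m_def y'_def algebra_simps)
  qed
  then show ?case by blast
qed

section \<open>Ideals of polynomial rings\<close>

lemma cring_mpoly_ring: "cring (mpoly_ring V :: 'a::comm_ring_1 mpoly ring)"
proof (intro cringI abelian_groupI comm_monoidI)
  show "\<exists>y\<in>carrier (mpoly_ring V). y \<oplus>\<^bsub>mpoly_ring V\<^esub> x = \<zero>\<^bsub>mpoly_ring V\<^esub>"
    if "x \<in> carrier (mpoly_ring V :: 'a mpoly ring)" for x
    using that polys_uminus[of x V] by (auto simp: mpoly_ring_def intro!: bexI[of _ "- x"])
qed (auto simp: mpoly_ring_def polys_add polys_mult algebra_simps)

lemma ideal_mpolyI: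
  fixes I :: "'a::comm_ring_1 mpoly set"
  assumes "I \<subseteq> polys V" "0 \<in> I" "\<And>f g. f \<in> I \<Longrightarrow> g \<in> I \<Longrightarrow> f + g \<in> I"
    and mult: "\<And>p f. p \<in> polys V \<Longrightarrow> f \<in> I \<Longrightarrow> p * f \<in> I"
  shows "ideal I (mpoly_ring V)"
proof -
  interpret R: cring "mpoly_ring V :: 'a mpoly ring" by (rule cring_mpoly_ring)
  have neg: "\<ominus>\<^bsub>mpoly_ring V\<^esub> f = - f" if "f \<in> polys V" for f :: "'a mpoly"
    using that polys_uminus[OF that] by (intro R.minus_equality) (auto simp: mpoly_ring_def)
  have uminus: "- f \<in> I" if "f \<in> I" for f
    using mult[OF polys_uminus[OF polys_1] that] by simp
  have mult': "f * p \<in> I" if "p \<in> polys V" "f \<in> I" for p f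
    using mult[OF that] by (simp add: mult.commute)
  show ?thesis
  proof (rule idealI)
    show "ring (mpoly_ring V :: 'a mpoly ring)" by unfold_locales
    show "subgroup I (add_monoid (mpoly_ring V))"
    proof (rule R.add.subgroupI)
      show "\<And>f. f \<in> I \<Longrightarrow> \<ominus>\<^bsub>mpoly_ring V\<^esub> f \<in> I"
        using neg uminus assms(1) by auto
    qed (use assms in \<open>auto simp: mpoly_ring_def\<close>)
  qed (use assms mult' in \<open>auto simp: mpoly_ring_def\<close>)
qed

lemma
  fixes I :: "'a::comm_ring_1 mpoly set"
  assumes "ideal I (mpoly_ring V)"
  shows ideal_mpoly_subset: "I \<subseteq> polys V"
    and ideal_mpoly_0: "0 \<in> I"
    and ideal_mpoly_add: "f \<in> I \<Longrightarrow> g \<in> I \<Longrightarrow> f + g \<in> I"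
    and ideal_mpoly_mult: "p \<in> polys V \<Longrightarrow> f \<in> I \<Longrightarrow> p * f \<in> I"
proof -
  interpret ideal I "mpoly_ring V" by fact
  show "I \<subseteq> polys V" using a_subset by (simp add: mpoly_ring_def)
  show "0 \<in> I" using additive_subgroup.zero_closed[OF is_additive_subgroup] by (simp add: mpoly_ring_def)
  show "f + g \<in> I" if "f \<in> I" "g \<in> I"
    using additive_subgroup.a_closed[OF is_additive_subgroup that] by (simp add: mpoly_ring_def)
  show "p * f \<in> I" if "p \<in> polys V" "f \<in> I"
    using I_l_closed[of f p] that by (simp add: mpoly_ring_def)
qed

lemma ideal_UNIV_iff: "ideal K (mpoly_ring UNIV) \<longleftrightarrow> ideal_set (K :: 'a::comm_ring_1 mpoly set)"
proof
  assume "ideal K (mpoly_ring UNIV)"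
  from ideal_mpoly_0[OF this] ideal_mpoly_add[OF this] ideal_mpoly_mult[OF this]
  show "ideal_set K" by (simp add: ideal_set_def)
next
  assume "ideal_set K"
  then show "ideal K (mpoly_ring UNIV)"
    by (intro ideal_mpolyI) (auto simp: ideal_set_def)
qed

lemma Idl_least: "ideal I R \<Longrightarrow> S \<subseteq> I \<Longrightarrow> Idl\<^bsub>R\<^esub> S \<subseteq> I"
  by (auto simp: genideal_def)

lemma Idl_memI: "(\<And>I. ideal I R \<Longrightarrow> S \<subseteq> I \<Longrightarrow> x \<in> I) \<Longrightarrow> x \<in> Idl\<^bsub>R\<^esub> S"
  by (auto simp: genideal_def)

text \<open>If \<open>s x\<^sub>i = p\<^sub>i e\<close> in a quotient, a form of degree \<open>d\<close> satisfies \<open>s\<^sup>d g(x) = g(p) e\<^sup>d\<close> there.\<close>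

lemma form_subst_cong:
  assumes I: "ideal I (mpoly_ring {..n})" and e: "e \<in> polys {..n}"
    and cI: "\<And>i. i \<le> n \<Longrightarrow> Cst s * Var i - Cst (p i) * e \<in> I" and g: "g \<in> forms n d"
  shows "Cst (s ^ d) * map_coeffs g - Cst (poly_subst p g) * e ^ d \<in> I"
proof -
  note I_add = ideal_mpoly_add[OF I] and I_mult = ideal_mpoly_mult[OF I]
  have ep: "e ^ m \<in> polys {..n}" for m using e by (rule polys_power)
  have mono: "Cst (s ^ length is) * mono (mol is) - Cst (monov p (mol is)) * e ^ length is \<in> I"
    if "set is \<subseteq> {..n}" for "is"
    using that
  proof (induction "is")
    case Nil
    then show ?case by (simp add: ideal_mpoly_0[OF I])
  next
    case (Cons i "is")
    have 1: "(Cst s * Var i) * (Cst (s ^ length is) * mono (mol is) - Cst (monov p (mol is)) * e ^ length is) \<in> I"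
      using Cons by (intro I_mult polys_mult polys_Cst polys_Var) auto
    have 2: "(Cst (monov p (mol is)) * e ^ length is) * (Cst s * Var i - Cst (p i) * e) \<in> I"
      using Cons.prems by (intro I_mult polys_mult polys_Cst ep cI) auto
    have "Cst (s ^ length (i # is)) * mono (mol (i # is)) - Cst (monov p (mol (i # is))) * e ^ length (i # is)
      = (Cst s * Var i) * (Cst (s ^ length is) * mono (mol is) - Cst (monov p (mol is)) * e ^ length is)
       + (Cst (monov p (mol is)) * e ^ length is) * (Cst s * Var i - Cst (p i) * e)"
      by (simp add: mono_add Var_def monov_add Cst_mult algebra_simps del: One_nat_def)
    then show ?case using I_add[OF 1 2] by simp
  qed
  show ?thesis
    using g
  proof (rule forms_induct_mono)
    fix "is" assume "set is \<subseteq> {..n}" "length is = d"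
    then show "Cst (s ^ d) * map_coeffs (mono (mol is)) - Cst (poly_subst p (mono (mol is))) * e ^ d \<in> I"
      using mono[of "is"] by (simp add: poly_subst_lsum)
  next
    fix x y assume "Cst (s ^ d) * map_coeffs x - Cst (poly_subst p x) * e ^ d \<in> I"
      "Cst (s ^ d) * map_coeffs y - Cst (poly_subst p y) * e ^ d \<in> I"
    from I_add[OF this] show "Cst (s ^ d) * map_coeffs (x + y) - Cst (poly_subst p (x + y)) * e ^ d \<in> I"
      by (simp add: map_coeffs_add poly_subst_add Cst_add algebra_simps)
  next
    fix b x assume "Cst (s ^ d) * map_coeffs x - Cst (poly_subst p x) * e ^ d \<in> I"
    from I_mult[OF _ this, of "Cst (Cst b)"]
    show "Cst (s ^ d) * map_coeffs (Cst b * x) - Cst (poly_subst p (Cst b * x)) * e ^ d \<in> I"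
      by (simp add: map_coeffs_Cst_mult poly_subst_mult Cst_mult right_diff_distrib mult.assoc mult.left_commute[of "Cst (s ^ d)"])
  qed (simp add: ideal_mpoly_0[OF I])
qed

definition evm where "evm p F = lsum (\<lambda>x. x) (monov p) F"

lemma evm_add: "evm p (F + G) = evm p F + evm p G"
  by (simp add: evm_def)

lemma evm_diff: "evm p (F - G) = evm p F - evm p G"
  by (simp add: evm_def)

lemma evm_mult: "evm p (F * G) = evm p F * evm p G"
  unfolding evm_def by (rule lsum_mult) (simp_all add: monov_add)

lemma evm_0 [simp]: "evm p 0 = 0"
  by (simp add: evm_def)

lemma evm_Cst_mult: "evm p (Cst b * F) = b * evm p F"
  by (simp add: evm_def)

lemma evm_Cst [simp]: "evm p (Cst b) = b"
  using evm_Cst_mult[of p b "mono 0"] by (simp add: evm_def del: mono_0 lsum_id_simps(3)) (simp add: lsum_mono)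

lemma evm_Var [simp]: "evm p (Var i) = p i"
  by (simp add: evm_def Var_def del: One_nat_def)

lemma evm_map_coeffs: "evm p (map_coeffs f) = poly_subst p f"
  by (simp add: evm_def lsum_map_coeffs poly_subst_lsum)

lemma poly_subst_mem_of_Idl:
  assumes A: "ideal_set A" and "N \<subseteq> polys {..n}" "\<And>v. v \<in> N \<Longrightarrow> evm p v \<in> A" "K \<subseteq> A"
    and f: "map_coeffs f \<in> Idl\<^bsub>mpoly_ring {..n}\<^esub> (N \<union> Cst ` K)"
  shows "poly_subst p f \<in> A"
proof -
  define I where "I = {F \<in> polys {..n}. evm p F \<in> A}"
  have "ideal I (mpoly_ring {..n})"
    by (rule ideal_mpolyI)
       (auto simp: I_def evm_mult evm_add ideal_set_0[OF A] ideal_set_add[OF A] ideal_set_mult[OF A]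
         intro: polys_add polys_mult)
  moreover have "N \<union> Cst ` K \<subseteq> I" using assms(2-4) by (auto simp: I_def)
  ultimately have "Idl\<^bsub>mpoly_ring {..n}\<^esub> (N \<union> Cst ` K) \<subseteq> I" by (rule Idl_least)
  then show ?thesis using f by (auto simp: I_def evm_map_coeffs)
qed

lemma ideal_set_Idl: "ideal_set (Idl\<^bsub>mpoly_ring UNIV\<^esub> S :: 'a::comm_ring_1 mpoly set)"
  by (rule ideal_setI) (auto simp: genideal_def ideal_UNIV_iff ideal_set_0 ideal_set_add ideal_set_mult)

text \<open>A prime containing \<open>K\<close> cannot contain the whole cover \<open>T\<close>,
  which together with \<open>K\<close> generates the unit ideal.\<close>

lemma invertible_quot_local:
  assumes inv: "invertible_quot K M N" and P: "prime_set P" "K \<subseteq> P"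
  obtains t e where "t \<notin> P" "e \<in> M" "\<And>v. v \<in> M \<Longrightarrow> \<exists>j b. Cst (t ^ j) * v - Cst b * e \<in> N"
    "\<And>b. Cst b * e \<in> N \<Longrightarrow> \<exists>j. t ^ j * b \<in> K"
proof -
  obtain T where T: "Idl\<^bsub>mpoly_ring UNIV\<^esub> (K \<union> T) = UNIV"
    and loc: "\<And>t. t \<in> T \<Longrightarrow> \<exists>e\<in>M. (\<forall>v\<in>M. \<exists>j b. Cst (t ^ j) * v - Cst b * e \<in> N) \<and>
           (\<forall>b. Cst b * e \<in> N \<longrightarrow> (\<exists>j. t ^ j * b \<in> K))"
    using inv by (auto simp: invertible_quot_def)
  have "\<not> T \<subseteq> P"
  proof
    assume "T \<subseteq> P"
    then have "Idl\<^bsub>mpoly_ring UNIV\<^esub> (K \<union> T) \<subseteq> P"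
      using P by (intro Idl_least) (auto simp: ideal_UNIV_iff prime_set_ideal)
    then show False using T prime_set_1[OF P(1)] by auto
  qed
  then obtain t where "t \<in> T" "t \<notin> P" by blast
  then show thesis using loc[of t] that by blast
qed

text \<open>By \<open>local_global\<close> the admissible \<open>t\<close> generate the unit ideal
  together with \<open>K\<close>; finitely many of them suffice to express 1 and form the
  cover.\<close>

lemma invertible_quotI:
  assumes "\<And>P. prime_set P \<Longrightarrow> K \<subseteq> P \<Longrightarrow> \<exists>t e. t \<notin> P \<and> e \<in> M \<and>
      (\<forall>v\<in>M. \<exists>j b. Cst (t ^ j) * v - Cst b * e \<in> N) \<and>
      (\<forall>b. Cst b * e \<in> N \<longrightarrow> (\<exists>j. t ^ j * b \<in> K))"
  shows "invertible_quot K M N"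
proof -
  define G where "G = {t. \<exists>e\<in>M. (\<forall>v\<in>M. \<exists>j b. Cst (t ^ j) * v - Cst b * e \<in> N) \<and>
      (\<forall>b. Cst b * e \<in> N \<longrightarrow> (\<exists>j. t ^ j * b \<in> K))}"
  define A where "A = {b. \<exists>T. finite T \<and> T \<subseteq> G \<and> b \<in> Idl\<^bsub>mpoly_ring UNIV\<^esub> (K \<union> T)}"
  have mono: "Idl\<^bsub>mpoly_ring UNIV\<^esub> S \<subseteq> Idl\<^bsub>mpoly_ring UNIV\<^esub> S'" if "S \<subseteq> S'" for S S' :: "'a mpoly set"
    using that by (auto simp: genideal_def)
  have sub: "S \<subseteq> Idl\<^bsub>mpoly_ring UNIV\<^esub> S" for S :: "'a mpoly set"
    by (auto simp: genideal_def)
  have "ideal_set A"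
  proof (rule ideal_setI)
    show "0 \<in> A" unfolding A_def using ideal_set_0[OF ideal_set_Idl] by blast
  next
    fix x y assume "x \<in> A" "y \<in> A"
    then obtain S T where "finite S" "S \<subseteq> G" "x \<in> Idl\<^bsub>mpoly_ring UNIV\<^esub> (K \<union> S)"
      "finite T" "T \<subseteq> G" "y \<in> Idl\<^bsub>mpoly_ring UNIV\<^esub> (K \<union> T)" by (auto simp: A_def)
    moreover from this have "x \<in> Idl\<^bsub>mpoly_ring UNIV\<^esub> (K \<union> (S \<union> T))"
      "y \<in> Idl\<^bsub>mpoly_ring UNIV\<^esub> (K \<union> (S \<union> T))"
      using mono[of "K \<union> S" "K \<union> (S \<union> T)"] mono[of "K \<union> T" "K \<union> (S \<union> T)"] by auto
    ultimately show "x + y \<in> A" unfolding A_def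
      by (intro CollectI exI[of _ "S \<union> T"]) (auto intro: ideal_set_add[OF ideal_set_Idl])
  next
    fix b x assume "x \<in> A"
    then show "b * x \<in> A" unfolding A_def using ideal_set_mult[OF ideal_set_Idl] by blast
  qed
  moreover have "K \<subseteq> A"
  proof
    fix x assume "x \<in> K"
    then show "x \<in> A" unfolding A_def using sub[of "K \<union> {}"] by (intro CollectI exI[of _ "{}"]) auto
  qed
  moreover have "G \<subseteq> A"
  proof
    fix x assume "x \<in> G"
    then show "x \<in> A" unfolding A_def using sub[of "K \<union> {x}"] by (intro CollectI exI[of _ "{x}"]) auto
  qed
  ultimately have "1 \<in> A"
    using assms by (intro local_global) (auto simp: G_def, blast)
  then obtain T where T: "finite T" "T \<subseteq> G" "1 \<in> Idl\<^bsub>mpoly_ring UNIV\<^esub> (K \<union> T)"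
    by (auto simp: A_def)
  have "x \<in> Idl\<^bsub>mpoly_ring UNIV\<^esub> (K \<union> T)" for x
    using ideal_set_mult[OF ideal_set_Idl T(3), of x] by simp
  then have "Idl\<^bsub>mpoly_ring UNIV\<^esub> (K \<union> T) = UNIV" by blast
  then show ?thesis
    using T(1,2) unfolding invertible_quot_def G_def by (intro exI[of _ T]) blast
qed

lemma
  assumes "S_submodule K M N"
  shows S_submodule_subset: "N \<subseteq> M"
    and S_submodule_0: "0 \<in> N"
    and S_submodule_add: "v \<in> N \<Longrightarrow> w \<in> N \<Longrightarrow> v + w \<in> N"
    and S_submodule_Cst: "v \<in> N \<Longrightarrow> Cst b * v \<in> N"
    and S_submodule_ideal: "b \<in> K \<Longrightarrow> v \<in> M \<Longrightarrow> Cst b * v \<in> N"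
  using assms by (auto simp: S_submodule_def)

lemma S_submodule_diff:
  "S_submodule K M N \<Longrightarrow> v \<in> N \<Longrightarrow> w \<in> N \<Longrightarrow> v - w \<in> (N :: 'b::comm_ring_1 mpoly set)"
  using S_submodule_add[of K M N v "Cst (-1) * w"] S_submodule_Cst[of K M N w "-1"]
  by (simp add: Cst_uminus)

section \<open>The equations of the point scheme\<close>

lemma poly_subst_tw: "poly_subst \<sigma> (tw s v i) = tw s (\<lambda>i. poly_subst \<sigma> (v i)) i"
  by (simp add: tw_def poly_subst_simps)

lemma poly_subst_pts: "poly_subst \<sigma> (pts n a ms p l i) = pts n a ms (\<lambda>i. poly_subst \<sigma> (p i)) l i"
  by (induction l arbitrary: i) (simp_all add: next_pt_def poly_subst_simps poly_subst_tw)

lemma poly_subst_denoms: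
  "poly_subst \<sigma> (denoms n a ms p H l) = denoms n a ms (\<lambda>i. poly_subst \<sigma> (p i)) (poly_subst \<sigma> H) l"
  by (induction l) (simp_all add: denom_def poly_subst_simps poly_subst_tw poly_subst_pts)

text \<open>The link between two successive explicit points. The denominators in front make it hold
  at the first point of every chain in every chart, so that for \<open>p = Var\<close> it is an
  element of \<open>chain_ideal\<close>.\<close>

definition link_eq ::
    "nat \<Rightarrow> 'k::field_char_0 \<Rightarrow> (nat \<Rightarrow> nat) \<Rightarrow> nat \<Rightarrow> nat \<Rightarrow> nat \<Rightarrow> (nat \<Rightarrow> 'k mpoly) \<Rightarrow> 'k mpoly" where
  "link_eq n a ms l i j p =
     denoms n a ms p 1 l * denoms n a ms p 1 (Suc l) *
     (pts n a ms p (Suc l) j * tw (- (a + of_nat j)) (pts n a ms p l) i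
      - pts n a ms p (Suc l) i * tw (- (a + of_nat i)) (pts n a ms p l) j)"

lemma poly_subst_link_eq:
  "poly_subst \<sigma> (link_eq n a ms l i j p) = link_eq n a ms l i j (\<lambda>i. poly_subst \<sigma> (p i))"
  by (simp add: link_eq_def poly_subst_simps poly_subst_denoms poly_subst_pts poly_subst_tw
      del: pts.simps denoms.simps)

text \<open>Times \<open>e l * e (Suc l)\<close>, the link of the explicit points is congruent to a
  multiple of the link of \<open>c\<close>; \<open>faithful_scale\<close> then replaces both factors
  by denominators.\<close>

lemma link_eq_chain:
  assumes c: "chain n a A c" and ms: "\<And>l. ms l \<le> n" and ij: "i \<le> n" "j \<le> n"
  shows "link_eq n a ms l i j (c 0) \<in> A"
proof -
  note A = chainD(1)[OF c]
  define v where "v = pts n a ms (c 0)"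
  define H where "H = denoms n a ms (c 0) 1"
  have "\<exists>e. \<forall>i\<le>n. H l * c l i - e * v l i \<in> A" for l
    unfolding H_def v_def by (rule pts_scale[OF c ms, of 1 1]) (simp add: ideal_set_0[OF A])
  then obtain e where e: "\<And>l i. i \<le> n \<Longrightarrow> H l * c l i - e l * v l i \<in> A" by metis
  have tw: "H l * tw s (c l) i - e l * tw s (v l) i \<in> A" if "i \<le> n" for s i
    using that e by (intro tw_cong_ideal[OF A]) auto
  define g where "g = v (Suc l) j * tw (- (a + of_nat j)) (v l) i
      - v (Suc l) i * tw (- (a + of_nat i)) (v l) j"
  have 1: "(e (Suc l) * v (Suc l) j) * (e l * tw (- (a + of_nat j)) (v l) i)
      - (H (Suc l) * c (Suc l) j) * (H l * tw (- (a + of_nat j)) (c l) i) \<in> A"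
    and 2: "(e (Suc l) * v (Suc l) i) * (e l * tw (- (a + of_nat i)) (v l) j)
      - (H (Suc l) * c (Suc l) i) * (H l * tw (- (a + of_nat i)) (c l) j) \<in> A"
    using ij by (auto intro!: ideal_set_cong_mult[OF A] ideal_set_cong_sym[OF A e] ideal_set_cong_sym[OF A tw])
  have 3: "H (Suc l) * H l * (c (Suc l) j * tw (- (a + of_nat j)) (c l) i
      - c (Suc l) i * tw (- (a + of_nat i)) (c l) j) \<in> A"
    using chainD(3)[OF c, of l] ij by (intro ideal_set_mult[OF A]) (auto simp: link_def)
  have "e l * (e (Suc l) * g) \<in> A"
    using ideal_set_add[OF A ideal_set_diff[OF A 1 2] 3] by (simp add: g_def algebra_simps)
  then have "H l * (e (Suc l) * g) \<in> A"
    using e by (intro faithful_scale[OF A chainD(2)[OF c, of l], of "H l" "e l" "v l"]) auto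
  then have "e (Suc l) * (H l * g) \<in> A" by (simp add: mult.left_commute)
  then have "H (Suc l) * (H l * g) \<in> A"
    using e by (intro faithful_scale[OF A chainD(2)[OF c, of "Suc l"], of "H (Suc l)" "e (Suc l)" "v (Suc l)"]) auto
  then show ?thesis by (simp add: link_eq_def g_def H_def v_def mult_ac)
qed

lemma tw_forms: "(\<And>k. k \<le> i \<Longrightarrow> v k \<in> forms n d) \<Longrightarrow> tw s v i \<in> forms n d"
  unfolding tw_def by (rule forms_sum) (auto intro: forms_Cst_mult)

lemma pts_forms:
  assumes ms: "\<And>l. ms l \<le> n" and "\<And>i. i \<le> n \<Longrightarrow> p i \<in> forms n d"
  shows "\<exists>D. \<forall>i\<le>n. pts n a ms p l i \<in> forms n D"
proof (induction l)
  case 0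
  then show ?case using assms by auto
next
  case (Suc l)
  then obtain D where D: "\<And>i. i \<le> n \<Longrightarrow> pts n a ms p l i \<in> forms n D" by blast
  have "pts n a ms p (Suc l) i \<in> forms n (D + n * D)" if i: "i \<le> n" for i
  proof -
    have card: "card ({..n} - {i}) = n" using i by simp
    have tw: "tw s (pts n a ms p l) k \<in> forms n D" if "k \<le> n" for s k
      using that D by (intro tw_forms) auto
    have "(\<Prod>k\<in>{..n} - {i}. tw (- (a + of_nat k)) (pts n a ms p l) (ms l)) \<in> forms n (card ({..n} - {i}) * D)"
      by (rule forms_prod) (use tw ms in auto)
    then show ?thesis
      unfolding pts.simps next_pt_def card by (rule forms_mult[OF tw[OF i]])
  qed
  then show ?case by blast
qed

lemma denoms_forms:
  assumes ms: "\<And>l. ms l \<le> n" and "\<And>i. i \<le> n \<Longrightarrow> p i \<in> forms n d"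
  shows "\<exists>D. denoms n a ms p 1 l \<in> forms n D"
proof (induction l)
  case 0
  then show ?case using forms_1[of n] by (auto intro!: exI[of _ 0])
next
  case (Suc l)
  obtain D where D: "\<And>i. i \<le> n \<Longrightarrow> pts n a ms p l i \<in> forms n D"
    using pts_forms[of ms n p d, OF assms] by blast
  have "denom n a (ms l) (pts n a ms p l) \<in> forms n (card {..n} * D)"
    unfolding denom_def using D ms le_trans by (intro forms_prod tw_forms) blast+
  then show ?case using Suc forms_mult unfolding denoms.simps by blast
qed

lemma link_eq_mem:
  assumes ms: "\<And>l. ms l \<le> n" and ij: "i \<le> n" "j \<le> n"
  shows "link_eq n a ms l i j Var \<in> chain_ideal n a"
    and "\<exists>D. link_eq n a ms l i j Var \<in> forms n D"
proof -
  have V: "\<And>i. i \<le> n \<Longrightarrow> Var i \<in> forms n 1" by (rule forms_Var)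
  obtain D1 D2 D3 D4 where
    D1: "denoms n a ms Var 1 l \<in> forms n D1" and D2: "denoms n a ms Var 1 (Suc l) \<in> forms n D2" and
    D3: "\<And>i. i \<le> n \<Longrightarrow> pts n a ms Var l i \<in> forms n D3" and
    D4: "\<And>i. i \<le> n \<Longrightarrow> pts n a ms Var (Suc l) i \<in> forms n D4"
    using denoms_forms[of ms n Var 1, OF ms V] pts_forms[of ms n Var 1, OF ms V] by metis
  have "link_eq n a ms l i j Var \<in> forms n (D1 + D2 + (D4 + D3))"
    unfolding link_eq_def using ij D3 D4
    by (intro forms_mult forms_diff D1 D2) (auto intro!: tw_forms simp del: pts.simps)
  then show "\<exists>D. link_eq n a ms l i j Var \<in> forms n D" by blast
  then obtain D where D: "link_eq n a ms l i j Var \<in> forms n D" by blast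
  then show "link_eq n a ms l i j Var \<in> chain_ideal n a"
    unfolding chain_ideal_def using formsD(1)[OF D] link_eq_chain[OF _ ms ij]
    by (auto simp: hom_part_form[OF D] poly_subst_link_eq dest: chainD(1)[THEN ideal_set_0])
qed

section \<open>Chains over a localisation\<close>

definition lead :: "'b set \<Rightarrow> (nat \<Rightarrow> 'b) \<Rightarrow> nat" where
  "lead P v = (LEAST i. v i \<notin> P)"

lemma lead:
  assumes "i \<le> n" "v i \<notin> P"
  shows "lead P v \<le> n" "v (lead P v) \<notin> P" "k < lead P v \<Longrightarrow> v k \<in> P"
proof -
  have "lead P v \<le> i" unfolding lead_def by (rule Least_le) fact
  then show "lead P v \<le> n" using assms by simp
  show "v (lead P v) \<notin> P" unfolding lead_def by (rule LeastI) fact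
  show "k < lead P v \<Longrightarrow> v k \<in> P" unfolding lead_def using not_less_Least by blast
qed

text \<open>The next point in the chart given by the leading index, which is admissible at the prime
  \<open>P\<close>: modulo \<open>P\<close> the leading coefficient is not changed by \<open>tw\<close>.\<close>

primrec pt_at :: "nat \<Rightarrow> 'k::field_char_0 \<Rightarrow> 'k mpoly set \<Rightarrow> (nat \<Rightarrow> 'k mpoly) \<Rightarrow> nat \<Rightarrow> nat \<Rightarrow> 'k mpoly" where
  "pt_at n a P p 0 = p"
| "pt_at n a P p (Suc l) = next_pt n a (lead P (pt_at n a P p l)) (pt_at n a P p l)"

definition lead_at where "lead_at n a P p l = lead P (pt_at n a P p l)"

lemma pts_lead_at: "pts n a (lead_at n a P p) p l = pt_at n a P p l"
  by (induction l) (simp_all add: lead_at_def)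

context
  fixes n and a :: "'k::field_char_0" and P and p :: "nat \<Rightarrow> 'k mpoly"
  assumes P: "prime_set P" and p: "\<exists>i\<le>n. p i \<notin> P"
begin

lemma tw_lead_notin: "i \<le> n \<Longrightarrow> v i \<notin> P \<Longrightarrow> tw s v (lead P v) \<notin> P"
  using prime_set_cong[OF P tw_lead[OF prime_set_ideal[OF P]]] lead[of i n v P] by blast

lemma denom_lead_notin: "i \<le> n \<Longrightarrow> v i \<notin> P \<Longrightarrow> denom n a (lead P v) v \<notin> P"
  unfolding denom_def by (intro prime_set_prod[OF P] tw_lead_notin)

lemma pt_at_notin: "\<exists>i\<le>n. pt_at n a P p l i \<notin> P"
proof (induction l)
  case 0
  then show ?case using p by simp
next
  case (Suc l)
  then obtain i where i: "i \<le> n" "pt_at n a P p l i \<notin> P" by blast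
  have "pt_at n a P p (Suc l) (lead P (pt_at n a P p l)) \<notin> P"
    using denom_lead_notin[of i "pt_at n a P p l"] i lead(1)[of i n "pt_at n a P p l" P] by (simp add: next_pt_lead)
  then show ?case using lead(1)[of i n "pt_at n a P p l" P] i by blast
qed

lemma lead_at:
  "lead_at n a P p l \<le> n" "pt_at n a P p l (lead_at n a P p l) \<notin> P"
  "k < lead_at n a P p l \<Longrightarrow> pt_at n a P p l k \<in> P"
  using pt_at_notin[of l] lead[of _ n "pt_at n a P p l" P] by (auto simp: lead_at_def)

lemma denoms_lead_at: "H \<notin> P \<Longrightarrow> denoms n a (lead_at n a P p) p H l \<notin> P"
proof (induction l)
  case (Suc l)
  obtain i where i: "i \<le> n" "pt_at n a P p l i \<notin> P" using pt_at_notin by blast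
  have "denom n a (lead_at n a P p l) (pt_at n a P p l) \<notin> P"
    using denom_lead_notin[of i "pt_at n a P p l"] i by (simp add: lead_at_def)
  then show ?case using Suc by (auto simp: pts_lead_at dest: prime_set_mult[OF P])
qed simp

text \<open>The equations \<open>link_eq\<close> hold at \<open>p\<close>. In the charts of the
  leading indices their prefactors lie outside \<open>P\<close>, so they can be cancelled in
  \<open>loc K P\<close>.\<close>

lemma chain_at:
  assumes K: "ideal_set K"
    and I: "\<And>f D. f \<in> chain_ideal n a \<Longrightarrow> f \<in> forms n D \<Longrightarrow> poly_subst p f \<in> loc K P"
  shows "chain n a (loc K P) (pt_at n a P p)"
  unfolding chain_def
proof (intro conjI allI)
  show A: "ideal_set (loc K P)" by (rule ideal_set_loc[OF K P])
  fix d
  show "faithful n (loc K P) (pt_at n a P p d)"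
    unfolding faithful_def
  proof (intro allI impI)
    fix b assume "\<forall>i\<le>n. b * pt_at n a P p d i \<in> loc K P"
    then have "pt_at n a P p d (lead_at n a P p d) * b \<in> loc K P"
      using lead_at(1) by (simp add: mult.commute)
    then show "b \<in> loc K P" by (rule loc_cancel[OF K P lead_at(2)])
  qed
  show "link n a (loc K P) (pt_at n a P p d) (pt_at n a P p (Suc d))"
    unfolding link_def
  proof (intro allI impI)
    fix i j assume ij: "i \<le> n" "j \<le> n"
    let ?ms = "lead_at n a P p"
    obtain D where "link_eq n a ?ms d i j Var \<in> forms n D"
      using link_eq_mem(2)[of ?ms, OF lead_at(1) ij] by blast
    then have "link_eq n a ?ms d i j p \<in> loc K P"
      using I[OF link_eq_mem(1)[of ?ms, OF lead_at(1) ij]] by (simp add: poly_subst_link_eq)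
    moreover have "denoms n a ?ms p 1 d * denoms n a ?ms p 1 (Suc d) \<notin> P"
      by (intro prime_set_mult[OF P] denoms_lead_at prime_set_1[OF P])
    ultimately show "pt_at n a P p (Suc d) j * tw (- (a + of_nat j)) (pt_at n a P p d) i
        - pt_at n a P p (Suc d) i * tw (- (a + of_nat i)) (pt_at n a P p d) j \<in> loc K P"
      using loc_cancel[OF K P] unfolding link_eq_def pts_lead_at by blast
  qed
qed

text \<open>The monomial of the leading indices is the candidate for a generator of the degree
  \<open>d\<close> part near \<open>P\<close>.\<close>

lemma Lval_lead_at:
  assumes c: "chain n a A (pt_at n a P p)" and "A \<subseteq> P"
  shows "Lval a (pt_at n a P p) d (mono (mol (rev (map (lead_at n a P p) [0..<d])))) \<notin> P"
proof -
  define js where "js = rev (map (lead_at n a P p) [0..<d])"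
  have js: "set js \<subseteq> {..n}" "length js = d" using lead_at(1) by (auto simp: js_def)
  have "wval a (pt_at n a P p) 0 js \<notin> P"
    by (rule wval_lead[OF P]) (use lead_at(2,3) in \<open>auto simp: js_def\<close>)
  moreover have "mval a (pt_at n a P p) 0 (mol js) - wval a (pt_at n a P p) 0 js \<in> P"
    using mval_mol[OF c js(1)] \<open>A \<subseteq> P\<close> by blast
  ultimately have "mval a (pt_at n a P p) 0 (mol js) \<notin> P"
    using prime_set_cong[OF P] by blast
  then show ?thesis by (simp add: Lval_mono mono_deg_mol js flip: js_def)
qed

end

section \<open>The bijection between point modules and points of the scheme\<close>

section \<open>From points of the scheme to point modules\<close>

lemma Lval1_expand:
  assumes v: "v \<in> forms n 1" and "0 \<in> N" "\<And>v w. v \<in> N \<Longrightarrow> w \<in> N \<Longrightarrow> v + w \<in> N"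
    "\<And>b v. v \<in> N \<Longrightarrow> Cst b * v \<in> N"
    and "\<And>i. i \<le> n \<Longrightarrow> Cst s * Var i - Cst (c 0 i) * e \<in> N"
  shows "Cst s * v - Cst (Lval a c 1 v) * e \<in> N"
  using v
proof (rule forms_induct_mono)
  show "Cst s * 0 - Cst (Lval a c 1 0) * e \<in> N" using assms(2) by simp
next
  fix f g assume "Cst s * f - Cst (Lval a c 1 f) * e \<in> N" "Cst s * g - Cst (Lval a c 1 g) * e \<in> N"
  from assms(3)[OF this] show "Cst s * (f + g) - Cst (Lval a c 1 (f + g)) * e \<in> N"
    by (simp add: Lval_add Cst_add algebra_simps)
next
  fix b f assume "Cst s * f - Cst (Lval a c 1 f) * e \<in> N"
  from assms(4)[OF this, of b] show "Cst s * (Cst b * f) - Cst (Lval a c 1 (Cst b * f)) * e \<in> N"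
    by (simp add: Lval_Cst_mult Cst_mult right_diff_distrib mult.assoc mult.left_commute[of "Cst s"])
next
  fix "is" assume "is": "set is \<subseteq> {..n}" "length is = 1"
  then obtain i where i: "is = [i]" "i \<le> n" by (auto simp: length_Suc_conv)
  then show "Cst s * mono (mol is) - Cst (Lval a c 1 (mono (mol is))) * e \<in> N"
    using assms(5)[OF i(2)] by (simp add: Var_def Lval_mono del: One_nat_def)
qed

lemma Lval1_mem:
  assumes A: "ideal_set A" and v: "v \<in> forms n 1" and c: "\<And>i. i \<le> n \<Longrightarrow> c 0 i \<in> A"
  shows "Lval a c 1 v \<in> A"
proof -
  \<comment> \<open>The expansion with \<open>s = 0\<close> and \<open>e = 1\<close>, in the module
    of polynomials with coefficients in \<open>A\<close>, exposes the value as a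
    coefficient.\<close>
  have "Cst 0 * v - Cst (Lval a c 1 v) * 1 \<in> {F. \<forall>u. lookup F u \<in> A}"
    by (rule Lval1_expand[OF v])
       (auto simp: ideal_set_0[OF A] lookup_add ideal_set_add[OF A] ideal_set_mult[OF A] c
          lookup_minus ideal_set_uminus[OF A] ideal_set_mult_right[OF A] simp del: mult_1_right)
  then have "lookup (Cst 0 * v - Cst (Lval a c 1 v) * 1) 0 \<in> A" by blast
  then have "- Lval a c 1 v \<in> A"
    by (simp only: lookup_minus lookup_Cst_mult lookup_one_zero) simp
  then show ?thesis using ideal_set_uminus[OF A] by fastforce
qed

text \<open>A trivialisation over the open set where \<open>t\<close> is invertible: modulo
  \<open>N\<close>, \<open>e\<close> is a generator and \<open>p i / s\<close> the coordinate of the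
  variable \<open>i\<close>, with one power \<open>s\<close> of \<open>t\<close> as common
  denominator.\<close>

definition datum where
  "datum n K N t s e p \<longleftrightarrow> e \<in> forms n 1 \<and> (\<exists>j. s = t ^ j) \<and>
     (\<forall>i\<le>n. Cst s * Var i - Cst (p i) * e \<in> N) \<and> (\<forall>b. Cst b * e \<in> N \<longrightarrow> (\<exists>j. t ^ j * b \<in> K))"

lemma datumE:
  assumes K: "ideal_set K" and N: "S_submodule K (forms n 1) N" "invertible_quot K (forms n 1) N"
    and P: "prime_set P" "K \<subseteq> P"
  obtains t s e p where "t \<notin> P" "datum n K N t s e p"
proof -
  obtain t e where t: "t \<notin> P" "e \<in> forms n 1"
    and gen: "\<And>v. v \<in> forms n 1 \<Longrightarrow> \<exists>j b. Cst (t ^ j) * v - Cst b * e \<in> N"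
    and ann: "\<And>b. Cst b * e \<in> N \<Longrightarrow> \<exists>j. t ^ j * b \<in> K"
    by (rule invertible_quot_local[OF N(2) P]) blast
  obtain j b where jb: "\<And>i. i \<le> n \<Longrightarrow> Cst (t ^ j i) * Var i - Cst (b i) * e \<in> N"
    using gen[OF forms_Var] by metis
  define J where "J = (\<Sum>i\<le>n. j i)"
  have "Cst (t ^ J) * Var i - Cst (t ^ (J - j i) * b i) * e \<in> N" if "i \<le> n" for i
  proof -
    have le: "j i \<le> J" using that member_le_sum[of i "{..n}" j] by (simp add: J_def)
    have "Cst (t ^ (J - j i)) * (Cst (t ^ j i) * Var i - Cst (b i) * e) \<in> N"
      by (rule S_submodule_Cst[OF N(1) jb[OF that]])
    moreover have "t ^ J = t ^ (J - j i) * t ^ j i" using le by (simp flip: power_add)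
    ultimately show ?thesis by (simp add: Cst_mult right_diff_distrib mult.assoc)
  qed
  then have "datum n K N t (t ^ J) e (\<lambda>i. t ^ (J - j i) * b i)"
    using t ann by (auto simp: datum_def)
  then show thesis using t that by blast
qed

context
  fixes n and a :: "'k::field_char_0" and K N
  assumes K: "ideal_set K" and N: "N \<in> proj_points n (chain_ideal n a) K"
begin

private lemma sub: "S_submodule K (forms n 1) N" and inv: "invertible_quot K (forms n 1) N"
  and van: "map_coeffs ` chain_ideal n a \<subseteq> Idl\<^bsub>mpoly_ring {..n}\<^esub> (N \<union> Cst ` K)"
  using N by (auto simp: proj_points_def)

private lemmas N_expand =
  Lval1_expand[OF _ S_submodule_0[OF sub] S_submodule_add[OF sub] S_submodule_Cst[OF sub]]

context
  fixes P t s e p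
  assumes P: "prime_set P" "K \<subseteq> P" and t: "t \<notin> P" and d: "datum n K N t s e p"
begin

private lemma e: "e \<in> forms n 1" and gen: "\<And>i. i \<le> n \<Longrightarrow> Cst s * Var i - Cst (p i) * e \<in> N"
  and ann: "\<And>b. Cst b * e \<in> N \<Longrightarrow> b \<in> loc K P" and s: "s \<notin> P"
proof -
  have "t ^ j \<notin> P" for j using prime_set_power[OF P(1) t] .
  then show "s \<notin> P" "\<And>b. Cst b * e \<in> N \<Longrightarrow> b \<in> loc K P"
    using d unfolding datum_def loc_def by blast+
qed (use d in \<open>auto simp: datum_def\<close>)

private lemma expand: "v \<in> forms n 1 \<Longrightarrow> c 0 = p \<Longrightarrow> Cst s * v - Cst (Lval a c 1 v) * e \<in> N"
proof (erule N_expand)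
  show "Cst s * Var i - Cst (c 0 i) * e \<in> N" if "c 0 = p" "i \<le> n" for i
    using gen[OF that(2)] that(1) by simp
qed

private lemma Lval_N: "v \<in> N \<Longrightarrow> c 0 = p \<Longrightarrow> Lval a c 1 v \<in> loc K P"
proof -
  assume v: "v \<in> N" "c 0 = p"
  have "Cst s * v - (Cst s * v - Cst (Lval a c 1 v) * e) \<in> N"
    using v S_submodule_subset[OF sub]
    by (intro S_submodule_diff[OF sub] S_submodule_Cst[OF sub] expand) auto
  then show ?thesis by (intro ann) simp
qed

text \<open>Expanding \<open>e\<close> in terms of itself shows that \<open>s\<close> equals the
  value at \<open>e\<close> in the local ring. But \<open>s\<close> is a unit there, while the value
  is a combination of the coordinates \<open>p i\<close>.\<close>

private lemma p_notin: "\<exists>i\<le>n. p i \<notin> P"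
proof (rule ccontr)
  assume "\<not> (\<exists>i\<le>n. p i \<notin> P)"
  then have "Lval a (\<lambda>_. p) 1 e \<in> P"
    by (intro Lval1_mem[OF prime_set_ideal[OF P(1)] e]) auto
  moreover have "Cst s * e - Cst (Lval a (\<lambda>_. p) 1 e) * e \<in> N" by (rule expand[OF e]) simp
  then have "s - Lval a (\<lambda>_. p) 1 e \<in> loc K P"
    by (intro ann) (simp add: Cst_diff left_diff_distrib)
  then have "s - Lval a (\<lambda>_. p) 1 e \<in> P" using loc_subset[OF K P] by blast
  ultimately show False using s ideal_set_cong_mem[OF prime_set_ideal[OF P(1)]] by blast
qed

private lemma subst_p:
  assumes "f \<in> chain_ideal n a"
  shows "poly_subst p f \<in> loc K P"
proof (rule poly_subst_mem_of_Idl[OF ideal_set_loc[OF K P(1)]])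
  show "N \<subseteq> polys {..n}" using S_submodule_subset[OF sub] formsD(1) by blast
  show "K \<subseteq> loc K P" by (rule loc_superset[OF K P(1)])
  show "map_coeffs f \<in> Idl\<^bsub>mpoly_ring {..n}\<^esub> (N \<union> Cst ` K)" using van assms by blast
  fix v assume v: "v \<in> N"
  then have "v \<in> forms n 1" using S_submodule_subset[OF sub] by blast
  then have "evm p v = Lval a (\<lambda>_. p) 1 v"
  proof (rule forms_induct_mono)
    fix "is" assume "is": "set is \<subseteq> {..n}" "length is = 1"
    then obtain i where "is = [i]" by (auto simp: length_Suc_conv)
    then show "evm p (mono (mol is)) = Lval a (\<lambda>_. p) 1 (mono (mol is))"
      by (simp add: Lval_mono evm_def del: One_nat_def)
  qed (simp_all add: Lval_add Lval_Cst_mult evm_add evm_Cst_mult)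
  then show "evm p v \<in> loc K P" using Lval_N[OF v] by simp
qed

private lemma chain_p: "chain n a (loc K P) (pt_at n a P p)"
  by (rule chain_at[OF P(1) p_notin K]) (rule subst_p)

private lemma Lval_N_iff:
  assumes v: "v \<in> forms n 1" and L: "Lval a (pt_at n a P p) 1 v \<in> loc K P"
  shows "\<exists>r. r \<notin> P \<and> Cst r * v \<in> N"
proof -
  let ?L = "Lval a (pt_at n a P p) 1 v"
  obtain r where r: "r \<notin> P" "r * ?L \<in> K" using L by (auto simp: loc_def)
  have "Cst r * (Cst s * v - Cst ?L * e) + Cst (r * ?L) * e \<in> N"
    using r e by (intro S_submodule_add[OF sub] S_submodule_Cst[OF sub] expand[OF v]
        S_submodule_ideal[OF sub]) auto
  then have "Cst (r * s) * v \<in> N" by (simp add: Cst_mult algebra_simps)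
  then show ?thesis using prime_set_mult[OF P(1) r(1) s] by blast
qed

lemmas point_at =
  s p_notin chain_p Lval_N[of _ "pt_at n a P p", OF _ pt_at.simps(1)] Lval_N_iff

end

text \<open>Since the point \<open>N\<close> extends to a chain only locally, the right ideal is cut out by all chains
  starting at \<open>N\<close> modulo some ideal; this avoids gluing.\<close>

definition adapted where
  "adapted A c \<longleftrightarrow> chain n a A c \<and> K \<subseteq> A \<and> (\<forall>v\<in>N. Lval a c 1 v \<in> A)"

definition pt_ideal where
  "pt_ideal = {F \<in> polys {..n}. \<forall>A c. adapted A c \<longrightarrow> (\<forall>d. Lval a c d F \<in> A)}"

lemma adapted_at:
  assumes "prime_set P" "K \<subseteq> P" "t \<notin> P" "datum n K N t s e p"
  shows "adapted (loc K P) (pt_at n a P p)"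
  using point_at[OF assms] loc_superset[OF K assms(1)] by (auto simp: adapted_def)

text \<open>The functional of an adapted chain kills the relations of the datum, so its first point
  is proportional to \<open>p\<close> and \<open>pts_scale\<close> applies.\<close>

lemma adapted_scale:
  assumes ad: "adapted A c" and d: "datum n K N t s e p" and ms: "\<And>l. ms l \<le> n"
  shows "\<exists>E. \<forall>F\<in>forms n d. (\<Prod>l<d. denoms n a ms p s l) * Lval a c d F - E * Lval a (pts n a ms p) d F \<in> A"
proof -
  have c: "chain n a A c" and A: "ideal_set A" using ad chainD by (auto simp: adapted_def)
  have "s * c 0 i - Lval a c 1 e * p i \<in> A" if "i \<le> n" for i
  proof -
    have "Lval a c 1 (Cst s * Var i - Cst (p i) * e) \<in> A"
      using d ad that unfolding datum_def adapted_def by blast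
    then show ?thesis
      by (simp add: Lval_diff Lval_Cst_mult mult.commute[of "Lval a c 1 e"] del: One_nat_def)
  qed
  then have "\<exists>e. \<forall>i\<le>n. denoms n a ms p s l * c l i - e * pts n a ms p l i \<in> A" for l
    by (rule pts_scale[OF c ms])
  then obtain E where E: "\<And>l i. i \<le> n \<Longrightarrow> denoms n a ms p s l * c l i - E l * pts n a ms p l i \<in> A"
    by metis
  show ?thesis
    using Lval_scale[OF A, of d n "denoms n a ms p s" c E "pts n a ms p"] E
    by (intro exI[of _ "\<Prod>l<d. E l"] ballI) auto
qed

lemma pt_ideal_invertible: "invertible_quot K (forms n d) (pt_ideal \<inter> forms n d)"
proof (rule invertible_quotI)
  fix P assume P: "prime_set P" "K \<subseteq> P"
  obtain t s e p where t: "t \<notin> P" "datum n K N t s e p"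
    by (rule datumE[OF K sub inv P])
  note pt = point_at[OF P t]
  define ms where "ms = lead_at n a P p"
  have ms: "ms l \<le> n" for l unfolding ms_def by (rule lead_at(1)[OF P(1) pt(2)])
  define H where "H = (\<Prod>l<d. denoms n a ms p s l)"
  define L where "L = Lval a (pts n a ms p) d"
  define E where "E = (mono (mol (rev (map ms [0..<d]))) :: 'k mpoly mpoly)"
  have pts: "pts n a ms p = pt_at n a P p" unfolding ms_def by (rule ext)+ (simp add: pts_lead_at)
  have E: "E \<in> forms n d"
    unfolding E_def using ms by (intro forms_mono) (auto simp: keys_mol mono_deg_mol)
  have D: "L E \<notin> P"
    unfolding L_def E_def pts unfolding ms_def by (rule Lval_lead_at[OF P(1) pt(2,3) loc_subset[OF K P]])
  have H: "H \<notin> P"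
    unfolding H_def ms_def by (intro prime_set_prod[OF P(1)] denoms_lead_at[OF P(1) pt(2,1)])
  \<comment> \<open>Inverting \<open>T\<close> inverts the denominator of the trivialisation, those
    of the charts \<open>ms\<close>, and the value at \<open>E\<close>.\<close>
  define T where "T = t * H * L E"
  have T: "T \<notin> P" unfolding T_def by (intro prime_set_mult[OF P(1)] t D H)
  have gen: "\<exists>j b. Cst (T ^ j) * v - Cst b * E \<in> pt_ideal \<inter> forms n d" if v: "v \<in> forms n d" for v
  proof -
    \<comment> \<open>\<open>L\<close> kills \<open>w\<close> by construction, so every adapted
      functional kills \<open>H * w\<close>.\<close>
    define w where "w = Cst (L E) * v - Cst (L v) * E"
    have w: "w \<in> forms n d" unfolding w_def by (intro forms_diff forms_Cst_mult v E)
    have "Cst (t * H) * w \<in> pt_ideal"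
      unfolding pt_ideal_def
    proof (intro CollectI conjI allI impI)
      show tw: "Cst (t * H) * w \<in> polys {..n}" using formsD(1)[OF w] by (intro polys_mult) auto
      fix A c d' assume ad: "adapted A c"
      then have A: "ideal_set A" using chainD by (auto simp: adapted_def)
      show "Lval a c d' (Cst (t * H) * w) \<in> A"
      proof (cases "d' = d")
        case True
        obtain R where "H * Lval a c d w - R * L w \<in> A"
          using adapted_scale[where ms = ms, OF ad t(2) ms] w unfolding H_def L_def by blast
        moreover have "L w = 0" by (simp add: w_def L_def Lval_diff Lval_Cst_mult)
        ultimately have "H * Lval a c d w \<in> A" by simp
        then have "t * (H * Lval a c d w) \<in> A" by (rule ideal_set_mult[OF A])
        then show ?thesis using True by (simp add: Lval_Cst_mult mult.assoc)
      next
        case False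
        have "Lval a c d' w = 0"
          using Lval_hom_part[of a c d' d w] hom_part_form[OF w, of d] False by simp
        then show ?thesis by (simp add: Lval_Cst_mult ideal_set_0[OF A])
      qed
    qed
    moreover have "Cst (t * H) * w = Cst (T ^ 1) * v - Cst (t * H * L v) * E"
      by (simp add: w_def T_def Cst_mult algebra_simps)
    ultimately show ?thesis using forms_Cst_mult[OF w, of "t * H"] by (metis IntI)
  qed
  have ann: "\<exists>j. T ^ j * b \<in> K" if b: "Cst b * E \<in> pt_ideal \<inter> forms n d" for b
  proof -
    have A: "ideal_set {r. r * b \<in> K}"
      by (rule ideal_setI) (auto simp: ideal_set_0[OF K] distrib_right ideal_set_add[OF K] mult.assoc ideal_set_mult[OF K])
    \<comment> \<open>Tested at the primes \<open>Q\<close> that avoid \<open>T\<close>. The chain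
      at \<open>Q\<close> uses the charts of \<open>Q\<close>, not \<open>ms\<close>; the factor
      \<open>R\<close> comparing the two lies outside \<open>Q\<close>, because the functional at
      \<open>Q\<close> has a value outside \<open>Q\<close>.\<close>
    have "\<exists>j. T ^ j \<in> {r. r * b \<in> K}"
    proof (rule power_mem_local[OF A])
      fix Q assume Q: "prime_set Q" "{r. r * b \<in> K} \<subseteq> Q" "T \<notin> Q"
      have KQ: "K \<subseteq> Q" using Q(2) ideal_set_mult_right[OF K] by blast
      have tQ: "t \<notin> Q" and DQ: "L E \<notin> Q"
        using prime_set_multD[OF Q(1)] Q(3) unfolding T_def by blast+
      have ad: "adapted (loc K Q) (pt_at n a Q p)" by (rule adapted_at[OF Q(1) KQ tQ t(2)])
      note ptQ = point_at[OF Q(1) KQ tQ t(2)]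
      let ?L = "Lval a (pt_at n a Q p) d"
      obtain R where R: "\<And>F. F \<in> forms n d \<Longrightarrow> H * ?L F - R * L F \<in> loc K Q"
        using adapted_scale[where ms = ms, OF ad t(2) ms] unfolding H_def L_def by blast
      have R': "H * ?L F - R * L F \<in> Q" if "F \<in> forms n d" for F
        using R[OF that] loc_subset[OF K Q(1) KQ] by blast
      have HQ: "H \<notin> Q" using prime_set_multD[OF Q(1)] Q(3) unfolding T_def by blast
      define E' where "E' = (mono (mol (rev (map (lead_at n a Q p) [0..<d]))) :: 'k mpoly mpoly)"
      have E': "E' \<in> forms n d"
        unfolding E'_def using lead_at(1)[OF Q(1) ptQ(2)] by (intro forms_mono) (auto simp: keys_mol mono_deg_mol)
      have "?L E' \<notin> Q"
        unfolding E'_def by (rule Lval_lead_at[OF Q(1) ptQ(2,3) loc_subset[OF K Q(1) KQ]])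
      then have "H * ?L E' \<notin> Q" by (rule prime_set_mult[OF Q(1) HQ])
      then have "R * L E' \<notin> Q"
        using R'[OF E'] ideal_set_cong_mem[OF prime_set_ideal[OF Q(1)]] by blast
      then have "R \<notin> Q" using prime_set_multD[OF Q(1)] by blast
      then have "R * L E \<notin> Q" using DQ by (rule prime_set_mult[OF Q(1)])
      then have "H * ?L E \<notin> Q" by (rule prime_set_cong[OF Q(1) R'[OF E]])
      then have LE: "?L E \<notin> Q" using prime_set_multD[OF Q(1)] by blast
      have "?L (Cst b * E) \<in> loc K Q" using b ad by (auto simp: pt_ideal_def)
      then have "?L E * b \<in> loc K Q" by (simp only: Lval_Cst_mult mult.commute[of b])
      then have "b \<in> loc K Q" by (rule loc_cancel[OF K Q(1) LE])
      then show "\<exists>r\<in>{r. r * b \<in> K}. r \<notin> Q" by (auto simp: loc_def)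
    qed
    then show ?thesis by simp
  qed
  show "\<exists>t e. t \<notin> P \<and> e \<in> forms n d \<and>
      (\<forall>v\<in>forms n d. \<exists>j b. Cst (t ^ j) * v - Cst b * e \<in> pt_ideal \<inter> forms n d) \<and>
      (\<forall>b. Cst b * e \<in> pt_ideal \<inter> forms n d \<longrightarrow> (\<exists>j. t ^ j * b \<in> K))"
    using T E gen ann by blast
qed

text \<open>For the inclusion into \<open>N\<close>, the adapted chain at each prime detects
  membership in the localisation of \<open>N\<close>.\<close>

lemma pt_ideal_degree_1: "pt_ideal \<inter> forms n 1 = N"
proof
  show "N \<subseteq> pt_ideal \<inter> forms n 1"
  proof
    fix v assume v: "v \<in> N"
    then have v1: "v \<in> forms n 1" using S_submodule_subset[OF sub] by blast
    have "Lval a c d v \<in> A" if ad: "adapted A c" for A c d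
    proof (cases "d = 1")
      case True
      then show ?thesis using ad v by (auto simp: adapted_def)
    next
      case False
      have "Lval a c d v = 0"
        using Lval_hom_part[of a c d 1 v] hom_part_form[OF v1, of 1] False by simp
      then show ?thesis using ad by (auto simp: adapted_def dest: chainD(1)[THEN ideal_set_0])
    qed
    then show "v \<in> pt_ideal \<inter> forms n 1" using v1 formsD(1)[OF v1] by (auto simp: pt_ideal_def)
  qed
  show "pt_ideal \<inter> forms n 1 \<subseteq> N"
  proof
    fix v assume v: "v \<in> pt_ideal \<inter> forms n 1"
    have A: "ideal_set {r. Cst r * v \<in> N}"
      by (rule ideal_setI)
         (auto simp: S_submodule_0[OF sub] Cst_add distrib_right S_submodule_add[OF sub] Cst_mult
           mult.assoc S_submodule_Cst[OF sub])
    have "1 \<in> {r. Cst r * v \<in> N}"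
    proof (rule local_global[OF A])
      fix P assume P: "prime_set P" "{r. Cst r * v \<in> N} \<subseteq> P"
      have KP: "K \<subseteq> P" using v S_submodule_ideal[OF sub] P(2) by blast
      obtain t s e p where t: "t \<notin> P" "datum n K N t s e p"
        by (rule datumE[OF K sub inv P(1) KP])
      have "Lval a (pt_at n a P p) 1 v \<in> loc K P"
        using v adapted_at[OF P(1) KP t] by (auto simp: pt_ideal_def)
      then show "\<exists>r\<in>{r. Cst r * v \<in> N}. r \<notin> P"
        using point_at(5)[OF P(1) KP t] v by blast
    qed
    then show "v \<in> N" by simp
  qed
qed

end

section \<open>From point modules to points of the scheme\<close>

lemma base_mult_add_left: "base_mult R (F + G) H = base_mult R F H + base_mult R G H"
  by (simp add: base_mult_lsum)

lemma base_mult_diff_left: "base_mult R (F - G) H = base_mult R F H - base_mult R G H"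
  by (simp add: base_mult_lsum)

lemma base_mult_Cst_left: "base_mult R (Cst b * F) H = Cst b * base_mult R F H"
  by (simp add: base_mult_lsum)

lemma base_mult_0_left [simp]: "base_mult R 0 H = 0"
  by (simp add: base_mult_lsum)

lemma base_mult_Var:
  assumes "j \<le> n"
  shows "base_mult (R_alg n a) (map_coeffs f) (Var j) = map_coeffs (Var j * sh n (a + of_nat j) f)"
proof -
  have star: "star n a f (mono (single j 1)) = Var j * sh n (a + of_nat j) f" for f
    using star_mol[of "[j]" n a f] assms by (simp add: Var_def del: One_nat_def)
  have "base_mult (R_alg n a) (map_coeffs f) (Var j)
      = lsum (\<lambda>x. Cst (Cst x)) (\<lambda>u. map_coeffs (Var j * sh n (a + of_nat j) (mono u))) f"
    by (simp add: base_mult_lsum lsum_Cst_map_coeffs Var_def[of j, where 'a = "'a mpoly"] star del: One_nat_def)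
  also have "\<dots> = map_coeffs (Var j * sh n (a + of_nat j) f)"
    by (rule linear_eq_lsum[of "\<lambda>f. map_coeffs (Var j * sh n (a + of_nat j) f)" "\<lambda>x. Cst (Cst x)", symmetric])
       (simp_all add: sh_add sh_Cst_mult distrib_left map_coeffs_add map_coeffs_Cst_mult mult.left_commute[of "Var j"])
  finally show ?thesis .
qed

lemma base_mult_polys:
  assumes "F \<in> polys {..n}" "G \<in> polys {..n}"
  shows "base_mult (R_alg n a) F G \<in> polys {..n}"
  unfolding base_mult_lsum lsum_def R_alg_mult
proof (intro polys_sum polys_mult polys_Cst map_coeffs_polys)
  fix u v assume "u \<in> keys F" "v \<in> keys G"
  then have u: "keys u \<subseteq> {..n}" and v: "keys v \<subseteq> {..n}" using assms polysD by blast+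
  have "star n a (mono u) (mono v) = mono v * sh n (weight a (word v)) (mono u)"
    using star_mol[of "word v" n a "mono u"] v by (simp add: set_word)
  then show "star n a (mono u) (mono v) \<in> polys {..n}"
    using u v formsD(1)[OF sh_forms[OF forms_mono[OF u refl]]] by (auto intro!: polys_mult polys_mono)
qed

text \<open>The product of \<open>f\<close> with \<open>X_j\<close> in the algebra is
  \<open>X_j (1 + Delta)^(a + j) f\<close>. Untwisting \<open>f\<close> beforehand makes every
  monomial a right multiple of its first letter: the algebra is generated in degree one.\<close>

lemma mono_mol_Cons_eq_base_mult:
  fixes a :: "'k::field_char_0"
  assumes "j \<le> n" "set is \<subseteq> {..n}"
  shows "mono (mol (j # is))
    = base_mult (R_alg n a) (map_coeffs (sh n (- (a + of_nat j)) (mono (mol is)))) (Var j)"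
proof -
  have f: "(mono (mol is) :: 'k mpoly) \<in> forms n (length is)"
    using assms(2) by (intro forms_mono) (auto simp: keys_mol mono_deg_mol)
  then have "sh n (a + of_nat j) (sh n (- (a + of_nat j)) (mono (mol is))) = mono (mol is)"
    by (simp add: sh_sh sh_zero)
  then have "base_mult (R_alg n a) (map_coeffs (sh n (- (a + of_nat j)) (mono (mol is)))) (Var j)
      = map_coeffs (mono (mol (j # is)))"
    by (simp only: base_mult_Var[OF assms(1)] mono_mol_Cons)
  then show ?thesis by (simp del: mol.simps)
qed

text \<open>\<open>V i j E\<close> is the product of \<open>E\<close> with
  \<open>(1 + Delta)^(- a - j) X_i\<close>. For a monomial \<open>f\<close> in place of
  \<open>E\<close>, both sides equal \<open>X_i X_j (1 + Delta)^(2 a + i + j) f\<close>, which is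
  symmetric.\<close>

lemma quadratic_relations:
  fixes a :: "'k::field_char_0"
  assumes i: "i \<le> n" "j \<le> n" and E: "E \<in> forms n d"
  defines "V \<equiv> \<lambda>i j E. \<Sum>k\<le>i. Cst (Cst (- (a + of_nat j) gchoose k)) * base_mult (R_alg n a) E (Var (i - k))"
  shows "base_mult (R_alg n a) (V i j E) (Var j) = base_mult (R_alg n a) (V j i E) (Var i)"
  using E
proof (rule forms_induct_mono)
  have add: "V i j (F + G) = V i j F + V i j G" for F G i j
    by (simp add: V_def base_mult_add_left distrib_left sum.distrib)
  have mult: "V i j (Cst b * F) = Cst b * V i j F" for F b i j
    by (simp add: V_def base_mult_Cst_left sum_distrib_left mult.left_commute)
  have "V i j 0 = 0" for i j by (simp add: V_def)
  then show "base_mult (R_alg n a) (V i j 0) (Var j) = base_mult (R_alg n a) (V j i 0) (Var i)" by simp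
  show "base_mult (R_alg n a) (V i j (F + G)) (Var j) = base_mult (R_alg n a) (V j i (F + G)) (Var i)"
    if "base_mult (R_alg n a) (V i j F) (Var j) = base_mult (R_alg n a) (V j i F) (Var i)"
      "base_mult (R_alg n a) (V i j G) (Var j) = base_mult (R_alg n a) (V j i G) (Var i)" for F G
    using that by (simp add: add base_mult_add_left)
  show "base_mult (R_alg n a) (V i j (Cst b * F)) (Var j) = base_mult (R_alg n a) (V j i (Cst b * F)) (Var i)"
    if "base_mult (R_alg n a) (V i j F) (Var j) = base_mult (R_alg n a) (V j i F) (Var i)" for F b
    using that by (simp add: mult base_mult_Cst_left)
next
  fix "is" assume "is": "set is \<subseteq> {..n}" "length is = d"
  define f where "f = (mono (mol is) :: 'k mpoly)"
  have f: "f \<in> forms n d" unfolding f_def using "is" by (intro forms_mono) (auto simp: keys_mol mono_deg_mol)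
  have V: "V i j (map_coeffs f) = map_coeffs (sh n (- (a + of_nat j)) (Var i * sh n (2 * a + of_nat i + of_nat j) f))"
    if "i \<le> n" "j \<le> n" for i j
  proof -
    have "sh n (- (a + of_nat j) - of_nat k) (sh n (2 * a + of_nat i + of_nat j) f) = sh n (a + of_nat (i - k)) f"
      if "k \<le> i" for k
      using that by (simp add: sh_sh[OF f] of_nat_diff algebra_simps)
    then show ?thesis
      using that by (simp add: V_def base_mult_Var sh_Var_mult map_coeffs_sum map_coeffs_Cst_mult)
  qed
  have "base_mult (R_alg n a) (V i j (map_coeffs f)) (Var j)
      = map_coeffs (Var j * (Var i * sh n (2 * a + of_nat i + of_nat j) f))" if "i \<le> n" "j \<le> n" for i j
  proof -
    have "Var i * sh n (2 * a + of_nat i + of_nat j) f \<in> forms n (1 + d)"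
      using that by (intro forms_mult forms_Var sh_forms f)
    then show ?thesis using that by (simp add: V base_mult_Var sh_sh sh_zero)
  qed
  from this[of i j] this[of j i]
  have "base_mult (R_alg n a) (V i j (map_coeffs f)) (Var j) = base_mult (R_alg n a) (V j i (map_coeffs f)) (Var i)"
    using i by (simp add: mult.left_commute add.commute add.left_commute)
  then show "base_mult (R_alg n a) (V i j (mono (mol is))) (Var j) = base_mult (R_alg n a) (V j i (mono (mol is))) (Var i)"
    by (simp add: f_def)
qed

lemma forms_0_eq: "F \<in> forms n 0 \<Longrightarrow> F = Cst (lookup F 0)"
proof (rule poly_mapping_eqI)
  fix u assume F: "F \<in> forms n 0"
  show "lookup F u = lookup (Cst (lookup F 0)) u"
  proof (cases "u = 0")
    case False
    then have "mono_deg u \<noteq> 0" by (metis length_0_conv length_word mol.simps(1) mol_word)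
    then have "u \<notin> keys F" using formsD(2)[OF F] by auto
    then show ?thesis using False by (simp add: Cst_def lookup_single in_keys_iff)
  qed (simp add: Cst_def)
qed

context
  fixes n and a :: "'k::field_char_0" and K J P
  assumes K: "ideal_set K" and J: "J \<in> point_ideals n (R_alg n a) K"
    and P: "prime_set P" "K \<subseteq> P"
begin

private lemma J_sub: "S_submodule K (polys {..n}) J"
  and J_right: "\<And>f g. f \<in> J \<Longrightarrow> g \<in> polys {..n} \<Longrightarrow> base_mult (R_alg n a) f g \<in> J"
  and J_inv: "\<And>d. invertible_quot K (forms n d) (J \<inter> forms n d)"
  using J by (auto simp: point_ideals_def)

text \<open>The localisation of \<open>J\<close> at \<open>P\<close>, pulled back to polynomials
  over \<open>B\<close>.\<close>

definition JP where "JP = {F. \<exists>s. s \<notin> P \<and> Cst s * F \<in> J}"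

private lemma JP_superset: "F \<in> J \<Longrightarrow> F \<in> JP"
  unfolding JP_def using prime_set_1[OF P(1)] by (intro CollectI exI[of _ 1]) simp

private lemma JP_add: "F \<in> JP \<Longrightarrow> G \<in> JP \<Longrightarrow> F + G \<in> JP"
proof -
  assume "F \<in> JP" "G \<in> JP"
  then obtain s r where s: "s \<notin> P" "Cst s * F \<in> J" and r: "r \<notin> P" "Cst r * G \<in> J"
    by (auto simp: JP_def)
  have "Cst r * (Cst s * F) + Cst s * (Cst r * G) \<in> J"
    by (rule S_submodule_add[OF J_sub S_submodule_Cst[OF J_sub s(2)] S_submodule_Cst[OF J_sub r(2)]])
  then have "Cst (r * s) * (F + G) \<in> J" by (simp add: Cst_mult algebra_simps)
  then show ?thesis unfolding JP_def using prime_set_mult[OF P(1) r(1) s(1)] by blast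
qed

private lemma JP_Cst: "F \<in> JP \<Longrightarrow> Cst b * F \<in> JP"
proof -
  assume "F \<in> JP"
  then obtain s where s: "s \<notin> P" "Cst s * F \<in> J" by (auto simp: JP_def)
  have "Cst s * (Cst b * F) \<in> J"
    using S_submodule_Cst[OF J_sub s(2), of b] by (simp only: mult.left_commute)
  then show ?thesis unfolding JP_def using s(1) by blast
qed

private lemma JP_diff: "F \<in> JP \<Longrightarrow> G \<in> JP \<Longrightarrow> F - G \<in> JP"
  using JP_add[of F "Cst (-1) * G"] JP_Cst[of G "-1"] by (simp add: Cst_uminus)

private lemma JP_0: "0 \<in> JP"
  by (rule JP_superset) (rule S_submodule_0[OF J_sub])

private lemma JP_sum: "(\<And>x. x \<in> A \<Longrightarrow> f x \<in> JP) \<Longrightarrow> sum f A \<in> JP"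
  by (induction A rule: infinite_finite_induct) (auto intro: JP_0 JP_add)

private lemma JP_cancel: "s \<notin> P \<Longrightarrow> Cst s * F \<in> JP \<Longrightarrow> F \<in> JP"
proof -
  assume s: "s \<notin> P" "Cst s * F \<in> JP"
  then obtain r where r: "r \<notin> P" "Cst r * (Cst s * F) \<in> J" by (auto simp: JP_def)
  then have "Cst (r * s) * F \<in> J" by (simp add: Cst_mult mult.assoc)
  then show ?thesis unfolding JP_def using prime_set_mult[OF P(1) r(1) s(1)] by blast
qed

private lemma JP_loc: "b \<in> loc K P \<Longrightarrow> F \<in> polys {..n} \<Longrightarrow> Cst b * F \<in> JP"
proof -
  assume b: "b \<in> loc K P" "F \<in> polys {..n}"
  then obtain r where r: "r \<notin> P" "r * b \<in> K" by (auto simp: loc_def)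
  have "Cst (r * b) * F \<in> J" by (rule S_submodule_ideal[OF J_sub r(2) b(2)])
  then show ?thesis unfolding JP_def using r(1) by (auto simp: Cst_mult mult.assoc)
qed

private lemma JP_right: "F \<in> JP \<Longrightarrow> i \<le> n \<Longrightarrow> base_mult (R_alg n a) F (Var i) \<in> JP"
proof -
  assume F: "F \<in> JP" and i: "i \<le> n"
  then obtain s where s: "s \<notin> P" "Cst s * F \<in> J" by (auto simp: JP_def)
  have "Cst s * base_mult (R_alg n a) F (Var i) \<in> J"
    using J_right[OF s(2) polys_Var[of i "{..n}"]] i by (simp only: base_mult_Cst_left atMost_iff)
  then show ?thesis unfolding JP_def using s(1) by blast
qed

private definition gen where
  "gen d e \<longleftrightarrow> e \<in> forms n d \<and> (\<forall>v\<in>forms n d. \<exists>s b. s \<notin> P \<and> Cst s * v - Cst b * e \<in> J) \<and>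
     (\<forall>b. Cst b * e \<in> JP \<longrightarrow> b \<in> loc K P)"

private lemma ex_gen: "\<exists>e. gen d e"
proof -
  obtain t e where t: "t \<notin> P" "e \<in> forms n d"
    and g: "\<And>v. v \<in> forms n d \<Longrightarrow> \<exists>j b. Cst (t ^ j) * v - Cst b * e \<in> J \<inter> forms n d"
    and ann: "\<And>b. Cst b * e \<in> J \<inter> forms n d \<Longrightarrow> \<exists>j. t ^ j * b \<in> K"
    by (rule invertible_quot_local[OF J_inv P]) blast
  have "\<exists>s b. s \<notin> P \<and> Cst s * v - Cst b * e \<in> J" if v: "v \<in> forms n d" for v
  proof -
    obtain j b where "Cst (t ^ j) * v - Cst b * e \<in> J \<inter> forms n d" using g[OF v] by blast
    then show ?thesis using prime_set_power[OF P(1) t(1), of j] by blast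
  qed
  moreover have "b \<in> loc K P" if b: "Cst b * e \<in> JP" for b
  proof -
    obtain s where s: "s \<notin> P" "Cst s * (Cst b * e) \<in> J" using b by (auto simp: JP_def)
    then have "Cst (s * b) * e \<in> J \<inter> forms n d"
      using forms_Cst_mult[OF t(2), of "s * b"] by (simp add: Cst_mult mult.assoc)
    then obtain j where "t ^ j * (s * b) \<in> K" using ann by blast
    then have "(t ^ j * s) * b \<in> K" by (simp add: mult.assoc)
    moreover have "t ^ j * s \<notin> P" by (intro prime_set_mult[OF P(1)] prime_set_power[OF P(1)] t(1) s(1))
    ultimately show ?thesis by (auto simp: loc_def)
  qed
  ultimately show ?thesis using t(2) by (auto simp: gen_def)
qed

text \<open>Any generator in degree 0 is a constant multiple of 1. Choosing 1 lets the chain start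
  at the cyclic generator, so that its first point is read off the degree one part of
  \<open>J\<close>.\<close>

private lemma gen_0: "gen 0 1"
proof -
  obtain e where e: "gen 0 e" using ex_gen by blast
  define \<beta> where "\<beta> = lookup e 0"
  have e0: "e = Cst \<beta>" using e forms_0_eq by (auto simp: gen_def \<beta>_def)
  have "b \<in> loc K P" if "Cst b * 1 \<in> JP" for b
  proof -
    have "Cst b * e \<in> JP" using JP_Cst[OF that, of \<beta>] by (simp add: e0 mult.commute)
    then show ?thesis using e by (auto simp: gen_def)
  qed
  moreover have "\<exists>s b. s \<notin> P \<and> Cst s * v - Cst b * 1 \<in> J" if "v \<in> forms n 0" for v
    using forms_0_eq[OF that] prime_set_1[OF P(1)] S_submodule_0[OF J_sub]
    by (intro exI[of _ 1] exI[of _ "lookup v 0"]) simp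
  ultimately show ?thesis by (simp add: gen_def)
qed

text \<open>With a local generator \<open>e d\<close> in each degree, the variables act by
  coefficients \<open>c d i\<close>. The quadratic relations make these a chain, and its functional
  is the coordinate with respect to \<open>e d\<close> up to a unit.\<close>

lemma point_ideal_chain:
  obtains c s e where "chain n a (loc K P) c" "s \<notin> P" "e \<in> forms n 1"
    "\<And>i. i \<le> n \<Longrightarrow> Cst s * Var i - Cst (c 0 i) * e \<in> J"
    "\<And>d F. F \<in> forms n d \<Longrightarrow> Lval a c d F \<in> loc K P \<longleftrightarrow> (\<exists>s. s \<notin> P \<and> Cst s * F \<in> J)"
    "\<And>d. \<exists>F\<in>forms n d. Lval a c d F \<notin> P"
proof -
  define e where "e d = (if d = 0 then 1 else SOME e. gen d e)" for d
  have gen: "gen d (e d)" for d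
    using gen_0 someI_ex[OF ex_gen[of d]] by (auto simp: e_def)
  have e0: "e 0 = 1" by (simp add: e_def)
  have ef: "e d \<in> forms n d" for d using gen by (simp add: gen_def)
  have g: "\<exists>s b. s \<notin> P \<and> Cst s * v - Cst b * e d \<in> J" if "v \<in> forms n d" for v d
    using gen that by (simp add: gen_def)
  have ann: "b \<in> loc K P" if "Cst b * e d \<in> JP" for b d
    using gen[of d] that by (simp add: gen_def)
  let ?m = "base_mult (R_alg n a)"
  have mf: "?m F (Var i) \<in> forms n (Suc d)" if "F \<in> forms n d" "i \<le> n" for F i d
    using that(1)
  proof (rule forms_induct_mono)
    fix "is" assume "is": "set is \<subseteq> {..n}" "length is = d"
    have "Var i * sh n (a + of_nat i) (mono (mol is)) \<in> forms n (1 + d)"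
      using "is" sh_mol_forms[OF "is"(1)] that(2) by (intro forms_mult forms_Var) auto
    then show "?m (mono (mol is)) (Var i) \<in> forms n (Suc d)"
      using map_coeffs_forms base_mult_Var[OF that(2), of a "mono (mol is)"] by fastforce
  qed (auto simp: base_mult_add_left base_mult_Cst_left intro: forms_add forms_Cst_mult)
  have "\<exists>S c. S \<notin> P \<and> (\<forall>i\<le>n. Cst S * ?m (e d) (Var i) - Cst (c i) * e (Suc d) \<in> J)" for d
  proof -
    have "\<forall>i\<in>{..n}. \<exists>s b. s \<notin> P \<and> Cst s * ?m (e d) (Var i) - Cst b * e (Suc d) \<in> J"
      using g mf ef by auto
    then obtain s b where sb: "\<And>i. i \<le> n \<Longrightarrow> s i \<notin> P"
      "\<And>i. i \<le> n \<Longrightarrow> Cst (s i) * ?m (e d) (Var i) - Cst (b i) * e (Suc d) \<in> J" by (metis atMost_iff)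
    define S where "S = (\<Prod>i\<le>n. s i)"
    define S' where "S' i = (\<Prod>l\<in>{..n} - {i}. s l)" for i
    have S': "S = S' i * s i" if "i \<le> n" for i
      unfolding S_def S'_def using that by (subst prod.remove[of _ i]) auto
    have "Cst (S' i) * (Cst (s i) * ?m (e d) (Var i) - Cst (b i) * e (Suc d)) \<in> J" if "i \<le> n" for i
      using sb that by (intro S_submodule_Cst[OF J_sub])
    then have "Cst S * ?m (e d) (Var i) - Cst (S' i * b i) * e (Suc d) \<in> J" if "i \<le> n" for i
      using that by (simp add: S' Cst_mult right_diff_distrib mult.assoc)
    moreover have "S \<notin> P" unfolding S_def using sb by (intro prime_set_prod[OF P(1)]) auto
    ultimately show ?thesis
      by (intro exI[of _ S] exI[of _ "\<lambda>i. S' i * b i"]) simp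
  qed
  then have "\<forall>d. \<exists>S c. S \<notin> P \<and> (\<forall>i\<le>n. Cst S * ?m (e d) (Var i) - Cst (c i) * e (Suc d) \<in> J)" ..
  from choice[OF this] obtain S where "\<forall>d. \<exists>c. S d \<notin> P
    \<and> (\<forall>i\<le>n. Cst (S d) * ?m (e d) (Var i) - Cst (c i) * e (Suc d) \<in> J)" ..
  from choice[OF this] obtain c where Sc: "\<forall>d. S d \<notin> P
    \<and> (\<forall>i\<le>n. Cst (S d) * ?m (e d) (Var i) - Cst (c d i) * e (Suc d) \<in> J)" ..
  have S: "S d \<notin> P" for d using Sc by simp
  have cJ: "Cst (S d) * ?m (e d) (Var i) - Cst (c d i) * e (Suc d) \<in> J" if "i \<le> n" for d i
    using Sc that by simp
  note c = JP_superset[OF cJ]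
  note A = ideal_set_loc[OF K P(1)]
  have ep: "e d \<in> polys {..n}" for d using formsD(1)[OF ef] .
  have link: "link n a (loc K P) (c d) (c (Suc d))" for d
    unfolding link_def
  proof (intro allI impI)
    fix i j assume ij: "i \<le> n" "j \<le> n"
    define V where "V i j = (\<Sum>k\<le>i. Cst (Cst (- (a + of_nat j) gchoose k)) * ?m (e d) (Var (i - k)))" for i j
    define M where "M i j = tw (- (a + of_nat j)) (c d) i" for i j
    have V: "Cst (S d) * V i j - Cst (M i j) * e (Suc d) \<in> JP" if "i \<le> n" for i j
    proof -
      have "(\<Sum>k\<le>i. Cst (Cst (- (a + of_nat j) gchoose k)) *
          (Cst (S d) * ?m (e d) (Var (i - k)) - Cst (c d (i - k)) * e (Suc d))) \<in> JP"
        using that by (intro JP_sum JP_Cst c) auto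
      then show ?thesis
        by (simp add: V_def M_def tw_def Cst_sum Cst_mult sum_distrib_left sum_distrib_right
            right_diff_distrib sum_subtractf mult_ac)
    qed
    \<comment> \<open>Apply the letter \<open>j\<close> to the expansion of \<open>V i j\<close> and
      expand the result in degree \<open>d + 2\<close>. Comparison with \<open>i\<close> and
      \<open>j\<close> exchanged gives the link.\<close>
    have VV: "Cst (S (Suc d) * S d) * ?m (V i j) (Var j) - Cst (c (Suc d) j * M i j) * e (Suc (Suc d)) \<in> JP"
      if "i \<le> n" "j \<le> n" for i j
    proof -
      have x: "Cst (S (Suc d)) * ?m (Cst (S d) * V i j - Cst (M i j) * e (Suc d)) (Var j) \<in> JP"
        using that by (intro JP_Cst JP_right V)
      have y: "Cst (M i j) * (Cst (S (Suc d)) * ?m (e (Suc d)) (Var j) - Cst (c (Suc d) j) * e (Suc (Suc d))) \<in> JP"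
        using that by (intro JP_Cst c)
      from JP_add[OF x[unfolded base_mult_diff_left base_mult_Cst_left] y]
      show ?thesis by (simp add: Cst_mult algebra_simps)
    qed
    have "?m (V i j) (Var j) = ?m (V j i) (Var i)"
      using quadratic_relations[OF ij ef] unfolding V_def .
    then have "Cst (c (Suc d) j * M i j - c (Suc d) i * M j i) * e (Suc (Suc d)) \<in> JP"
      using JP_diff[OF VV[of j i] VV[of i j]] ij by (simp add: Cst_diff left_diff_distrib mult.commute[of "S d"])
    then show "c (Suc d) j * tw (- (a + of_nat j)) (c d) i - c (Suc d) i * tw (- (a + of_nat i)) (c d) j \<in> loc K P"
      unfolding M_def by (rule ann)
  qed
  \<comment> \<open>Degree \<open>d + 1\<close> is generated by degree \<open>d\<close>, so the
    coordinate of a monomial is a multiple of some \<open>c d j\<close> up to a unit; this makes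
    \<open>c d\<close> faithful.\<close>
  have step: "\<exists>r \<beta>. r \<notin> P \<and> Cst r * mono (mol (j # is)) - Cst (\<beta> * c d j) * e (Suc d) \<in> JP"
    if "j \<le> n" "set is \<subseteq> {..n}" "length is = d" for j "is" d
  proof -
    let ?g = "map_coeffs (sh n (- (a + of_nat j)) (mono (mol is)))"
    have "?g \<in> forms n d" using map_coeffs_forms[OF sh_mol_forms[OF that(2)]] that(3) by simp
    then obtain r \<beta> where r: "r \<notin> P" "Cst r * ?g - Cst \<beta> * e d \<in> J" using g by blast
    have x: "Cst (S d) * ?m (Cst r * ?g - Cst \<beta> * e d) (Var j) \<in> JP"
      using that(1) by (intro JP_Cst JP_right JP_superset r)
    have y: "Cst \<beta> * (Cst (S d) * ?m (e d) (Var j) - Cst (c d j) * e (Suc d)) \<in> JP"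
      using that(1) by (intro JP_Cst c)
    from JP_add[OF x[unfolded base_mult_diff_left base_mult_Cst_left] y]
    have "Cst (S d * r) * ?m ?g (Var j) - Cst (\<beta> * c d j) * e (Suc d) \<in> JP"
      by (simp add: Cst_mult algebra_simps)
    then show ?thesis
      unfolding mono_mol_Cons_eq_base_mult[OF that(1,2), of a] using prime_set_mult[OF P(1) S r(1)] by blast
  qed
  have faithful: "faithful n (loc K P) (c d)" for d
    unfolding faithful_def
  proof (intro allI impI)
    fix b assume b: "\<forall>i\<le>n. b * c d i \<in> loc K P"
    have "Cst b * F \<in> JP" if "F \<in> forms n (Suc d)" for F
      using that
    proof (rule forms_induct_mono)
      fix "is" assume "is": "set is \<subseteq> {..n}" "length is = Suc d"
      then obtain j js where js: "is = j # js" "j \<le> n" "set js \<subseteq> {..n}" "length js = d"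
        by (cases "is") auto
      then obtain r \<beta> where r: "r \<notin> P" "Cst r * mono (mol is) - Cst (\<beta> * c d j) * e (Suc d) \<in> JP"
        using step by blast
      have "\<beta> * (b * c d j) \<in> loc K P" using b js(2) ideal_set_mult[OF A, of "b * c d j" \<beta>] by simp
      then have "Cst (\<beta> * (b * c d j)) * e (Suc d) \<in> JP" by (rule JP_loc) (rule ep)
      from JP_add[OF JP_Cst[OF r(2), of b] this] have "Cst r * (Cst b * mono (mol is)) \<in> JP"
        by (simp add: Cst_mult algebra_simps)
      then show "Cst b * mono (mol is) \<in> JP" by (rule JP_cancel[OF r(1)])
    qed (auto simp: JP_0 distrib_left mult.left_commute[of "Cst b"] intro: JP_add JP_Cst)
    from ann[OF this[OF ef]] show "b \<in> loc K P" .
  qed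
  have chain: "chain n a (loc K P) c" using A link faithful by (simp add: chain_def)
  define SS where "SS d = (\<Prod>l<d. S l)" for d
  have SS: "SS d \<notin> P" for d unfolding SS_def by (intro prime_set_prod[OF P(1)] S)
  \<comment> \<open>The first letter is split off as a right factor, which twists the rest of the
    word by \<open>- (a + j)\<close>, in agreement with the recursion of
    \<open>wval\<close>.\<close>
  have L: "Cst (SS d) * F - Cst (Lval a c d F) * e d \<in> JP" if "F \<in> forms n d" for d F
    using that
  proof (induction d arbitrary: F)
    case 0
    then have "F = Cst (lookup F 0)" by (rule forms_0_eq)
    then have "F = Cst (lookup F 0) * mono 0" by simp
    moreover have "mval a c 0 0 = 1"
      using length_word[of 0] by (simp add: mval_def)
    ultimately have "Lval a c 0 F = lookup F 0"
      by (metis Lval_Cst_mult Lval_mono mono_deg_0 mult_1_right)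
    then show ?case using \<open>F = Cst (lookup F 0)\<close> by (simp add: SS_def e0 JP_0)
  next
    case (Suc d)
    from Suc.prems show ?case
    proof (rule forms_induct_mono)
      fix "is" assume "is": "set is \<subseteq> {..n}" "length is = Suc d"
      then obtain j js where js: "is = j # js" "j \<le> n" "set js \<subseteq> {..n}" "length js = d"
        by (cases "is") auto
      let ?f = "sh n (- (a + of_nat j)) (mono (mol js))"
      let ?g = "map_coeffs ?f"
      have f: "?f \<in> forms n d" using sh_mol_forms[OF js(3)] js(4) by simp
      have x: "Cst (S d) * ?m (Cst (SS d) * ?g - Cst (Lval a c d ?g) * e d) (Var j) \<in> JP"
        using js(2) by (intro JP_Cst JP_right Suc.IH map_coeffs_forms f)
      have y: "Cst (Lval a c d ?g) * (Cst (S d) * ?m (e d) (Var j) - Cst (c d j) * e (Suc d)) \<in> JP"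
        using js(2) by (intro JP_Cst c)
      from JP_add[OF x[unfolded base_mult_diff_left base_mult_Cst_left] y]
      have 1: "Cst (SS (Suc d)) * ?m ?g (Var j) - Cst (c d j * Lval a c d ?g) * e (Suc d) \<in> JP"
        by (simp add: Cst_mult algebra_simps SS_def)
      have m: "mono (mol js) \<in> forms n d"
        using js by (intro forms_mono) (auto simp: keys_mol mono_deg_mol)
      have "Lval a c d ?g = twLval a c 0 ?f" using Lval_map_coeffs[OF chain f, of d] by simp
      then have "Lval a c d ?g - mval a c (- (a + of_nat j)) (mol js) \<in> loc K P"
        using twLval_sh[OF chain m, of 0 "- (a + of_nat j)"] by (simp add: twLval_def[OF chain])
      then have "Lval a c d ?g - wval a c (- (a + of_nat j)) js \<in> loc K P"
        by (rule ideal_set_cong_trans[OF A]) (rule mval_mol[OF chain js(3)])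
      then have "c d j * (Lval a c d ?g - wval a c (- (a + of_nat j)) js) \<in> loc K P"
        by (rule ideal_set_mult[OF A])
      then have 2: "c d j * Lval a c d ?g - wval a c 0 is \<in> loc K P"
        by (simp add: js right_diff_distrib)
      have "Lval a c (Suc d) (mono (mol is)) - wval a c 0 is \<in> loc K P"
        using mval_mol[OF chain "is"(1), of 0] "is"(2) by (simp add: Lval_mono mono_deg_mol)
      then have "c d j * Lval a c d ?g - Lval a c (Suc d) (mono (mol is)) \<in> loc K P"
        by (rule ideal_set_cong_trans[OF A 2 ideal_set_cong_sym[OF A]])
      then have "Cst (c d j * Lval a c d ?g - Lval a c (Suc d) (mono (mol is))) * e (Suc d) \<in> JP"
        by (rule JP_loc) (rule ep)
      from JP_add[OF 1 this]
      show "Cst (SS (Suc d)) * mono (mol is) - Cst (Lval a c (Suc d) (mono (mol is))) * e (Suc d) \<in> JP"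
        unfolding js(1) mono_mol_Cons_eq_base_mult[OF js(2,3), of a, symmetric]
        by (simp add: Cst_diff left_diff_distrib)
    next
      fix f g assume "Cst (SS (Suc d)) * f - Cst (Lval a c (Suc d) f) * e (Suc d) \<in> JP"
        "Cst (SS (Suc d)) * g - Cst (Lval a c (Suc d) g) * e (Suc d) \<in> JP"
      from JP_add[OF this]
      show "Cst (SS (Suc d)) * (f + g) - Cst (Lval a c (Suc d) (f + g)) * e (Suc d) \<in> JP"
        by (simp add: Lval_add Cst_add algebra_simps)
    next
      fix b f assume "Cst (SS (Suc d)) * f - Cst (Lval a c (Suc d) f) * e (Suc d) \<in> JP"
      from JP_Cst[OF this, of b]
      show "Cst (SS (Suc d)) * (Cst b * f) - Cst (Lval a c (Suc d) (Cst b * f)) * e (Suc d) \<in> JP"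
        by (simp add: Lval_Cst_mult Cst_mult right_diff_distrib mult.assoc mult.left_commute[of "Cst (SS (Suc d))"])
    qed (simp add: JP_0)
  qed
  have iff: "Lval a c d F \<in> loc K P \<longleftrightarrow> (\<exists>s. s \<notin> P \<and> Cst s * F \<in> J)" if F: "F \<in> forms n d" for d F
  proof
    assume "Lval a c d F \<in> loc K P"
    from JP_add[OF L[OF F] JP_loc[OF this ep[of d]]] have "Cst (SS d) * F \<in> JP" by simp
    then have "F \<in> JP" by (rule JP_cancel[OF SS])
    then show "\<exists>s. s \<notin> P \<and> Cst s * F \<in> J" by (simp add: JP_def)
  next
    assume "\<exists>s. s \<notin> P \<and> Cst s * F \<in> J"
    then have "F \<in> JP" by (simp add: JP_def)
    from JP_diff[OF JP_Cst[OF this, of "SS d"] L[OF F]] have "Cst (Lval a c d F) * e d \<in> JP" by simp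
    then show "Lval a c d F \<in> loc K P" by (rule ann)
  qed
  have notin: "\<exists>F\<in>forms n d. Lval a c d F \<notin> P" for d
  proof (rule bexI[of _ "e d"])
    have "Cst (SS d - Lval a c d (e d)) * e d \<in> JP"
      using L[OF ef] by (simp add: Cst_diff left_diff_distrib)
    then have "SS d - Lval a c d (e d) \<in> P" using ann loc_subset[OF K P] by blast
    then show "Lval a c d (e d) \<notin> P"
      using SS ideal_set_cong_mem[OF prime_set_ideal[OF P(1)]] by blast
  qed (rule ef)
  have V: "?m 1 (Var i) = Var i" if "i \<le> n" for i
    using base_mult_Var[OF that, of a 1] map_coeffs_mono[of 0, where 'a = 'k] by simp
  show thesis
  proof (rule that[OF chain S[of 0] ef[of 1] _ iff notin])
    fix i assume "i \<le> n"
    then show "Cst (S 0) * Var i - Cst (c 0 i) * e 1 \<in> J"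
      using cJ[of i 0] V[of i] by (simp add: e0)
  qed
qed

end

section \<open>The point scheme\<close>

text \<open>At each prime the chains of \<open>J\<close> and \<open>J'\<close> start at proportional
  points, so both follow the same explicit sequence \<open>pts\<close>, and their functionals have
  the same kernel.\<close>

lemma point_ideal_subset:
  fixes a :: "'k::field_char_0"
  assumes K: "ideal_set K" and J: "J \<in> point_ideals n (R_alg n a) K"
    and J': "J' \<in> point_ideals n (R_alg n a) K" and eq: "J \<inter> forms n 1 = J' \<inter> forms n 1"
  shows "J \<subseteq> J'"
proof
  have sub: "S_submodule K (polys {..n}) J" and sub': "S_submodule K (polys {..n}) J'"
    and hom: "\<And>f d. f \<in> J \<Longrightarrow> hom_part d f \<in> J"
    using J J' by (auto simp: point_ideals_def)
  have form: "f \<in> J'" if f: "f \<in> J" "f \<in> forms n d" for f d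
  proof -
    have A: "ideal_set {r. Cst r * f \<in> J'}"
      by (rule ideal_setI)
         (auto simp: S_submodule_0[OF sub'] Cst_add distrib_right S_submodule_add[OF sub'] Cst_mult
           mult.assoc S_submodule_Cst[OF sub'])
    have "1 \<in> {r. Cst r * f \<in> J'}"
    proof (rule local_global[OF A])
      fix P assume P: "prime_set P" "{r. Cst r * f \<in> J'} \<subseteq> P"
      have KP: "K \<subseteq> P" using formsD(1)[OF f(2)] S_submodule_ideal[OF sub'] P(2) by blast
      note AP = ideal_set_loc[OF K P(1)]
      obtain c s e where c: "chain n a (loc K P) c" "s \<notin> P" "e \<in> forms n 1"
        "\<And>i. i \<le> n \<Longrightarrow> Cst s * Var i - Cst (c 0 i) * e \<in> J"
        "\<And>d F. F \<in> forms n d \<Longrightarrow> Lval a c d F \<in> loc K P \<longleftrightarrow> (\<exists>s. s \<notin> P \<and> Cst s * F \<in> J)"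
        "\<And>d. \<exists>F\<in>forms n d. Lval a c d F \<notin> P"
        by (rule point_ideal_chain[OF K J P(1) KP]) blast
      obtain c' s' e' where c': "chain n a (loc K P) c'" "s' \<notin> P" "e' \<in> forms n 1"
        "\<And>i. i \<le> n \<Longrightarrow> Cst s' * Var i - Cst (c' 0 i) * e' \<in> J'"
        "\<And>d F. F \<in> forms n d \<Longrightarrow> Lval a c' d F \<in> loc K P \<longleftrightarrow> (\<exists>s. s \<notin> P \<and> Cst s * F \<in> J')"
        "\<And>d. \<exists>F\<in>forms n d. Lval a c' d F \<notin> P"
        by (rule point_ideal_chain[OF K J' P(1) KP]) blast
      define p where "p = c 0"
      have p: "\<exists>i\<le>n. p i \<notin> P"
        using c(6)[of 1] Lval1_mem[OF prime_set_ideal[OF P(1)], of _ n c a] by (auto simp: p_def)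
      define ms where "ms = lead_at n a P p"
      have ms: "ms l \<le> n" for l unfolding ms_def by (rule lead_at(1)[OF P(1) p])
      define L where "L = Lval a (pts n a ms p) d"
      have "\<exists>e. \<forall>i\<le>n. denoms n a ms p 1 l * c l i - e * pts n a ms p l i \<in> loc K P" for l
        by (rule pts_scale[OF c(1) ms, of 1 1]) (simp add: p_def ideal_set_0[OF AP])
      then obtain E where E: "\<And>l i. i \<le> n \<Longrightarrow> denoms n a ms p 1 l * c l i - E l * pts n a ms p l i \<in> loc K P"
        by metis
      have "s * c' 0 i - Lval a c' 1 e * p i \<in> loc K P" if "i \<le> n" for i
      proof -
        have F: "Cst s * Var i - Cst (c 0 i) * e \<in> forms n 1"
          by (intro forms_diff forms_Cst_mult forms_Var c(3) that)
        then have "Cst 1 * (Cst s * Var i - Cst (c 0 i) * e) \<in> J'" using c(4)[OF that] eq by auto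
        then have "Lval a c' 1 (Cst s * Var i - Cst (c 0 i) * e) \<in> loc K P"
          using c'(5)[OF F] prime_set_1[OF P(1)] by blast
        then show ?thesis
          by (simp add: Lval_diff Lval_Cst_mult p_def mult.commute[of "Lval a c' 1 e"] del: One_nat_def)
      qed
      then have "\<exists>e. \<forall>i\<le>n. denoms n a ms p s l * c' l i - e * pts n a ms p l i \<in> loc K P" for l
        by (rule pts_scale[OF c'(1) ms])
      then obtain E' where E': "\<And>l i. i \<le> n \<Longrightarrow> denoms n a ms p s l * c' l i - E' l * pts n a ms p l i \<in> loc K P"
        by metis
      define H H' X X' where "H = (\<Prod>l<d. denoms n a ms p 1 l)" and "H' = (\<Prod>l<d. denoms n a ms p s l)"
        and "X = (\<Prod>l<d. E l)" and "X' = (\<Prod>l<d. E' l)"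
      have HP: "H \<notin> P" "H' \<notin> P"
        unfolding H_def H'_def ms_def
        by (intro prime_set_prod[OF P(1)] denoms_lead_at[OF P(1) p] prime_set_1[OF P(1)] c(2))+
      have 1: "H * Lval a c d F - X * L F \<in> loc K P" if "F \<in> forms n d" for F
        unfolding H_def X_def L_def by (rule Lval_scale[OF AP E that])
      have 2: "H' * Lval a c' d F - X' * L F \<in> loc K P" if "F \<in> forms n d" for F
        unfolding H'_def X'_def L_def by (rule Lval_scale[OF AP E' that])
      obtain F where F: "F \<in> forms n d" "Lval a c d F \<notin> P" using c(6) by blast
      have "H * Lval a c d F - X * L F \<in> P" using 1[OF F(1)] loc_subset[OF K P(1) KP] by blast
      \<comment> \<open>The functional of \<open>c\<close> takes a value outside \<open>P\<close>,
        so the factor \<open>X\<close> can be cancelled and \<open>f \<in> J\<close> forces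
        \<open>L f\<close> to vanish locally.\<close>
      then have "X * L F \<notin> P"
        using prime_set_mult[OF P(1) HP(1) F(2)] ideal_set_cong_mem[OF prime_set_ideal[OF P(1)]] by blast
      then have X: "X \<notin> P" by (rule prime_set_multD[OF P(1)])
      have "Cst 1 * f \<in> J" using f(1) by simp
      then have "Lval a c d f \<in> loc K P" using c(5)[OF f(2)] prime_set_1[OF P(1)] by blast
      then have "X * L f \<in> loc K P"
        by (intro ideal_set_cong_mem[OF AP ideal_set_cong_sym[OF AP 1[OF f(2)]]] ideal_set_mult[OF AP])
      then have "L f \<in> loc K P" by (rule loc_cancel[OF K P(1) X])
      then have "H' * Lval a c' d f \<in> loc K P"
        by (intro ideal_set_cong_mem[OF AP 2[OF f(2)]] ideal_set_mult[OF AP])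
      then have "Lval a c' d f \<in> loc K P" by (rule loc_cancel[OF K P(1) HP(2)])
      then show "\<exists>r\<in>{r. Cst r * f \<in> J'}. r \<notin> P" using c'(5)[OF f(2)] by blast
    qed
    then show ?thesis by simp
  qed
  fix f assume f: "f \<in> J"
  then have fp: "f \<in> polys {..n}" using S_submodule_subset[OF sub] by blast
  obtain D where D: "\<forall>u\<in>keys f. mono_deg u < D" using mono_deg_bound by blast
  have "(\<Sum>d<m. hom_part d f) \<in> J'" for m
    by (induction m) (auto intro: S_submodule_0[OF sub'] S_submodule_add[OF sub'] form hom f hom_part_forms fp)
  moreover have e: "f = (\<Sum>d<D. hom_part d f)" using D by (intro hom_part_expand) auto
  ultimately show "f \<in> J'" by (subst e) blast
qed

text \<open>Locally \<open>J\<close> has a chain, and the forms of \<open>chain_ideal\<close> vanish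
  at its first point \<open>c 0\<close>; by \<open>form_subst_cong\<close> they then vanish modulo
  the ideal generated by \<open>K\<close> and the degree one part of \<open>J\<close>.\<close>

lemma point_ideal_degree_1:
  fixes a :: "'k::field_char_0"
  assumes K: "ideal_set K" and J: "J \<in> point_ideals n (R_alg n a) K"
  shows "J \<inter> forms n 1 \<in> proj_points n (chain_ideal n a) K"
  unfolding proj_points_def
proof (intro CollectI conjI)
  have sub: "S_submodule K (polys {..n}) J" using J by (auto simp: point_ideals_def)
  show "S_submodule K (forms n 1) (J \<inter> forms n 1)"
    unfolding S_submodule_def
  proof (intro conjI ballI allI)
    show "Cst b * v \<in> J \<inter> forms n 1" if "b \<in> K" "v \<in> forms n 1" for b v
      using S_submodule_ideal[OF sub that(1) formsD(1)[OF that(2)]] forms_Cst_mult[OF that(2)] by blast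
    show "Cst b * v \<in> J \<inter> forms n 1" if "v \<in> J \<inter> forms n 1" for b v
      using that S_submodule_Cst[OF sub] forms_Cst_mult by blast
    show "v + w \<in> J \<inter> forms n 1" if "v \<in> J \<inter> forms n 1" "w \<in> J \<inter> forms n 1" for v w
      using that S_submodule_add[OF sub] forms_add by blast
  qed (use S_submodule_0[OF sub] in auto)
  show "invertible_quot K (forms n 1) (J \<inter> forms n 1)"
    using J by (simp add: point_ideals_def del: One_nat_def)
  show "map_coeffs ` chain_ideal n a \<subseteq> Idl\<^bsub>mpoly_ring {..n}\<^esub> ((J \<inter> forms n 1) \<union> Cst ` K)"
  proof (intro image_subsetI Idl_memI)
    fix f and I assume f: "f \<in> chain_ideal n a"
      and I: "ideal I (mpoly_ring {..n})" "(J \<inter> forms n 1) \<union> Cst ` K \<subseteq> I"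
    note I_add = ideal_mpoly_add[OF I(1)] and I_mult = ideal_mpoly_mult[OF I(1)]
    have fp: "f \<in> polys {..n}" using f by (simp add: chain_ideal_def)
    have A: "ideal_set {r. Cst r * F \<in> I}" for F
      by (rule ideal_setI)
         (auto simp: ideal_mpoly_0[OF I(1)] Cst_add distrib_right I_add Cst_mult mult.assoc I_mult)
    have form: "map_coeffs (hom_part d f) \<in> I" for d
    proof -
      define g where "g = hom_part d f"
      have g: "g \<in> forms n d" unfolding g_def by (rule hom_part_forms[OF fp])
      have "1 \<in> {r. Cst r * map_coeffs g \<in> I}"
      proof (rule local_global[OF A])
        fix P assume P: "prime_set P" "{r. Cst r * map_coeffs g \<in> I} \<subseteq> P"
        have KP: "K \<subseteq> P"
        proof
          fix b assume "b \<in> K"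
          then have "map_coeffs g * Cst b \<in> I"
            using I(2) formsD(1)[OF map_coeffs_forms[OF g]] by (intro I_mult) auto
          then show "b \<in> P" using P(2) by (auto simp: mult.commute)
        qed
        obtain c s e where c: "chain n a (loc K P) c" "s \<notin> P" "e \<in> forms n 1"
          "\<And>i. i \<le> n \<Longrightarrow> Cst s * Var i - Cst (c 0 i) * e \<in> J"
          by (rule point_ideal_chain[OF K J P(1) KP]) blast
        have cI: "Cst s * Var i - Cst (c 0 i) * e \<in> I" if "i \<le> n" for i
        proof -
          have "Cst s * Var i - Cst (c 0 i) * e \<in> forms n 1"
            by (intro forms_diff forms_Cst_mult forms_Var c(3) that)
          then show ?thesis using c(4)[OF that] I(2) by blast
        qed
        have ep: "e ^ m \<in> polys {..n}" for m using formsD(1)[OF c(3)] by (rule polys_power)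
        have "Cst (s ^ d) * map_coeffs g - Cst (poly_subst (c 0) g) * e ^ d \<in> I"
          by (rule form_subst_cong[OF I(1) formsD(1)[OF c(3)] cI g])
        moreover obtain r where r: "r \<notin> P" "r * poly_subst (c 0) g \<in> K"
          using f c(1) unfolding chain_ideal_def g_def loc_def by blast
        ultimately have "Cst r * (Cst (s ^ d) * map_coeffs g - Cst (poly_subst (c 0) g) * e ^ d)
            + e ^ d * Cst (r * poly_subst (c 0) g) \<in> I"
          using I(2) by (intro I_add I_mult ep) auto
        then have "Cst (r * s ^ d) * map_coeffs g \<in> I" by (simp add: Cst_mult algebra_simps)
        moreover have "r * s ^ d \<notin> P" by (intro prime_set_mult[OF P(1)] prime_set_power[OF P(1)] r(1) c(2))
        ultimately show "\<exists>r\<in>{r. Cst r * map_coeffs g \<in> I}. r \<notin> P" by blast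
      qed
      then show ?thesis by (simp add: g_def)
    qed
    obtain D where D: "\<forall>u\<in>keys f. mono_deg u < D" using mono_deg_bound by blast
    have "(\<Sum>d<m. map_coeffs (hom_part d f)) \<in> I" for m
      by (induction m) (auto intro: ideal_mpoly_0[OF I(1)] I_add form)
    moreover have e: "f = (\<Sum>d<D. hom_part d f)" using D by (intro hom_part_expand) auto
    ultimately show "map_coeffs f \<in> I" by (subst e, subst map_coeffs_sum) blast
  qed
qed

lemma pt_ideal_point_ideal:
  fixes a :: "'k::field_char_0"
  assumes K: "ideal_set K" and N: "N \<in> proj_points n (chain_ideal n a) K"
  shows "pt_ideal n a K N \<in> point_ideals n (R_alg n a) K"
  unfolding point_ideals_def
proof (intro CollectI conjI ballI allI)
  define J where "J = pt_ideal n a K N"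
  have ad: "ideal_set A" "chain n a A c" "K \<subseteq> A" if "adapted n a K N A c" for A c
    using that by (auto simp: adapted_def[OF K N] dest: chainD(1))
  have memI: "F \<in> J" if "F \<in> polys {..n}" "\<And>A c d. adapted n a K N A c \<Longrightarrow> Lval a c d F \<in> A" for F
    using that by (auto simp: J_def pt_ideal_def[OF K N])
  have memD: "F \<in> polys {..n}" "\<And>A c d. adapted n a K N A c \<Longrightarrow> Lval a c d F \<in> A" if "F \<in> J" for F
    using that by (auto simp: J_def pt_ideal_def[OF K N])
  have "S_submodule K (polys {..n}) J"
    unfolding S_submodule_def
  proof (intro conjI ballI allI subsetI)
    show "Cst b * v \<in> J" if "b \<in> K" "v \<in> polys {..n}" for b v
    proof (rule memI)
      show "Cst b * v \<in> polys {..n}" using that by (intro polys_mult polys_Cst)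
      fix A c d assume c: "adapted n a K N A c"
      then show "Lval a c d (Cst b * v) \<in> A"
        using ideal_set_mult_right[OF ad(1)[OF c], of b] ad(3)[OF c] that(1) by (auto simp: Lval_Cst_mult)
    qed
    show "0 \<in> J" by (rule memI) (auto dest: ad(1) ideal_set_0)
    show "v + w \<in> J" if "v \<in> J" "w \<in> J" for v w
    proof (rule memI)
      show "v + w \<in> polys {..n}" using memD(1)[OF that(1)] memD(1)[OF that(2)] by (rule polys_add)
      show "Lval a c d (v + w) \<in> A" if c: "adapted n a K N A c" for A c d
        unfolding Lval_add
        by (rule ideal_set_add[OF ad(1)[OF c] memD(2)[OF \<open>v \<in> J\<close> c] memD(2)[OF \<open>w \<in> J\<close> c]])
    qed
    show "Cst b * v \<in> J" if "v \<in> J" for b v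
    proof (rule memI)
      show "Cst b * v \<in> polys {..n}" using polys_Cst memD(1)[OF that] by (rule polys_mult)
      show "Lval a c d (Cst b * v) \<in> A" if c: "adapted n a K N A c" for A c d
        unfolding Lval_Cst_mult by (rule ideal_set_mult[OF ad(1)[OF c] memD(2)[OF \<open>v \<in> J\<close> c]])
    qed
  qed (rule memD(1))
  then show "S_submodule K (polys {..n}) (pt_ideal n a K N)" by (simp add: J_def)
  show "base_mult (R_alg n a) f g \<in> pt_ideal n a K N" if "f \<in> pt_ideal n a K N" "g \<in> polys {..n}" for f g
  proof -
    have f: "f \<in> J" using that(1) by (simp add: J_def)
    have "base_mult (R_alg n a) f g \<in> J"
    proof (rule memI)
      show "base_mult (R_alg n a) f g \<in> polys {..n}" by (rule base_mult_polys[OF memD(1)[OF f] that(2)])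
      show "Lval a c d (base_mult (R_alg n a) f g) \<in> A" if c: "adapted n a K N A c" for A c d
        by (rule Lval_base_mult[OF ad(2)[OF c] memD(1)[OF f] \<open>g \<in> polys {..n}\<close> memD(2)[OF f c]])
    qed
    then show ?thesis by (simp add: J_def)
  qed
  show "hom_part d f \<in> pt_ideal n a K N" if "f \<in> pt_ideal n a K N" for f d
  proof -
    have f: "f \<in> J" using that by (simp add: J_def)
    have "hom_part d f \<in> J"
    proof (rule memI)
      show "hom_part d f \<in> polys {..n}" by (rule hom_part_polys[OF memD(1)[OF f]])
      show "Lval a c e (hom_part d f) \<in> A" if c: "adapted n a K N A c" for A c e
        unfolding Lval_hom_part using memD(2)[OF f c] ideal_set_0[OF ad(1)[OF c]] by simp
    qed
    then show ?thesis by (simp add: J_def)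
  qed
  show "invertible_quot K (forms n d) (pt_ideal n a K N \<inter> forms n d)" for d
    by (rule pt_ideal_invertible[OF K N])
qed

text \<open>Saturation comes from the faithfulness of the first point: a value killed modulo
  \<open>A\<close> by powers of all its coordinates lies in \<open>A\<close>.\<close>

lemma chain_ideal_closed_subscheme: "closed_subscheme n (chain_ideal n (a :: 'k::field_char_0))"
  unfolding closed_subscheme_def
proof (intro conjI ballI allI impI)
  have memI: "f \<in> chain_ideal n a" if "f \<in> polys {..n}"
    "\<And>A c e. chain n a A c \<Longrightarrow> poly_subst (c 0) (hom_part e f) \<in> A" for f
    using that by (auto simp: chain_ideal_def)
  have memD: "f \<in> polys {..n}" "chain n a A c \<Longrightarrow> poly_subst (c 0) (hom_part e f) \<in> A"
    if "f \<in> chain_ideal n a" for f A c e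
    using that by (auto simp: chain_ideal_def)
  show "ideal (chain_ideal n a) (mpoly_ring {..n})"
  proof (rule ideal_mpolyI)
    show "chain_ideal n a \<subseteq> polys {..n}" using memD by blast
    show "0 \<in> chain_ideal n a" by (rule memI) (auto dest: chainD(1)[THEN ideal_set_0])
    show "f + g \<in> chain_ideal n a" if "f \<in> chain_ideal n a" "g \<in> chain_ideal n a" for f g
    proof (rule memI)
      show "f + g \<in> polys {..n}" using memD(1)[OF that(1)] memD(1)[OF that(2)] by (rule polys_add)
      fix A c e assume c: "chain n a A c"
      show "poly_subst (c 0) (hom_part e (f + g)) \<in> A"
        unfolding hom_part_add poly_subst_add
        by (rule ideal_set_add[OF chainD(1)[OF c] memD(2)[OF that(1) c] memD(2)[OF that(2) c]])
    qed
    fix p f :: "'k mpoly" assume p: "p \<in> polys {..n}" and f: "f \<in> chain_ideal n a"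
    show "p * f \<in> chain_ideal n a"
    proof (rule memI)
      show "p * f \<in> polys {..n}" using p memD(1)[OF f] by (rule polys_mult)
      fix A c e assume c: "chain n a A c"
      note A = chainD(1)[OF c]
      obtain D where D: "\<forall>u\<in>keys p. mono_deg u < D" using mono_deg_bound by blast
      have "hom_part e (p * f) = (\<Sum>d<D. hom_part e (f * hom_part d p))"
        by (subst hom_part_expand[of p D])
           (use D in \<open>auto simp: sum_distrib_left hom_part_sum mult.commute[of _ f]\<close>)
      also have "\<dots> = (\<Sum>d<D. if d \<le> e then hom_part (e - d) f * hom_part d p else 0)"
        by (intro sum.cong refl hom_part_mult_form[OF hom_part_forms[OF p]])
      finally have "poly_subst (c 0) (hom_part e (p * f))
          = (\<Sum>d<D. if d \<le> e then poly_subst (c 0) (hom_part (e - d) f) * poly_subst (c 0) (hom_part d p) else 0)"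
        by (simp add: poly_subst_sum poly_subst_mult if_distrib[of "poly_subst _"] cong: if_cong)
      then show "poly_subst (c 0) (hom_part e (p * f)) \<in> A"
        by (simp only:) (auto intro!: ideal_set_sum[OF A] ideal_set_mult_right[OF A] memD(2)[OF f c] simp: ideal_set_0[OF A])
    qed
  qed
  show "hom_part d f \<in> chain_ideal n a" if f: "f \<in> chain_ideal n a" for f d
  proof (rule memI)
    show "hom_part d f \<in> polys {..n}" by (rule hom_part_polys[OF memD(1)[OF f]])
    fix A c e assume c: "chain n a A c"
    have "hom_part e (hom_part d f) = (if e = d then hom_part d f else 0)"
      by (rule hom_part_form[OF hom_part_forms[OF memD(1)[OF f]]])
    then show "poly_subst (c 0) (hom_part e (hom_part d f)) \<in> A"
      using memD(2)[OF f c] ideal_set_0[OF chainD(1)[OF c]] by simp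
  qed
  fix f assume f: "f \<in> polys {..n}" "\<forall>i\<le>n. \<exists>m. Var i ^ m * f \<in> chain_ideal n a"
  then obtain m where m: "\<And>i. i \<le> n \<Longrightarrow> Var i ^ m i * f \<in> chain_ideal n a" by metis
  show "f \<in> chain_ideal n a"
  proof (rule memI[OF f(1)])
    fix A c e assume c: "chain n a A c"
    show "poly_subst (c 0) (hom_part e f) \<in> A"
    proof (rule faithful_power[OF chainD(1,2)[OF c]])
      fix i assume i: "i \<le> n"
      have V: "(Var i :: 'k mpoly) ^ m i \<in> forms n (m i)"
        using forms_power[OF forms_Var[OF i], of "m i"] by simp
      have "poly_subst (c 0) (hom_part (m i + e) (f * Var i ^ m i)) \<in> A"
        using memD(2)[OF m[OF i] c] by (simp add: mult.commute)
      then show "c 0 i ^ m i * poly_subst (c 0) (hom_part e f) \<in> A"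
        by (simp add: hom_part_mult_form[OF V] poly_subst_simps mult.commute)
    qed
  qed
qed

lemma point_scheme_chain_ideal: "point_scheme n (R_alg n a) (chain_ideal n (a :: 'k::field_char_0))"
  unfolding point_scheme_def ideal_UNIV_iff
proof (intro conjI allI impI chain_ideal_closed_subscheme)
  fix K :: "'k mpoly set" assume K: "ideal_set K"
  show "bij_betw (\<lambda>J. J \<inter> forms n 1) (point_ideals n (R_alg n a) K) (proj_points n (chain_ideal n a) K)"
  proof (rule bij_betw_imageI[OF inj_onI], goal_cases inj image)
    case (inj J J')
    then show ?case
      using point_ideal_subset[OF K, of J n a J'] point_ideal_subset[OF K, of J' n a J] by auto
  next
    case image
    show ?case
    proof (intro equalityI subsetI)
    fix N assume "N \<in> (\<lambda>J. J \<inter> forms n 1) ` point_ideals n (R_alg n a) K"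
    then show "N \<in> proj_points n (chain_ideal n a) K"
      using point_ideal_degree_1[OF K] by auto
  next
    fix N assume N: "N \<in> proj_points n (chain_ideal n a) K"
    show "N \<in> (\<lambda>J. J \<inter> forms n 1) ` point_ideals n (R_alg n a) K"
      using pt_ideal_degree_1[OF K N] pt_ideal_point_ideal[OF K N] by (metis image_eqI)
    qed
  qed
qed

section \<open>Uniqueness of the closed subscheme representing point modules\<close>

section \<open>Uniqueness of the point scheme\<close>

text \<open>Parts of degree above \<open>D\<close> are dropped, so this is the homogenisation by
  \<open>Var i\<close> only for large \<open>D\<close>.\<close>

definition homogenize :: "nat \<Rightarrow> nat \<Rightarrow> 'a::comm_ring_1 mpoly \<Rightarrow> 'a mpoly" where
  "homogenize i D q = (\<Sum>e\<le>D. Var i ^ (D - e) * hom_part e q)"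

lemma poly_subst_Var_id: "poly_subst Var f = f"
proof -
  have "monov Var (mol is) = (mono (mol is) :: 'a mpoly)" for "is"
    by (induction "is") (simp_all add: monov_add mono_add Var_def del: One_nat_def)
  then have "monov Var u = (mono u :: 'a mpoly)" for u by (metis mol_word)
  then have "poly_subst Var f = (\<Sum>u\<in>keys f. Cst (lookup f u) * mono u)"
    by (simp add: poly_subst_lsum lsum_def)
  then show ?thesis by (simp flip: mpoly_expand)
qed

lemma homogenize_add: "homogenize i D (p + q) = homogenize i D p + homogenize i D q"
  by (simp add: homogenize_def hom_part_add distrib_left sum.distrib)

lemma homogenize_0 [simp]: "homogenize i D 0 = 0"
  by (simp add: homogenize_def)

lemma homogenize_sum: "homogenize i D (sum f A) = (\<Sum>x\<in>A. homogenize i D (f x))"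
  by (induction A rule: infinite_finite_induct) (simp_all add: homogenize_add)

lemma homogenize_form:
  assumes "f \<in> forms n d" "d \<le> D"
  shows "homogenize i D f = Var i ^ (D - d) * f"
  using assms(2) by (simp add: homogenize_def hom_part_form[OF assms(1)] if_distrib[of "(*) _"] sum.delta cong: if_cong)

lemma homogenize_mult_form:
  fixes p q :: "'a::comm_ring_1 mpoly"
  assumes p: "p \<in> forms n k" "k \<le> D"
  shows "homogenize i D (p * q) = p * homogenize i (D - k) q"
proof -
  have "homogenize i D (p * q) = (\<Sum>e\<le>D. if k \<le> e then Var i ^ (D - e) * (hom_part (e - k) q * p) else 0)"
    by (simp add: homogenize_def mult.commute[of p] hom_part_mult_form[OF p(1)] if_distrib[of "(*) _"] cong: if_cong)
  also have "\<dots> = (\<Sum>e\<in>{k..D}. Var i ^ (D - e) * (hom_part (e - k) q * p))"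
    by (rule sum.mono_neutral_cong_right) auto
  also have "\<dots> = (\<Sum>e\<le>D - k. Var i ^ (D - k - e) * (hom_part e q * p))"
    by (rule sum.reindex_bij_witness[of _ "\<lambda>e. e + k" "\<lambda>e. e - k"]) (use p(2) in auto)
  finally show ?thesis by (simp add: homogenize_def sum_distrib_left mult_ac)
qed

text \<open>The polynomials whose homogenisations of all large degrees lie in \<open>I\<close> form
  an ideal that contains \<open>I\<close> and \<open>Var i - 1\<close>. For the form
  \<open>f\<close>, the homogenisation is a power of \<open>Var i\<close> times
  \<open>f\<close>.\<close>

lemma dehomogenization_mem:
  fixes I :: "'a::comm_ring_1 mpoly set"
  assumes I: "ideal I (mpoly_ring {..n})" and hom: "\<And>f d. f \<in> I \<Longrightarrow> hom_part d f \<in> I"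
    and i: "i \<le> n" and f: "f \<in> forms n d"
    and mem: "f \<in> Idl\<^bsub>mpoly_ring UNIV\<^esub> (I \<union> {Var i - 1})"
  shows "\<exists>m. Var i ^ m * f \<in> I"
proof -
  \<comment> \<open>\<open>B\<close> has variables beyond \<open>n\<close>; these are first sent to
    0.\<close>
  define \<rho> where "\<rho> = poly_subst (\<lambda>j. if j \<le> n then Var j else 0 :: 'a mpoly)"
  have \<rho>_polys: "\<rho> b \<in> polys {..n}" for b
    unfolding \<rho>_def poly_subst_lsum lsum_def monov_def
    by (intro polys_sum polys_mult polys_Cst polys_prod polys_power) (auto intro: polys_Var)
  have \<rho>_id: "\<rho> b = b" if "b \<in> polys {..n}" for b
  proof -
    have "monov (\<lambda>j. if j \<le> n then Var j else 0 :: 'a mpoly) (mol is) = mono (mol is)" if "set is \<subseteq> {..n}" for "is"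
      using that by (induction "is") (simp_all add: monov_add mono_add Var_def del: One_nat_def)
    then have "monov (\<lambda>j. if j \<le> n then Var j else 0 :: 'a mpoly) u = mono u" if "u \<in> keys b" for u
      using polysD[OF \<open>b \<in> polys {..n}\<close> that] by (metis mol_word set_word)
    then have "\<rho> b = (\<Sum>u\<in>keys b. Cst (lookup b u) * mono u)"
      unfolding \<rho>_def poly_subst_lsum lsum_def by (intro sum.cong) auto
    then show ?thesis by (simp flip: mpoly_expand)
  qed
  define Z where "Z = {b. \<exists>D0. \<forall>D\<ge>D0. homogenize i D (\<rho> b) \<in> I}"
  have "ideal_set Z"
  proof (rule ideal_setI)
    show "0 \<in> Z" by (auto simp: Z_def \<rho>_def ideal_mpoly_0[OF I])
  next
    fix x y assume "x \<in> Z" "y \<in> Z"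
    then obtain D1 D2 where "\<forall>D\<ge>D1. homogenize i D (\<rho> x) \<in> I" "\<forall>D\<ge>D2. homogenize i D (\<rho> y) \<in> I"
      by (auto simp: Z_def)
    then show "x + y \<in> Z"
      unfolding Z_def
      by (intro CollectI exI[of _ "max D1 D2"])
         (auto simp: \<rho>_def poly_subst_add homogenize_add intro!: ideal_mpoly_add[OF I])
  next
    fix b x assume "x \<in> Z"
    then obtain D1 where D1: "\<And>D. D \<ge> D1 \<Longrightarrow> homogenize i D (\<rho> x) \<in> I" by (auto simp: Z_def)
    obtain L where L: "\<forall>u\<in>keys (\<rho> b). mono_deg u < L" using mono_deg_bound by blast
    have "homogenize i D (\<rho> (b * x)) \<in> I" if "D \<ge> D1 + L" for D
    proof -
      have "\<rho> (b * x) = (\<Sum>k<L. hom_part k (\<rho> b) * \<rho> x)"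
        using hom_part_expand[of "\<rho> b" L] L by (simp add: \<rho>_def poly_subst_mult flip: sum_distrib_right)
      then have "homogenize i D (\<rho> (b * x)) = (\<Sum>k<L. hom_part k (\<rho> b) * homogenize i (D - k) (\<rho> x))"
        using that by (simp add: homogenize_sum homogenize_mult_form[OF hom_part_forms[OF \<rho>_polys]])
      moreover have "(\<Sum>k<L'. hom_part k (\<rho> b) * homogenize i (D - k) (\<rho> x)) \<in> I" if "L' \<le> L" for L'
        using that
      proof (induction L')
        case 0
        then show ?case by (simp add: ideal_mpoly_0[OF I])
      next
        case (Suc L')
        have "hom_part L' (\<rho> b) * homogenize i (D - L') (\<rho> x) \<in> I"
          using Suc.prems \<open>D \<ge> D1 + L\<close> by (intro ideal_mpoly_mult[OF I] hom_part_polys \<rho>_polys D1) auto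
        then show ?case using Suc by (auto intro: ideal_mpoly_add[OF I])
      qed
      ultimately show ?thesis by simp
    qed
    then show "b * x \<in> Z" by (auto simp: Z_def)
  qed
  moreover have "I \<subseteq> Z"
  proof
    fix g assume g: "g \<in> I"
    have "(\<Sum>e\<in>B. Var i ^ (D - e) * hom_part e g) \<in> I" if "finite B" for B D
      using that i
      by (induction B rule: finite_induct)
         (auto intro!: ideal_mpoly_0[OF I] ideal_mpoly_add[OF I] ideal_mpoly_mult[OF I] polys_power polys_Var hom g)
    then show "g \<in> Z"
      using \<rho>_id[of g] g ideal_mpoly_subset[OF I] by (auto simp: Z_def homogenize_def)
  qed
  moreover have "Var i - 1 \<in> Z"
  proof -
    have \<rho>: "\<rho> (Var i - 1) = Var i + Cst (- 1)"
      using i by (simp add: \<rho>_def poly_subst_diff Cst_uminus)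
    have "homogenize i D (\<rho> (Var i - 1)) = 0" if "D \<ge> 1" for D
    proof -
      have "Var i ^ D = (Var i :: 'a mpoly) ^ (D - 1) * Var i" using that by (simp flip: power_Suc2)
      moreover have "homogenize i D (Var i) = (Var i :: 'a mpoly) ^ (D - 1) * Var i"
        by (rule homogenize_form[OF forms_Var[OF i] that])
      moreover have "homogenize i D (Cst (- 1)) = (Var i :: 'a mpoly) ^ D * Cst (- 1)"
        using homogenize_form[OF forms_Cst[of "- 1 :: 'a" n], of D i] by simp
      ultimately show ?thesis unfolding \<rho> homogenize_add by (simp add: Cst_uminus)
    qed
    then show ?thesis unfolding Z_def by (auto intro!: exI[of _ 1] simp: ideal_mpoly_0[OF I])
  qed
  ultimately have "Idl\<^bsub>mpoly_ring UNIV\<^esub> (I \<union> {Var i - 1}) \<subseteq> Z"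
    by (intro Idl_least) (auto simp: ideal_UNIV_iff)
  then have "f \<in> Z" using mem by blast
  then obtain D0 where D0: "\<forall>D\<ge>D0. homogenize i D f \<in> I"
    using \<rho>_id[OF formsD(1)[OF f]] by (auto simp: Z_def)
  have "homogenize i (D0 + d) f = Var i ^ D0 * f" using homogenize_form[OF f, of "D0 + d" i] by simp
  then show ?thesis using D0 by (metis le_add1)
qed

text \<open>The universal point of the chart \<open>X\<^sub>i = 1\<close>.\<close>

lemma chart_point:
  fixes I :: "'k::field_char_0 mpoly set"
  assumes I: "closed_subscheme n I" and i: "i \<le> n"
  defines "K \<equiv> Idl\<^bsub>mpoly_ring UNIV\<^esub> (I \<union> {Var i - 1})"
  shows "{v \<in> forms n 1. evm Var v \<in> K} \<in> proj_points n I K"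
  unfolding proj_points_def
proof (intro CollectI conjI)
  define N where "N = {v \<in> forms n 1. evm Var v \<in> K}"
  have K: "ideal_set K" unfolding K_def by (rule ideal_set_Idl)
  have IK: "I \<subseteq> K" and iK: "Var i - 1 \<in> K"
    unfolding K_def by (auto intro!: Idl_memI)
  have "S_submodule K (forms n 1) N"
    unfolding S_submodule_def N_def
    by (auto simp: evm_add evm_Cst_mult ideal_set_0[OF K] simp del: One_nat_def
        intro: forms_add forms_Cst_mult ideal_set_add[OF K] ideal_set_mult[OF K] ideal_set_mult_right[OF K])
  then show "S_submodule K (forms n 1) {v \<in> forms n 1. evm Var v \<in> K}" by (simp add: N_def)
  have scale: "Cst 1 * v - Cst (evm Var v) * Var i \<in> N" if v: "v \<in> forms n 1" for v
  proof -
    have "evm Var (Cst 1 * v - Cst (evm Var v) * Var i) = - (evm Var v * (Var i - 1))"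
      by (simp add: evm_diff evm_mult algebra_simps)
    also have "\<dots> \<in> K" by (intro ideal_set_uminus[OF K] ideal_set_mult[OF K] iK)
    finally show ?thesis
      unfolding N_def by (intro CollectI conjI forms_diff forms_Cst_mult forms_Var v i)
  qed
  show "invertible_quot K (forms n 1) {v \<in> forms n 1. evm Var v \<in> K}"
  proof (rule invertible_quotI, intro exI conjI ballI allI impI)
    fix P assume P: "prime_set P"
    show "1 \<notin> P" by (rule prime_set_1[OF P])
    show "Var i \<in> forms n 1" by (rule forms_Var[OF i])
    show "Cst (1 ^ 1) * v - Cst (evm Var v) * Var i \<in> {v \<in> forms n 1. evm Var v \<in> K}" if "v \<in> forms n 1" for v
      using scale[OF that] by (simp add: N_def)
    show "1 ^ 1 * b \<in> K" if "Cst b * Var i \<in> {v \<in> forms n 1. evm Var v \<in> K}" for b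
    proof -
      have "b * Var i - b * (Var i - 1) \<in> K"
        using that by (intro ideal_set_diff[OF K _ ideal_set_mult[OF K iK]]) (simp add: evm_Cst_mult)
      then show ?thesis by (simp add: algebra_simps)
    qed
  qed
  show "map_coeffs ` I \<subseteq> Idl\<^bsub>mpoly_ring {..n}\<^esub> ({v \<in> forms n 1. evm Var v \<in> K} \<union> Cst ` K)"
    unfolding N_def[symmetric]
  proof (intro image_subsetI Idl_memI)
    fix g A assume g: "g \<in> I" and A: "ideal A (mpoly_ring {..n})" "N \<union> Cst ` K \<subseteq> A"
    have idI: "ideal I (mpoly_ring {..n})" and homI: "\<And>d. hom_part d g \<in> I"
      using I g by (auto simp: closed_subscheme_def)
    have gp: "g \<in> polys {..n}" using g ideal_mpoly_subset[OF idI] by blast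
    have form: "map_coeffs (hom_part d g) \<in> A" for d
    proof -
      define h where "h = hom_part d g"
      have h: "h \<in> forms n d" unfolding h_def by (rule hom_part_forms[OF gp])
      have hK: "poly_subst Var h \<in> K" using homI[of d] IK by (auto simp: h_def poly_subst_Var_id)
      have V: "Var i \<in> polys {..n}" using i by (intro polys_Var) auto
      have "Cst (1 ^ d) * map_coeffs h - Cst (poly_subst Var h) * Var i ^ d \<in> A"
      proof (rule form_subst_cong[OF A(1) V _ h])
        fix j assume "j \<le> n"
        then have "Cst 1 * Var j - Cst (evm Var (Var j)) * Var i \<in> N" by (intro scale forms_Var)
        then show "Cst 1 * Var j - Cst (Var j) * Var i \<in> A" using A(2) by auto
      qed
      moreover have "Var i ^ d * Cst (poly_subst Var h) \<in> A"
        using hK A(2) by (intro ideal_mpoly_mult[OF A(1)] polys_power V) auto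
      ultimately have "(Cst (1 ^ d) * map_coeffs h - Cst (poly_subst Var h) * Var i ^ d)
          + Var i ^ d * Cst (poly_subst Var h) \<in> A"
        by (rule ideal_mpoly_add[OF A(1)])
      then show ?thesis by (simp add: h_def mult.commute)
    qed
    obtain D where D: "\<forall>u\<in>keys g. mono_deg u < D" using mono_deg_bound by blast
    have "(\<Sum>d<m. map_coeffs (hom_part d g)) \<in> A" for m
      by (induction m) (auto intro: ideal_mpoly_0[OF A(1)] ideal_mpoly_add[OF A(1)] form)
    moreover have e: "g = (\<Sum>d<D. hom_part d g)" using D by (intro hom_part_expand) auto
    ultimately show "map_coeffs g \<in> A" by (subst e, subst map_coeffs_sum) blast
  qed
qed

text \<open>The universal point of each chart of \<open>I'\<close> is also a point of
  \<open>I\<close>, so the forms of \<open>I\<close> vanish there; dehomogenisation and saturation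
  bring them into \<open>I'\<close>.\<close>

lemma closed_subscheme_subset:
  fixes I I' :: "'k::field_char_0 mpoly set"
  assumes I: "closed_subscheme n I" and I': "closed_subscheme n I'"
    and sub: "\<And>K. ideal_set K \<Longrightarrow> proj_points n I' K \<subseteq> proj_points n I K"
  shows "I \<subseteq> I'"
proof
  fix f assume f: "f \<in> I"
  have idI: "ideal I (mpoly_ring {..n})" and homI: "\<And>d. hom_part d f \<in> I"
    and idI': "ideal I' (mpoly_ring {..n})" and homI': "\<And>f d. f \<in> I' \<Longrightarrow> hom_part d f \<in> I'"
    and sat: "\<And>f. f \<in> polys {..n} \<Longrightarrow> (\<And>i. i \<le> n \<Longrightarrow> \<exists>m. Var i ^ m * f \<in> I') \<Longrightarrow> f \<in> I'"
    using I I' f by (auto simp: closed_subscheme_def)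
  have fp: "f \<in> polys {..n}" using f ideal_mpoly_subset[OF idI] by blast
  have form: "hom_part d f \<in> I'" for d
  proof (rule sat)
    have h: "hom_part d f \<in> forms n d" by (rule hom_part_forms[OF fp])
    show "hom_part d f \<in> polys {..n}" by (rule formsD(1)[OF h])
    fix i assume i: "i \<le> n"
    define K where "K = Idl\<^bsub>mpoly_ring UNIV\<^esub> (I' \<union> {Var i - 1})"
    define N where "N = {v \<in> forms n 1. evm Var v \<in> K}"
    have K: "ideal_set K" unfolding K_def by (rule ideal_set_Idl)
    have "N \<in> proj_points n I K"
      using chart_point[OF I' i] sub[OF K] unfolding K_def N_def by blast
    then have "map_coeffs (hom_part d f) \<in> Idl\<^bsub>mpoly_ring {..n}\<^esub> (N \<union> Cst ` K)"
      using homI by (auto simp: proj_points_def)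
    then have "poly_subst Var (hom_part d f) \<in> K"
      by (rule poly_subst_mem_of_Idl[OF K, rotated 3]) (auto simp: N_def dest: formsD(1))
    then show "\<exists>m. Var i ^ m * hom_part d f \<in> I'"
      using dehomogenization_mem[OF idI' homI' i h] by (simp add: K_def poly_subst_Var_id)
  qed
  obtain D where D: "\<forall>u\<in>keys f. mono_deg u < D" using mono_deg_bound by blast
  have "(\<Sum>d<m. hom_part d f) \<in> I'" for m
    by (induction m) (auto intro: ideal_mpoly_0[OF idI'] ideal_mpoly_add[OF idI'] form)
  moreover have e: "f = (\<Sum>d<D. hom_part d f)" using D by (intro hom_part_expand) auto
  ultimately show "f \<in> I'" by (subst e) blast
qed

text \<open>The points over \<open>B / K\<close> are the image of \<open>point_ideals\<close>, which
  does not involve the ideal.\<close>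

lemma point_scheme_unique:
  fixes I I' :: "'k::field_char_0 mpoly set"
  assumes "point_scheme n R I" "point_scheme n R I'"
  shows "I = I'"
proof -
  have "proj_points n I K = proj_points n I' K" if "ideal_set K" for K
    using assms that unfolding point_scheme_def ideal_UNIV_iff bij_betw_def by metis
  then show ?thesis
    using closed_subscheme_subset[of n I I'] closed_subscheme_subset[of n I' I] assms
    by (auto simp: point_scheme_def)
qed

lemma scheme_iso_refl: "scheme_iso n I n I"
  unfolding scheme_iso_def
proof (intro exI[of _ id] exI[of _ "\<lambda>U s. s"] conjI allI impI)
  show "homeomorphic_map (Proj_top n I) (Proj_top n I) id" by simp
  fix U assume U: "openin (Proj_top n I) U"
  have pre: "{P \<in> Proj n I. id P \<in> W} = W" if "openin (Proj_top n I) W" for W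
    using that by (auto simp: openin_Proj_top Proj_open_def)
  have "(\<lambda>s. s) \<in> ring_iso R R" for R :: "'a proj_section ring"
    by (auto simp: ring_iso_def ring_hom_def bij_betw_def)
  then show "let pre = \<lambda>U. {P \<in> Proj n I. id P \<in> U}
    in (\<lambda>s. s) \<in> ring_iso (sections n I U) (sections n I (pre U)) \<and>
       (\<forall>c. const_section n I U c = const_section n I (pre U) c) \<and>
       (\<forall>W. openin (Proj_top n I) W \<and> W \<subseteq> U \<longrightarrow>
          (\<forall>s\<in>carrier (sections n I U). restrict s W = restrict s (pre W)))"
    unfolding Let_def using pre[OF U] pre by simp
qed

section \<open>The points of the scheme: rational normal curves\<close>

section \<open>Graded substitutions\<close>

lemma poly_subst_forms:
  fixes \<sigma> :: "nat \<Rightarrow> 'a::comm_ring_1 mpoly"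
  assumes \<sigma>: "\<And>i. i \<le> N \<Longrightarrow> \<sigma> i \<in> forms n k" and f: "f \<in> forms N d"
  shows "poly_subst \<sigma> f \<in> forms n (k * d)"
  using f
proof (rule forms_induct_mono)
  fix "is" assume "is": "set is \<subseteq> {..N}" "length is = d"
  have "poly_subst \<sigma> (mono (mol is)) \<in> forms n (k * length is)" using "is"(1)
  proof (induction "is")
    case Nil
    then show ?case using forms_1 by simp
  next
    case (Cons i "is")
    have "\<sigma> i * poly_subst \<sigma> (mono (mol is)) \<in> forms n (k + k * length is)"
      using Cons by (intro forms_mult \<sigma>) auto
    then show ?case by (simp add: mono_mol_Cons poly_subst_mult del: mol.simps)
  qed
  then show "poly_subst \<sigma> (mono (mol is)) \<in> forms n (k * d)" using "is"(2) by simp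
qed (auto simp: poly_subst_add poly_subst_mult intro: forms_add forms_Cst_mult)

lemma hom_part_poly_subst:
  fixes \<sigma> :: "nat \<Rightarrow> 'a::comm_ring_1 mpoly"
  assumes \<sigma>: "\<And>i. i \<le> N \<Longrightarrow> \<sigma> i \<in> forms n k" and "k \<ge> 1" and f: "f \<in> polys {..N}"
  shows "hom_part (k * d) (poly_subst \<sigma> f) = poly_subst \<sigma> (hom_part d f)"
proof -
  obtain D0 where D0: "\<forall>u\<in>keys f. mono_deg u < D0" using mono_deg_bound by blast
  define D where "D = max D0 (Suc d)"
  have f_eq: "f = (\<Sum>e<D. hom_part e f)"
    using D0 by (intro hom_part_expand) (auto simp: D_def)
  have "hom_part (k * d) (poly_subst \<sigma> f) = (\<Sum>e<D. hom_part (k * d) (poly_subst \<sigma> (hom_part e f)))"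
    by (subst f_eq) (simp add: poly_subst_sum hom_part_sum)
  also have "\<dots> = (\<Sum>e<D. if e = d then poly_subst \<sigma> (hom_part e f) else 0)"
  proof (rule sum.cong)
    fix e
    show "hom_part (k * d) (poly_subst \<sigma> (hom_part e f)) = (if e = d then poly_subst \<sigma> (hom_part e f) else 0)"
      using hom_part_form[OF poly_subst_forms[OF \<sigma> hom_part_forms[OF f, of e]], where e = "k * d"] assms(2)
      by auto
  qed simp
  also have "\<dots> = poly_subst \<sigma> (hom_part d f)" by (simp add: D_def)
  finally show ?thesis .
qed

lemma poly_subst_cong_form:
  assumes A: "ideal_set A" and \<sigma>: "\<And>i. i \<le> n \<Longrightarrow> \<sigma> i - l * \<tau> i \<in> A" and f: "f \<in> forms n d"
  shows "poly_subst \<sigma> f - l ^ d * poly_subst \<tau> f \<in> A"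
  using f
proof (rule forms_induct_mono)
  fix "is" assume "is": "set is \<subseteq> {..n}" "length is = d"
  have "poly_subst \<sigma> (mono (mol is)) - l ^ length is * poly_subst \<tau> (mono (mol is)) \<in> A" using "is"(1)
  proof (induction "is")
    case Nil
    then show ?case by (simp add: ideal_set_0[OF A])
  next
    case (Cons i "is")
    have "\<sigma> i * poly_subst \<sigma> (mono (mol is)) - (l * \<tau> i) * (l ^ length is * poly_subst \<tau> (mono (mol is))) \<in> A"
      using Cons by (intro ideal_set_cong_mult[OF A] \<sigma>) auto
    then show ?case by (simp add: mono_mol_Cons poly_subst_mult mult_ac del: mol.simps)
  qed
  then show "poly_subst \<sigma> (mono (mol is)) - l ^ d * poly_subst \<tau> (mono (mol is)) \<in> A" using "is"(2) by simp
next
  fix f g assume "poly_subst \<sigma> f - l ^ d * poly_subst \<tau> f \<in> A" "poly_subst \<sigma> g - l ^ d * poly_subst \<tau> g \<in> A"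
  from ideal_set_add[OF A this] show "poly_subst \<sigma> (f + g) - l ^ d * poly_subst \<tau> (f + g) \<in> A"
    by (simp add: poly_subst_add algebra_simps)
next
  fix b f assume "poly_subst \<sigma> f - l ^ d * poly_subst \<tau> f \<in> A"
  from ideal_set_mult[OF A this, of "Cst b"]
  show "poly_subst \<sigma> (Cst b * f) - l ^ d * poly_subst \<tau> (Cst b * f) \<in> A"
    by (simp add: poly_subst_mult right_diff_distrib mult.left_commute)
qed (simp add: ideal_set_0[OF A])

lemma poly_subst_cong_polys:
  assumes "f \<in> polys V" "\<And>i. i \<in> V \<Longrightarrow> \<sigma> i = \<tau> i"
  shows "poly_subst \<sigma> f = poly_subst \<tau> f"
proof -
  have "monov \<sigma> u = monov \<tau> u" if "u \<in> keys f" for u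
    unfolding monov_def using polysD[OF assms(1) that] assms(2) by (intro prod.cong) auto
  then show ?thesis unfolding poly_subst_lsum by (rule lsum_cong)
qed

lemma poly_subst_polys:
  fixes \<sigma> :: "nat \<Rightarrow> 'a::comm_ring_1 mpoly"
  assumes "f \<in> polys V" "\<And>i. i \<in> V \<Longrightarrow> \<sigma> i \<in> polys W"
  shows "poly_subst \<sigma> f \<in> polys W"
  unfolding poly_subst_lsum lsum_def monov_def
  using assms polysD[OF assms(1)] by (intro polys_sum polys_mult polys_Cst polys_prod polys_power) blast

lemma poly_subst_poly_subst: "poly_subst \<tau> (poly_subst \<sigma> f) = poly_subst (\<lambda>i. poly_subst \<tau> (\<sigma> i)) f"
proof -
  have "poly_subst \<tau> (monov \<sigma> u) = monov (\<lambda>i. poly_subst \<tau> (\<sigma> i)) u" for u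
    by (simp add: monov_def poly_subst_simps)
  then show ?thesis
    by (simp add: poly_subst_lsum[of \<sigma>] poly_subst_lsum[of "\<lambda>i. poly_subst \<tau> (\<sigma> i)"] lsum_def poly_subst_simps)
qed

section \<open>Homogenised binomial coefficients\<close>

text \<open>This is \<open>S ^ l\<close> times the binomial coefficient of \<open>T / S\<close> over
  \<open>l\<close>.\<close>

definition hbinom :: "nat \<Rightarrow> 'k::field_char_0 mpoly \<Rightarrow> 'k mpoly \<Rightarrow> 'k mpoly" where
  "hbinom l S T = Cst (1 / fact l) * (\<Prod>r<l. T - Cst (of_nat r) * S)"

lemma hbinom_0 [simp]: "hbinom 0 S T = 1"
  by (simp add: hbinom_def)

lemma hbinom_Suc: "Cst (of_nat (Suc l)) * hbinom (Suc l) S T = (T - Cst (of_nat l) * S) * hbinom l S T"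
proof -
  have "Cst (of_nat (Suc l)) * Cst (1 / fact (Suc l)) = (Cst (1 / fact l) :: 'a mpoly)"
    by (simp add: field_simps del: of_nat_Suc flip: Cst_mult)
  then have "Cst (of_nat (Suc l)) * (Cst (1 / fact (Suc l)) * x) = Cst (1 / fact l) * x" for x :: "'a mpoly"
    by (metis mult.assoc)
  then have "Cst (of_nat (Suc l)) * hbinom (Suc l) S T
      = Cst (1 / fact l) * ((\<Prod>r<l. T - Cst (of_nat r) * S) * (T - Cst (of_nat l) * S))"
    unfolding hbinom_def prod.lessThan_Suc by blast
  then show ?thesis by (simp only: hbinom_def mult_ac)
qed

text \<open>Homogeneous form of Vandermonde's identity for \<open>T / S + c\<close>. In the
  induction both sides are multiplied by \<open>l + 1\<close>, split as
  \<open>(l + 1 - r) + r\<close>, so that each of the two binomials absorbs its own part.\<close>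

lemma hbinom_Vandermonde:
  "hbinom l S (T + Cst c * S) = (\<Sum>r\<le>l. Cst (c gchoose r) * (S ^ r * hbinom (l - r) S T))"
proof (induction l)
  case 0
  then show ?case by simp
next
  case (Suc l)
  define f where "f r = Cst (c gchoose r) * S ^ r" for r
  define h where "h r = hbinom r S T" for r
  have h: "Cst (of_nat (Suc r)) * h (Suc r) = (T - Cst (of_nat r) * S) * h r" for r
    by (simp only: h_def hbinom_Suc)
  have IH: "hbinom l S (T + Cst c * S) = (\<Sum>r\<le>l. f r * h (l - r))"
    by (simp add: Suc f_def h_def mult.assoc)
  have split: "Cst (of_nat (Suc l)) * (f r * h (Suc l - r))
      = f r * (Cst (of_nat (Suc l - r)) * h (Suc l - r)) + Cst (of_nat r) * f r * h (Suc l - r)"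
    if "r \<le> Suc l" for r
  proof -
    have "of_nat (Suc l) = (of_nat (Suc l - r) + of_nat r :: 'a)" using that by (simp flip: of_nat_add del: of_nat_Suc)
    then show ?thesis by (simp only: Cst_add) (simp add: algebra_simps)
  qed
  have fS: "Cst (of_nat (Suc r)) * f (Suc r) = Cst (c - of_nat r) * (S * f r)" for r
  proof -
    have "of_nat (Suc r) * (c gchoose Suc r) = (c - of_nat r) * (c gchoose r)"
      using gbinomial_absorption[of r c] gbinomial_absorb_comp[of c r] by simp
    then show ?thesis
      unfolding f_def by (simp only: Cst_mult[symmetric] mult.assoc[symmetric] power_Suc mult.left_commute[of S])
        (simp add: mult_ac flip: Cst_mult)
  qed
  have "Cst (of_nat (Suc l)) * (\<Sum>r\<le>Suc l. f r * h (Suc l - r))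
      = (\<Sum>r\<le>Suc l. f r * (Cst (of_nat (Suc l - r)) * h (Suc l - r)))
        + (\<Sum>r\<le>Suc l. Cst (of_nat r) * f r * h (Suc l - r))"
    unfolding sum_distrib_left sum.distrib[symmetric] by (intro sum.cong split) auto
  also have "(\<Sum>r\<le>Suc l. f r * (Cst (of_nat (Suc l - r)) * h (Suc l - r)))
      = (\<Sum>r\<le>l. f r * ((T - Cst (of_nat (l - r)) * S) * h (l - r)))"
  proof -
    have "Cst (of_nat (Suc l - r)) * h (Suc l - r) = (T - Cst (of_nat (l - r)) * S) * h (l - r)"
      if "r \<le> l" for r
      by (simp only: Suc_diff_le[OF that] h)
    then show ?thesis by simp
  qed
  also have "(\<Sum>r\<le>Suc l. Cst (of_nat r) * f r * h (Suc l - r))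
      = (\<Sum>r\<le>l. Cst (c - of_nat r) * (S * f r) * h (l - r))"
    by (simp only: sum.atMost_Suc_shift fS) simp
  also have "(\<Sum>r\<le>l. f r * ((T - Cst (of_nat (l - r)) * S) * h (l - r)))
        + (\<Sum>r\<le>l. Cst (c - of_nat r) * (S * f r) * h (l - r))
      = (\<Sum>r\<le>l. (T + Cst c * S - Cst (of_nat l) * S) * (f r * h (l - r)))"
    unfolding sum.distrib[symmetric]
    by (intro sum.cong refl) (simp add: of_nat_diff Cst_diff algebra_simps)
  also have "\<dots> = Cst (of_nat (Suc l)) * hbinom (Suc l) S (T + Cst c * S)"
    by (simp only: hbinom_Suc IH sum_distrib_left)
  finally have "(\<Sum>r\<le>Suc l. f r * h (Suc l - r)) = hbinom (Suc l) S (T + Cst c * S)"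
    by (subst (asm) mult_left_cancel) (simp_all del: of_nat_Suc)
  then show ?case by (simp add: f_def h_def mult.assoc)
qed

text \<open>Both sides are the falling factorial of length \<open>l + l'\<close> divided by
  \<open>l! l'!\<close>, a trinomial coefficient.\<close>

lemma hbinom_mult_sym:
  "hbinom l S T * hbinom l' S (T - Cst (of_nat l) * S) = hbinom l' S T * hbinom l S (T - Cst (of_nat l') * S)"
proof -
  have *: "hbinom l S T * hbinom l' S (T - Cst (of_nat l) * S)
      = Cst (1 / fact l) * Cst (1 / fact l') * (\<Prod>r<l + l'. T - Cst (of_nat r) * S)" for l l'
  proof -
    have "(\<Prod>r<l + l'. T - Cst (of_nat r) * S)
        = (\<Prod>r<l. T - Cst (of_nat r) * S) * (\<Prod>r<l'. T - Cst (of_nat l) * S - Cst (of_nat r) * S)"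
      by (induction l') (simp_all add: Cst_add algebra_simps)
    then show ?thesis by (simp add: hbinom_def mult_ac)
  qed
  show ?thesis unfolding * by (simp add: add.commute mult.commute)
qed

section \<open>The curves\<close>

text \<open>The coefficients of the falling factorial \<open>T (T - S) \<dots> (T - (l - 1) S)\<close>.\<close>

primrec ffact_coeff :: "nat \<Rightarrow> nat \<Rightarrow> 'k::field_char_0" where
  "ffact_coeff 0 j = (if j = 0 then 1 else 0)"
| "ffact_coeff (Suc l) j = (case j of 0 \<Rightarrow> 0 | Suc j' \<Rightarrow> ffact_coeff l j') - of_nat l * ffact_coeff l j"

lemma ffact_coeff_gt: "l < j \<Longrightarrow> ffact_coeff l j = 0"
  by (induction l arbitrary: j) (auto split: nat.split)

lemma ffact_coeff_diag: "ffact_coeff l l = 1"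
  by (induction l) (simp_all add: ffact_coeff_gt)

lemma ffact_coeff_sum:
  "l \<le> k \<Longrightarrow> (\<Sum>j\<le>k. Cst (ffact_coeff l j) * (S ^ (k - j) * T ^ j))
     = S ^ (k - l) * (\<Prod>r<l. T - Cst (of_nat r) * (S :: 'k::field_char_0 mpoly))"
proof (induction l arbitrary: k)
  case 0
  have "(\<Sum>j\<le>k. Cst (ffact_coeff 0 j) * (S ^ (k - j) * T ^ j)) = (\<Sum>j\<le>k. if j = 0 then S ^ k else 0)"
    by (rule sum.cong) auto
  then show ?case by simp
next
  case (Suc l)
  then obtain k' where k: "k = Suc k'" "l \<le> k'" by (cases k) auto
  let ?\<Pi> = "\<Prod>r<l. T - Cst (of_nat r) * S"
  have "(\<Sum>j\<le>k. Cst (ffact_coeff (Suc l) j) * (S ^ (k - j) * T ^ j))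
      = (\<Sum>j\<le>k. Cst (case j of 0 \<Rightarrow> 0 | Suc j' \<Rightarrow> ffact_coeff l j') * (S ^ (k - j) * T ^ j))
        - Cst (of_nat l) * (\<Sum>j\<le>k. Cst (ffact_coeff l j) * (S ^ (k - j) * T ^ j))"
    by (simp add: Cst_diff Cst_mult left_diff_distrib sum_subtractf sum_distrib_left mult.assoc)
  also have "(\<Sum>j\<le>k. Cst (case j of 0 \<Rightarrow> 0 | Suc j' \<Rightarrow> ffact_coeff l j') * (S ^ (k - j) * T ^ j))
      = T * (\<Sum>j\<le>k'. Cst (ffact_coeff l j) * (S ^ (k' - j) * T ^ j))"
    unfolding k(1) sum.atMost_Suc_shift by (simp add: sum_distrib_left mult_ac)
  also have "\<dots> = T * (S ^ (k' - l) * ?\<Pi>)" using Suc.IH[OF k(2)] by simp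
  also have "(\<Sum>j\<le>k. Cst (ffact_coeff l j) * (S ^ (k - j) * T ^ j)) = S ^ (k - l) * ?\<Pi>"
    using k by (intro Suc.IH) auto
  also have "S ^ (k - l) = S * S ^ (k' - l)" using k by (simp add: Suc_diff_le)
  finally show ?case using k(1) by (simp add: algebra_simps)
qed

text \<open>The \<open>k\<close>-th curve consists of the points \<open>z ^ (n - k) * (1 + z) ^ b\<close>, where \<open>b = T / S\<close>.\<close>

definition curve_mat :: "nat \<Rightarrow> nat \<Rightarrow> nat \<Rightarrow> nat \<Rightarrow> 'k::field_char_0" where
  "curve_mat n k i j = (if i < n - k then 0 else ffact_coeff (i - (n - k)) j / fact (i - (n - k)))"

definition curve_pt ::
    "nat \<Rightarrow> nat \<Rightarrow> 'k::field_char_0 mpoly \<Rightarrow> 'k mpoly \<Rightarrow> nat \<Rightarrow> 'k mpoly" where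
  "curve_pt n k S T i = (\<Sum>j\<le>k. Cst (curve_mat n k i j) * (S ^ (k - j) * T ^ j))"

lemma curve_pt_eq_0: "i < n - k \<Longrightarrow> curve_pt n k S T i = 0"
  by (simp add: curve_pt_def curve_mat_def)

lemma curve_pt_eq: "l \<le> k \<Longrightarrow> curve_pt n k S T (n - k + l) = S ^ (k - l) * hbinom l S T"
proof -
  assume l: "l \<le> k"
  have "curve_pt n k S T (n - k + l)
      = Cst (1 / fact l) * (\<Sum>j\<le>k. Cst (ffact_coeff l j) * (S ^ (k - j) * T ^ j))"
    by (simp add: curve_pt_def curve_mat_def sum_distrib_left flip: Cst_mult mult.assoc)
  then show ?thesis unfolding ffact_coeff_sum[OF l] by (simp add: hbinom_def mult_ac)
qed

text \<open>Below its zero rows the matrix is triangular with diagonal \<open>1 / l!\<close>,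
  because the falling factorial of length \<open>l\<close> is monic of degree
  \<open>l\<close>.\<close>

lemma curve_mat_inj:
  fixes u :: "nat \<Rightarrow> 'k::field_char_0"
  assumes "k \<le> n" and eq: "\<And>i. i \<le> n \<Longrightarrow> (\<Sum>j\<le>k. curve_mat n k i j * u j) = 0"
  shows "j \<le> k \<Longrightarrow> u j = 0"
proof (induction j rule: less_induct)
  case (less l)
  have "(\<Sum>j\<le>k. curve_mat n k (n - k + l) j * u j) = (\<Sum>j\<le>k. if j = l then u l / fact l else 0)"
  proof (rule sum.cong)
    fix j assume "j \<in> {..k}"
    then show "curve_mat n k (n - k + l) j * u j = (if j = l then u l / fact l else 0)"
      using less.IH[of j] by (cases j l rule: linorder_cases)
        (auto simp: curve_mat_def ffact_coeff_gt ffact_coeff_diag)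
  qed simp
  then have "u l / fact l = 0" using eq[of "n - k + l"] less.prems assms(1) by simp
  then show ?case by simp
qed

text \<open>The factor \<open>(1 + z) ^ c\<close> raises the exponent \<open>T / S\<close> by
  \<open>c\<close>, that is, replaces \<open>T\<close> by \<open>T + c S\<close>.\<close>

lemma tw_curve_pt:
  assumes "l \<le> k"
  shows "tw c (curve_pt n k S T) (n - k + l) = S ^ (k - l) * hbinom l S (T + Cst c * S)"
proof -
  have "tw c (curve_pt n k S T) (n - k + l)
      = (\<Sum>r\<le>l. Cst (c gchoose r) * curve_pt n k S T (n - k + l - r))"
    unfolding tw_def by (rule sum.mono_neutral_right) (auto simp: curve_pt_eq_0)
  also have "\<dots> = (\<Sum>r\<le>l. S ^ (k - l) * (Cst (c gchoose r) * (S ^ r * hbinom (l - r) S T)))"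
  proof (rule sum.cong)
    fix r assume r: "r \<in> {..l}"
    then have "n - k + l - r = n - k + (l - r)" by simp
    moreover have "curve_pt n k S T (n - k + (l - r)) = S ^ (k - (l - r)) * hbinom (l - r) S T"
      using r assms by (intro curve_pt_eq) simp
    moreover have "S ^ (k - (l - r)) = S ^ (k - l) * S ^ r"
      using r assms by (simp flip: power_add)
    ultimately show "Cst (c gchoose r) * curve_pt n k S T (n - k + l - r)
        = S ^ (k - l) * (Cst (c gchoose r) * (S ^ r * hbinom (l - r) S T))"
      by (simp only: mult_ac)
  qed simp
  finally show ?thesis by (simp add: hbinom_Vandermonde sum_distrib_left)
qed

text \<open>For \<open>a = k - n\<close> the point modules on the \<open>k\<close>-th curve have constant chains.\<close>

lemma chain_curve:
  assumes k: "k \<le> n" and S: "S \<noteq> 0"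
  shows "chain n (- of_nat (n - k)) {0} (\<lambda>_. curve_pt n k S T)"
  unfolding chain_def
proof (intro conjI allI)
  show "ideal_set {0 :: 'a mpoly}" by (rule ideal_setI) auto
  let ?p = "curve_pt n k S T"
  have "?p (n - k) = S ^ k" using curve_pt_eq[of 0 k n S T] by simp
  then show "faithful n {0} ?p"
    unfolding faithful_def using S by (auto dest: spec[of _ "n - k"])
  show "link n (- of_nat (n - k)) {0} ?p ?p"
    unfolding link_def
  proof (intro allI impI)
    fix i j assume ij: "i \<le> n" "j \<le> n"
    have 0: "tw s ?p i = 0" if "i < n - k" for s i
      using that by (simp add: tw_def curve_pt_eq_0)
    show "?p j * tw (- (- of_nat (n - k) + of_nat j)) ?p i - ?p i * tw (- (- of_nat (n - k) + of_nat i)) ?p j \<in> {0}"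
    proof (cases "i < n - k \<or> j < n - k")
      case True
      then show ?thesis by (auto simp: 0 curve_pt_eq_0)
    next
      case False
      define l l' where "l = i - (n - k)" and "l' = j - (n - k)"
      have l: "i = n - k + l" "j = n - k + l'" "l \<le> k" "l' \<le> k"
        using False ij k by (auto simp: l_def l'_def)
      have s: "- (- of_nat (n - k) + of_nat (n - k + x)) = (- of_nat x :: 'a)" for x by simp
      show ?thesis
        using hbinom_mult_sym[of l S T l']
        unfolding l(1,2) s tw_curve_pt[OF l(3)] tw_curve_pt[OF l(4)] curve_pt_eq[OF l(3)] curve_pt_eq[OF l(4)]
        by (simp add: Cst_uminus mult_ac)
    qed
  qed
qed

lemma curve_pt_forms:
  assumes "S \<in> forms N 1" "T \<in> forms N 1"
  shows "curve_pt n k S T i \<in> forms N k"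
  unfolding curve_pt_def
proof (intro forms_sum forms_Cst_mult)
  fix j assume "j \<in> {..k}"
  then show "S ^ (k - j) * T ^ j \<in> forms N k"
    using forms_mult[OF forms_power[OF assms(1), of "k - j"] forms_power[OF assms(2), of j]] by simp
qed

lemma veronese_subst_eq: "veronese_subst k (curve_mat n k) = poly_subst (curve_pt n k (Var 0) (Var 1))"
  by (simp add: veronese_subst_def curve_pt_def[abs_def])

lemma poly_subst_curve_pt:
  "poly_subst \<sigma> (curve_pt n k S T i) = curve_pt n k (poly_subst \<sigma> S) (poly_subst \<sigma> T) i"
  by (simp add: curve_pt_def poly_subst_simps)

text \<open>The ideal does not depend on \<open>a\<close>, so the parameter may be the one for which
  the points of this curve give constant chains.\<close>

lemma chain_ideal_curve:
  assumes "k \<le> n" "f \<in> chain_ideal n (a :: 'k::field_char_0)" "S \<noteq> 0"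
  shows "poly_subst (curve_pt n k S T) f = 0"
proof -
  have "f \<in> chain_ideal n (- of_nat (n - k))" using assms(2) chain_ideal_param by blast
  then have "poly_subst (curve_pt n k S T) (hom_part e f) = 0" for e
    using chain_curve[OF assms(1,3), of T] unfolding chain_ideal_def by blast
  moreover obtain D where "\<forall>u\<in>keys f. mono_deg u < D" using mono_deg_bound by blast
  then have "f = (\<Sum>d<D. hom_part d f)" by (intro hom_part_expand) auto
  ultimately show ?thesis using poly_subst_sum[of "curve_pt n k S T" "\<lambda>d. hom_part d f" "{..<D}"] by simp
qed

section \<open>The points of the point scheme\<close>

lemma primeideal_pullback:
  fixes P :: "'a::comm_ring_1 mpoly set"
  assumes P: "prime_set P"
  shows "primeideal {g \<in> polys V. poly_subst \<tau> g \<in> P} (mpoly_ring V)"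
proof (rule primeidealI)
  note A = prime_set_ideal[OF P]
  show "ideal {g \<in> polys V. poly_subst \<tau> g \<in> P} (mpoly_ring V)"
    by (rule ideal_mpolyI)
       (auto simp: poly_subst_add poly_subst_mult ideal_set_0[OF A]
         intro: polys_add polys_mult ideal_set_add[OF A] ideal_set_mult[OF A])
  show "cring (mpoly_ring V :: 'a mpoly ring)" by (rule cring_mpoly_ring)
  have "(1 :: 'a mpoly) \<in> polys V" "1 \<notin> {g \<in> polys V. poly_subst \<tau> g \<in> P}"
    using prime_set_1[OF P] by auto
  then have "polys V \<noteq> {g \<in> polys V. poly_subst \<tau> g \<in> P}" by blast
  then show "carrier (mpoly_ring V) \<noteq> {g \<in> polys V. poly_subst \<tau> g \<in> P}"
    by (simp add: mpoly_ring_def)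
qed (use P in \<open>auto simp: mpoly_ring_def poly_subst_mult prime_set_def\<close>)

text \<open>A prime of the ring in \<open>n + 1\<close> variables becomes a prime of
  \<open>B\<close> by setting the further variables to 0.\<close>

definition prime_ext where
  "prime_ext n P = {b. poly_subst (\<lambda>j. if j \<le> n then Var j else 0) b \<in> P}"

lemma prime_ext_iff: "f \<in> polys {..n} \<Longrightarrow> f \<in> prime_ext n P \<longleftrightarrow> f \<in> P"
  using poly_subst_cong_polys[of f "{..n}" "\<lambda>j. if j \<le> n then Var j else 0" Var]
  by (simp add: prime_ext_def poly_subst_Var_id)

lemma prime_set_prime_ext:
  assumes "primeideal P (mpoly_ring {..n})"
  shows "prime_set (prime_ext n P)"
proof -
  interpret primeideal P "mpoly_ring {..n}" by fact
  note I = is_ideal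
  have \<rho>: "poly_subst (\<lambda>j. if j \<le> n then Var j else 0) b \<in> polys {..n}" for b :: "'a mpoly"
    by (rule poly_subst_polys[of _ UNIV]) (auto intro: polys_Var)
  show ?thesis
    unfolding prime_set_def
  proof (intro conjI allI impI ideal_setI)
    show "1 \<notin> prime_ext n P"
    proof
      assume "1 \<in> prime_ext n P"
      then have "1 \<in> P" by (simp add: prime_ext_def)
      then have "f \<in> P" if "f \<in> polys {..n}" for f using ideal_mpoly_mult[OF I that, of 1] by simp
      then show False using I_notcarr ideal_mpoly_subset[OF I] by (auto simp: mpoly_ring_def)
    qed
    fix a b assume "a * b \<in> prime_ext n P"
    then show "a \<in> prime_ext n P \<or> b \<in> prime_ext n P"
      using I_prime[of "poly_subst (\<lambda>j. if j \<le> n then Var j else 0) a"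
          "poly_subst (\<lambda>j. if j \<le> n then Var j else 0) b"] \<rho>
      by (simp add: prime_ext_def poly_subst_mult mpoly_ring_def)
  qed (auto simp: prime_ext_def poly_subst_add poly_subst_mult ideal_mpoly_0[OF I]
      intro!: ideal_mpoly_add[OF I] ideal_mpoly_mult[OF I] \<rho>)
qed

lemma Var_neq_0 [simp]: "Var i \<noteq> (0 :: 'a::comm_ring_1 mpoly)"
  by (metis Var_def mono_def lookup_single_eq lookup_zero one_neq_zero)

lemma curve_subset_Proj:
  fixes I :: "'k::field_char_0 mpoly set"
  assumes k: "1 \<le> k" "k \<le> n" and Q: "Q \<in> Proj 1 {0}"
  shows "{f \<in> polys {..n}. veronese_subst k (curve_mat n k) f \<in> Q} \<in> Proj n (chain_ideal n (a :: 'k))"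
proof -
  define \<sigma> where "\<sigma> = curve_pt n k (Var 0) (Var 1 :: 'k mpoly)"
  define Q' where "Q' = prime_ext 1 Q"
  have Qp: "primeideal Q (mpoly_ring {..1})" and homQ: "\<And>f d. f \<in> Q \<Longrightarrow> hom_part d f \<in> Q"
    and V: "\<exists>i\<le>1. Var i \<notin> Q"
    using Q by (auto simp: Proj_def)
  have Q': "prime_set Q'" unfolding Q'_def by (rule prime_set_prime_ext[OF Qp])
  have \<sigma>: "\<sigma> i \<in> forms 1 k" for i unfolding \<sigma>_def by (intro curve_pt_forms forms_Var) auto
  have \<sigma>p: "poly_subst \<sigma> f \<in> polys {..1}" if "f \<in> polys {..n}" for f
    by (rule poly_subst_polys[OF that]) (rule formsD(1)[OF \<sigma>])
  have mem: "poly_subst \<sigma> f \<in> Q' \<longleftrightarrow> poly_subst \<sigma> f \<in> Q" if "f \<in> polys {..n}" for f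
    unfolding Q'_def by (rule prime_ext_iff[OF \<sigma>p[OF that]])
  define P where "P = {f \<in> polys {..n}. poly_subst \<sigma> f \<in> Q'}"
  have P_eq: "P = {f \<in> polys {..n}. veronese_subst k (curve_mat n k) f \<in> Q}"
    unfolding P_def veronese_subst_eq \<sigma>_def[symmetric] using mem by auto
  have "P \<in> Proj n (chain_ideal n a)"
    unfolding Proj_def
  proof (intro CollectI conjI ballI allI subsetI)
    show "primeideal P (mpoly_ring {..n})" unfolding P_def by (rule primeideal_pullback[OF Q'])
    show "hom_part d f \<in> P" if "f \<in> P" for f d
    proof -
      have f: "f \<in> polys {..n}" "poly_subst \<sigma> f \<in> Q" using that mem by (auto simp: P_def)
      have "poly_subst \<sigma> (hom_part d f) \<in> Q"
        using homQ[OF f(2), of "k * d"] hom_part_poly_subst[OF \<sigma> k(1) f(1), of d] by simp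
      then show ?thesis using mem[OF hom_part_polys[OF f(1)]] hom_part_polys[OF f(1)] by (simp add: P_def)
    qed
    show "f \<in> P" if "f \<in> chain_ideal n a" for f
      using chain_ideal_curve[OF k(2) that, of "Var 0" "Var 1"] that ideal_set_0[OF prime_set_ideal[OF Q']]
      by (auto simp: P_def \<sigma>_def chain_ideal_def)
    show "\<exists>i\<le>n. Var i \<notin> P"
    proof (rule ccontr)
      assume "\<not> (\<exists>i\<le>n. Var i \<notin> P)"
      then have s: "\<sigma> i \<in> Q'" if "i \<le> n" for i using that by (auto simp: P_def)
      have V': "Var i \<in> Q' \<longleftrightarrow> Var i \<in> Q" if "i \<le> 1" for i
        unfolding Q'_def using that by (intro prime_ext_iff polys_Var) auto
      \<comment> \<open>The first nonzero coordinate is \<open>Var 0 ^ k\<close>, and modulo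
        \<open>Var 0\<close> the last one is \<open>Var 1 ^ k / k!\<close>. So a prime containing
        all coordinates would contain both variables.\<close>
      have "\<sigma> (n - k + 0) = Var 0 ^ k" unfolding \<sigma>_def by (subst curve_pt_eq) auto
      then have 0: "Var 0 \<in> Q'" using s[of "n - k"] prime_set_power[OF Q', of "Var 0" k] by auto
      have "\<sigma> (n - k + k) = hbinom k (Var 0) (Var 1)" unfolding \<sigma>_def by (subst curve_pt_eq) auto
      then have h: "hbinom k (Var 0) (Var 1) \<in> Q'" using s[of n] k by simp
      have "Cst (fact k :: 'k) * Cst (1 / fact k) = (1 :: 'k mpoly)" by (simp flip: Cst_mult)
      then have "Cst (1 / fact k :: 'k) \<notin> Q'"
        using ideal_set_mult[OF prime_set_ideal[OF Q'], of "Cst (1 / fact k)" "Cst (fact k)"] prime_set_1[OF Q'] by auto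
      from prime_set_mult[OF Q' this] h
      have "(\<Prod>r<k. Var 1 - Cst (of_nat r :: 'k) * Var 0) \<in> Q'" unfolding hbinom_def by blast
      then obtain r where r: "Var 1 - Cst (of_nat r :: 'k) * Var 0 \<in> Q'"
        using prime_set_prod[OF Q', of "{..<k}" "\<lambda>r. Var 1 - Cst (of_nat r) * Var 0"] by blast
      from ideal_set_add[OF prime_set_ideal[OF Q'] r ideal_set_mult[OF prime_set_ideal[OF Q'] 0, of "Cst (of_nat r)"]]
      have "Var 1 \<in> Q'" by simp
      then have "Var i \<in> Q" if "i \<le> 1" for i using 0 V' that by (cases "i = 0") (auto simp: le_Suc_eq)
      then show False using V by auto
    qed
  qed
  then show ?thesis by (simp add: P_eq)
qed

text \<open>If \<open>m\<close> is the leading index of the generic point \<open>x\<close> of \<open>P\<close>, the recursion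
  \<open>l x\<^sub>m x\<^bsub>m + l\<^esub> = (x\<^bsub>m + 1\<^esub> - (l - 1) x\<^sub>m) x\<^bsub>m + l - 1\<^esub>\<close> puts \<open>x\<close> on the curve of degree \<open>n - m\<close>.\<close>

lemma point_on_curve:
  fixes P :: "'k::field_char_0 mpoly set"
  assumes P: "prime_set P" and I: "chain_ideal n (a :: 'k) \<subseteq> P"
    and m: "m < n" "Var m \<notin> P" "\<And>i. i < m \<Longrightarrow> Var i \<in> P"
  shows "i \<le> n \<Longrightarrow> curve_pt n (n - m) (Var m) (Var (Suc m)) i - Var m ^ (n - m - 1) * Var i \<in> P"
proof -
  note A = prime_set_ideal[OF P]
  define x where "x = (Var :: nat \<Rightarrow> 'k mpoly)"
  \<comment> \<open>With this parameter the twist \<open>- (b + m)\<close> in \<open>next_pt\<close>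
    at the chart \<open>m\<close> is 0, so the next point is \<open>x m ^ n\<close> times
    \<open>x\<close> modulo \<open>P\<close>.\<close>
  define b where "b = (- of_nat m :: 'k)"
  have lead: "lead P x = m"
    unfolding lead_def x_def using m(2,3) by (intro Least_equality) (auto simp: not_less[symmetric])
  have loc: "loc P P = P"
    using loc_superset[OF A P] loc_subset[OF A P] by blast
  have "poly_subst x f \<in> loc P P" if "f \<in> chain_ideal n b" for f
    using that I chain_ideal_param[of n a b] unfolding loc x_def by (auto simp: poly_subst_Var_id)
  then have chain: "chain n b (loc P P) (pt_at n b P x)"
    using m(1,2) by (intro chain_at[OF P _ A]) (auto simp: x_def intro!: exI[of _ m])
  have xm: "x m \<notin> P" and xlt: "\<And>i. i < m \<Longrightarrow> x i \<in> P" using m by (auto simp: x_def)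
  have tw_m: "tw s x m - x m \<in> P" for s by (rule tw_lead[OF A xlt])
  \<comment> \<open>Cancelling \<open>x m ^ n\<close> leaves the link of \<open>x\<close> with
    itself.\<close>
  have R: "x j * tw (of_nat m - of_nat j) x i - x i * tw (of_nat m - of_nat i) x j \<in> P"
    if "i \<le> n" "j \<le> n" for i j
  proof -
    define q where "q = next_pt n b m x"
    have "link n b P x q"
      using chainD(3)[OF chain, of 0] by (simp add: loc lead q_def)
    then have 1: "q j * tw (of_nat m - of_nat j) x i - q i * tw (of_nat m - of_nat i) x j \<in> P"
      using that by (auto simp: link_def b_def)
    have q: "q i - x m ^ n * x i \<in> P" if "i \<le> n" for i
    proof -
      have "(\<Prod>l\<in>{..n}-{i}. tw (- (b + of_nat l)) x m) - (\<Prod>l\<in>{..n}-{i}. x m) \<in> P"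
        by (rule ideal_set_cong_prod[OF A tw_m])
      moreover have "(\<Prod>l\<in>{..n}-{i}. x m) = x m ^ n" using that by simp
      ultimately have "x i * ((\<Prod>l\<in>{..n}-{i}. tw (- (b + of_nat l)) x m) - x m ^ n) \<in> P"
        by (intro ideal_set_mult[OF A]) simp
      then show ?thesis by (simp add: q_def next_pt_def b_def algebra_simps)
    qed
    have "(q j - x m ^ n * x j) * tw (of_nat m - of_nat j) x i - (q i - x m ^ n * x i) * tw (of_nat m - of_nat i) x j \<in> P"
      using that by (intro ideal_set_diff[OF A] ideal_set_mult_right[OF A] q)
    from ideal_set_diff[OF A 1 this]
    have "x m ^ n * (x j * tw (of_nat m - of_nat j) x i - x i * tw (of_nat m - of_nat i) x j) \<in> P"
      by (simp add: algebra_simps)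
    then show ?thesis using P prime_set_power[OF P xm, of n] by (auto simp: prime_set_def)
  qed
  \<comment> \<open>The twist by -1 is the one that occurs in \<open>R\<close> when one index is
    \<open>Suc m\<close>; \<open>x\<close> is recovered as \<open>(1 + z) y\<close>.\<close>
  define y where "y = tw (- 1) x"
  have "x = tw 1 y" by (simp add: y_def tw_tw)
  have xy: "x (Suc i) = y (Suc i) + y i" for i
  proof -
    have g: "(1 :: 'k) gchoose k = (if k \<le> 1 then 1 else 0)" for k
      using gbinomial_binomial binomial_gbinomial[of 1 k, where 'a = 'k] by (cases "k = 0"; cases "k = 1") (auto simp: binomial_eq_0)
    have "tw 1 y (Suc i) = (\<Sum>k\<in>{0, 1}. Cst (1 gchoose k) * y (Suc i - k))"
      unfolding tw_def by (rule sum.mono_neutral_right) (auto simp: g)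
    then show ?thesis using \<open>x = tw 1 y\<close> by (simp add: g)
  qed
  let ?t = "x (Suc m)"
  define D where "D l = ?t - Cst (of_nat l) * x m" for l
  have tw_Sm: "tw s x (Suc m) - (?t + Cst s * x m) \<in> P" for s
  proof -
    have "tw s x (Suc m) = ?t + Cst s * x m + (\<Sum>k\<in>{..Suc m} - {0, 1}. Cst (s gchoose k) * x (Suc m - k))"
      unfolding tw_def by (subst sum.subset_diff[of "{0, 1}"]) auto
    moreover have "(\<Sum>k\<in>{..Suc m} - {0, 1}. Cst (s gchoose k) * x (Suc m - k)) \<in> P"
    proof (rule ideal_set_sum[OF A])
      fix k assume "k \<in> {..Suc m} - {0, 1}"
      then have "Suc m - k < m" by auto
      then show "Cst (s gchoose k) * x (Suc m - k) \<in> P" by (intro ideal_set_mult[OF A] xlt)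
    qed
    ultimately show ?thesis by simp
  qed
  \<comment> \<open>This is \<open>R\<close> at \<open>m + l\<close> and \<open>Suc m\<close>;
    modulo \<open>P\<close> only two terms of the twisted coordinate at \<open>Suc m\<close>
    survive.\<close>
  have rec_y: "Cst (of_nat l) * x m * y (m + l) - D l * y (m + l - 1) \<in> P" if l: "1 \<le> l" "m + l \<le> n" for l
  proof -
    have s: "of_nat m - of_nat (Suc m) = (- 1 :: 'k)" "of_nat m - of_nat (m + l) = (- of_nat l :: 'k)" by simp_all
    have "?t * y (m + l) - x (m + l) * tw (- of_nat l) x (Suc m) \<in> P"
      using R[of "m + l" "Suc m"] l unfolding s y_def by simp
    moreover have "x (m + l) * (tw (- of_nat l) x (Suc m) - D l) \<in> P"
      using tw_Sm[of "- of_nat l"] by (intro ideal_set_mult[OF A]) (simp add: D_def Cst_uminus)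
    ultimately have "?t * y (m + l) - x (m + l) * tw (- of_nat l) x (Suc m)
        + x (m + l) * (tw (- of_nat l) x (Suc m) - D l) \<in> P" by (rule ideal_set_add[OF A])
    moreover have "x (m + l) = y (m + l) + y (m + l - 1)" using xy[of "m + l - 1"] l by simp
    ultimately show ?thesis by (simp add: D_def algebra_simps)
  qed
  have xy': "Cst (of_nat l) * x m * x (m + l) - ?t * y (m + l - 1) \<in> P" if l: "1 \<le> l" "m + l \<le> n" for l
  proof -
    have "x (m + l) = y (m + l) + y (m + l - 1)" using xy[of "m + l - 1"] l by simp
    then show ?thesis using rec_y[OF l] by (simp add: D_def algebra_simps)
  qed
  have Cst_notin: "Cst (of_nat l :: 'k) \<notin> P" if "l > 0" for l
  proof
    assume "Cst (of_nat l :: 'k) \<in> P"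
    then have "Cst (1 / of_nat l) * Cst (of_nat l :: 'k) \<in> P" by (rule ideal_set_mult[OF A])
    then show False using that prime_set_1[OF P] by (simp flip: Cst_mult)
  qed
  \<comment> \<open>Eliminates \<open>y\<close> between \<open>rec_y\<close> and \<open>xy'\<close>,
    at the cost of the factor \<open>l * x m\<close>, which lies outside \<open>P\<close> for
    \<open>l > 0\<close>.\<close>
  have rec_x: "Cst (of_nat (Suc l)) * x m * x (m + Suc l) - D l * x (m + l) \<in> P" if l: "m + Suc l \<le> n" for l
  proof (cases l)
    case 0
    then show ?thesis by (simp add: D_def ideal_set_0[OF A] mult.commute)
  next
    case (Suc l')
    define c c' where "c = Cst (of_nat (Suc l) :: 'k)" and "c' = Cst (of_nat l :: 'k)"
    have 1: "c * x m * x (m + Suc l) - ?t * y (m + l) \<in> P"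
      using xy'[of "Suc l"] l by (simp add: c_def)
    have 2: "c' * x m * y (m + l) - D l * y (m + l') \<in> P"
      using rec_y[of l] l Suc by (simp add: c'_def)
    have 3: "c' * x m * x (m + l) - ?t * y (m + l') \<in> P"
      using xy'[of l] l Suc by (simp add: c'_def)
    have "c' * x m * (c * x m * x (m + Suc l) - ?t * y (m + l)) + ?t * (c' * x m * y (m + l) - D l * y (m + l'))
        - D l * (c' * x m * x (m + l) - ?t * y (m + l')) \<in> P"
      by (rule ideal_set_diff[OF A ideal_set_add[OF A ideal_set_mult[OF A 1] ideal_set_mult[OF A 2]] ideal_set_mult[OF A 3]])
    then have "(c' * x m) * (c * x m * x (m + Suc l) - D l * x (m + l)) \<in> P"
      by (simp add: algebra_simps)
    moreover have "c' * x m \<notin> P" unfolding c'_def using Suc by (intro prime_set_mult[OF P] Cst_notin xm) simp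
    ultimately show ?thesis using P unfolding c_def prime_set_def by blast
  qed
  \<comment> \<open>\<open>rec_x\<close> is the recursion \<open>hbinom_Suc\<close> with
    \<open>S = x m\<close> and \<open>T = x (m + 1)\<close>, up to powers of
    \<open>x m\<close>.\<close>
  have main: "x m * hbinom l (x m) ?t - x m ^ l * x (m + l) \<in> P" if "m + l \<le> n" for l
    using that
  proof (induction l)
    case 0
    then show ?case by (simp add: ideal_set_0[OF A])
  next
    case (Suc l)
    define c where "c = Cst (of_nat (Suc l) :: 'k)"
    have h: "c * hbinom (Suc l) (x m) ?t = D l * hbinom l (x m) ?t" unfolding c_def D_def by (rule hbinom_Suc)
    have 1: "D l * (x m * hbinom l (x m) ?t - x m ^ l * x (m + l)) \<in> P"
      using Suc by (intro ideal_set_mult[OF A]) simp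
    have 2: "x m ^ l * (c * x m * x (m + Suc l) - D l * x (m + l)) \<in> P"
      using rec_x[OF Suc.prems] by (intro ideal_set_mult[OF A]) (simp add: c_def)
    have "c * (x m * hbinom (Suc l) (x m) ?t) = x m * (D l * hbinom l (x m) ?t)"
      unfolding h[symmetric] by (simp only: mult_ac)
    then have "c * (x m * hbinom (Suc l) (x m) ?t - x m ^ Suc l * x (m + Suc l))
      = D l * (x m * hbinom l (x m) ?t - x m ^ l * x (m + l)) - x m ^ l * (c * x m * x (m + Suc l) - D l * x (m + l))"
      by (simp add: algebra_simps)
    then have "c * (x m * hbinom (Suc l) (x m) ?t - x m ^ Suc l * x (m + Suc l)) \<in> P"
      using ideal_set_diff[OF A 1 2] by simp
    moreover have "c \<notin> P" unfolding c_def by (rule Cst_notin) simp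
    ultimately show ?case using P unfolding prime_set_def by blast
  qed
  assume i: "i \<le> n"
  show ?thesis
  proof (cases "i < m")
    case True
    then have "Var m ^ (n - m - 1) * Var i \<in> P" by (intro ideal_set_mult[OF A] m(3))
    then show ?thesis using True m(1) by (simp add: curve_pt_eq_0 ideal_set_uminus[OF A])
  next
    case False
    define l where "l = i - m"
    have l: "i = m + l" "l \<le> n - m" using False i by (auto simp: l_def)
    have cp: "curve_pt n (n - m) (x m) ?t i = x m ^ (n - m - l) * hbinom l (x m) ?t"
      using curve_pt_eq[OF l(2), of n "x m" ?t] l(1) m(1) by simp
    have "x m ^ (n - m - l) * (x m * hbinom l (x m) ?t - x m ^ l * x i) \<in> P"
      using main[of l] l m(1) by (intro ideal_set_mult[OF A]) simp
    moreover have "x m ^ (n - m - l) * x m ^ l = x m * x m ^ (n - m - 1)"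
    proof -
      have "n - m - l + l = Suc (n - m - 1)" using l(2) m(1) by simp
      then show ?thesis by (metis power_add power_Suc)
    qed
    ultimately have "x m * (curve_pt n (n - m) (x m) ?t i - x m ^ (n - m - 1) * x i) \<in> P"
      unfolding cp by (simp add: right_diff_distrib mult_ac)
    then show ?thesis using P xm unfolding prime_set_def x_def by blast
  qed
qed

lemma Proj_subset_curves:
  fixes a :: "'k::field_char_0"
  assumes n: "n \<ge> 1" and P: "P \<in> Proj n (chain_ideal n a)"
  shows "\<exists>k\<in>{1..n}. \<exists>Q\<in>Proj 1 {0}. P = {f \<in> polys {..n}. veronese_subst k (curve_mat n k) f \<in> Q}"
proof -
  define P' where "P' = prime_ext n P"
  have Pp: "primeideal P (mpoly_ring {..n})" and homP: "\<And>f d. f \<in> P \<Longrightarrow> hom_part d f \<in> P"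
    and IP: "chain_ideal n a \<subseteq> P" and V: "\<exists>i\<le>n. Var i \<notin> P"
    using P by (auto simp: Proj_def)
  have P': "prime_set P'" unfolding P'_def by (rule prime_set_prime_ext[OF Pp])
  note A = prime_set_ideal[OF P']
  have mem: "f \<in> P' \<longleftrightarrow> f \<in> P" if "f \<in> polys {..n}" for f
    unfolding P'_def by (rule prime_ext_iff[OF that])
  have idP: "ideal P (mpoly_ring {..n})" using Pp by (simp add: primeideal.axioms)
  have VP: "Var i \<in> P' \<longleftrightarrow> Var i \<in> P" if "i \<le> n" for i using that by (intro mem polys_Var) auto
  have IP': "chain_ideal n a \<subseteq> P'" using IP mem by (auto simp: chain_ideal_def)
  define m where "m = lead P' (Var :: nat \<Rightarrow> 'k mpoly)"
  obtain i0 where i0: "i0 \<le> n" "Var i0 \<notin> P'" using V VP by blast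
  have m: "m \<le> n" "Var m \<notin> P'" "\<And>i. i < m \<Longrightarrow> Var i \<in> P'"
    using lead[of i0 n Var P'] i0 by (auto simp: m_def)
  have "\<exists>m0 w. m0 < n \<and> w \<notin> P' \<and> (Var m0 \<notin> P' \<or> Var (Suc m0) \<notin> P') \<and>
      (\<forall>i\<le>n. curve_pt n (n - m0) (Var m0) (Var (Suc m0)) i - w * Var i \<in> P')"
  proof (cases "m < n")
    case True
    then show ?thesis
      using point_on_curve[OF P' IP' True m(2,3)] prime_set_power[OF P' m(2), of "n - m - 1"] m(2)
      by (intro exI[of _ m] exI[of _ "Var m ^ (n - m - 1)"]) auto
  next
    \<comment> \<open>\<open>P\<close> is the coordinate point of index \<open>n\<close>. No curve
      of degree 0 is available, but the point lies on the line \<open>k = 1\<close>, at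
      \<open>S = 0\<close>.\<close>
    case False
    then have mn: "m = n" using m(1) by simp
    define m0 where "m0 = n - 1"
    have m0: "n = Suc m0" "n - m0 = 1" using n by (auto simp: m0_def)
    have "curve_pt n (n - m0) (Var m0) (Var (Suc m0)) i - 1 * Var i \<in> P'" if "i \<le> n" for i
    proof -
      consider "i < m0" | "i = m0" | "i = Suc m0" using \<open>i \<le> n\<close> m0 by linarith
      then show ?thesis
      proof cases
        case 1
        then have "Var i \<in> P'" using m(3) mn m0 by simp
        then show ?thesis using 1 m0 by (simp add: curve_pt_eq_0 ideal_set_uminus[OF A])
      next
        case 2
        then show ?thesis
          using curve_pt_eq[of 0 1 n "Var m0" "Var (Suc m0) :: 'k mpoly"] m0 by (simp add: ideal_set_0[OF A])
      next
        case 3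
        have "hbinom 1 (Var m0) (Var (Suc m0) :: 'k mpoly) = Var (Suc m0)" by (simp add: hbinom_def)
        then show ?thesis
          using 3 curve_pt_eq[of 1 1 n "Var m0" "Var (Suc m0) :: 'k mpoly"] m0 by (simp add: ideal_set_0[OF A])
      qed
    qed
    then show ?thesis
      using m(2) mn m0 prime_set_1[OF P'] by (intro exI[of _ m0] exI[of _ 1]) auto
  qed
  then obtain m0 w where m0: "m0 < n" "w \<notin> P'" "Var m0 \<notin> P' \<or> Var (Suc m0) \<notin> P'"
    and cp: "\<And>i. i \<le> n \<Longrightarrow> curve_pt n (n - m0) (Var m0) (Var (Suc m0)) i - w * Var i \<in> P'" by blast
  define k where "k = n - m0"
  define \<theta> where "\<theta> = (\<lambda>j :: nat. if j = 0 then Var m0 else Var (Suc m0) :: 'k mpoly)"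
  define \<sigma> where "\<sigma> = curve_pt n k (Var m0) (Var (Suc m0) :: 'k mpoly)"
  have k: "k \<in> {1..n}" using m0(1) by (auto simp: k_def)
  have \<sigma>: "\<sigma> i \<in> forms n k" for i unfolding \<sigma>_def using m0(1) by (intro curve_pt_forms forms_Var) auto
  have \<theta>: "\<theta> i \<in> forms n 1" for i using m0(1) by (auto simp: \<theta>_def intro!: forms_Var simp del: One_nat_def)
  \<comment> \<open>The parameter on the projective line: the ratio \<open>T / S\<close> is read off
    the coordinates \<open>m0\<close> and \<open>m0 + 1\<close> of the generic point.\<close>
  define Q where "Q = {g \<in> polys {..1}. poly_subst \<theta> g \<in> P'}"
  have "Q \<in> Proj 1 {0}"
    unfolding Proj_def
  proof (intro CollectI conjI ballI allI)
    show "primeideal Q (mpoly_ring {..1})" unfolding Q_def by (rule primeideal_pullback[OF P'])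
    show "{0} \<subseteq> Q" by (simp add: Q_def ideal_set_0[OF A])
    show "\<exists>i\<le>1. Var i \<notin> Q"
      using m0(3)
    proof
      assume "Var m0 \<notin> P'"
      then show ?thesis by (intro exI[of _ 0]) (simp add: Q_def \<theta>_def)
    next
      assume "Var (Suc m0) \<notin> P'"
      then show ?thesis by (intro exI[of _ 1]) (simp add: Q_def \<theta>_def)
    qed
    fix g d assume "g \<in> Q"
    then have g: "g \<in> polys {..1}" "poly_subst \<theta> g \<in> P'" by (auto simp: Q_def)
    have \<theta>p: "poly_subst \<theta> f \<in> polys {..n}" if "f \<in> polys {..1}" for f
      by (rule poly_subst_polys[OF that]) (rule formsD(1)[OF \<theta>])
    then have "hom_part (1 * d) (poly_subst \<theta> g) \<in> P"
      using mem[OF \<theta>p[OF g(1)]] g(2) homP by blast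
    then have "poly_subst \<theta> (hom_part d g) \<in> P"
      unfolding hom_part_poly_subst[of 1 \<theta> n 1, OF \<theta> le_refl g(1)] .
    then have "poly_subst \<theta> (hom_part d g) \<in> P'"
      using mem[OF \<theta>p[OF hom_part_polys[OF g(1)]]] by blast
    then show "hom_part d g \<in> Q" using hom_part_polys[OF g(1)] by (simp add: Q_def)
  qed
  moreover have "P = {f \<in> polys {..n}. veronese_subst k (curve_mat n k) f \<in> Q}"
  proof -
    have ver: "veronese_subst k (curve_mat n k) f \<in> Q \<longleftrightarrow> poly_subst \<sigma> f \<in> P'" if f: "f \<in> polys {..n}" for f
    proof -
      have "poly_subst (curve_pt n k (Var 0) (Var 1)) f \<in> polys {..1}"
        by (rule poly_subst_polys[OF f]) (intro formsD(1)[OF curve_pt_forms] forms_Var, auto)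
      moreover have "poly_subst \<theta> (poly_subst (curve_pt n k (Var 0) (Var 1)) f) = poly_subst \<sigma> f"
        by (simp add: poly_subst_poly_subst poly_subst_curve_pt \<theta>_def \<sigma>_def)
      ultimately show ?thesis by (simp add: veronese_subst_eq Q_def)
    qed
    \<comment> \<open>On forms of degree \<open>d\<close>, substituting the curve point is
      multiplication by \<open>w ^ d\<close> modulo \<open>P'\<close>, and \<open>w\<close> lies
      outside \<open>P'\<close>.\<close>
    have form: "poly_subst \<sigma> f \<in> P' \<longleftrightarrow> f \<in> P'" if f: "f \<in> forms n d" for f d
    proof -
      have "poly_subst \<sigma> f - w ^ d * poly_subst Var f \<in> P'"
        using cp unfolding k_def[symmetric] \<sigma>_def[symmetric] by (intro poly_subst_cong_form[OF A _ f])
      then have 1: "poly_subst \<sigma> f - w ^ d * f \<in> P'" by (simp add: poly_subst_Var_id)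
      have w: "w ^ d \<notin> P'" by (rule prime_set_power[OF P' m0(2)])
      show ?thesis
      proof
        assume "poly_subst \<sigma> f \<in> P'"
        then have "w ^ d * f \<in> P'" using ideal_set_cong_mem[OF A ideal_set_cong_sym[OF A 1]] by blast
        then show "f \<in> P'" using prime_set_mult[OF P' w] by blast
      next
        assume "f \<in> P'"
        then show "poly_subst \<sigma> f \<in> P'" by (intro ideal_set_cong_mem[OF A 1] ideal_set_mult[OF A])
      qed
    qed
    have \<sigma>p: "poly_subst \<sigma> f \<in> polys {..n}" if "f \<in> polys {..n}" for f
      by (rule poly_subst_polys[OF that]) (rule formsD(1)[OF \<sigma>])
    have iff: "f \<in> P \<longleftrightarrow> poly_subst \<sigma> f \<in> P'" if f: "f \<in> polys {..n}" for f
    proof -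
      obtain D where "\<forall>u\<in>keys f. mono_deg u < D" using mono_deg_bound by blast
      then have e: "f = (\<Sum>d<D. hom_part d f)" by (intro hom_part_expand) auto
      have hf: "hom_part d f \<in> forms n d" for d by (rule hom_part_forms[OF f])
      show ?thesis
      proof
        assume "f \<in> P"
        then have "hom_part d f \<in> P'" for d using homP mem[OF formsD(1)[OF hf]] by blast
        then have "(\<Sum>d<D. poly_subst \<sigma> (hom_part d f)) \<in> P'"
          using form[OF hf] by (intro ideal_set_sum[OF A]) blast
        then show "poly_subst \<sigma> f \<in> P'" by (subst e) (simp add: poly_subst_sum)
      next
        assume "poly_subst \<sigma> f \<in> P'"
        then have "hom_part (k * d) (poly_subst \<sigma> f) \<in> P" for d using mem[OF \<sigma>p[OF f]] homP by blast
        then have "poly_subst \<sigma> (hom_part d f) \<in> P" for d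
          using hom_part_poly_subst[of n \<sigma> n k, OF \<sigma> _ f] k by simp
        then have "poly_subst \<sigma> (hom_part d f) \<in> P'" for d
          using mem[OF \<sigma>p[OF formsD(1)[OF hf]]] by blast
        then have "hom_part d f \<in> P'" for d using form[OF hf] by blast
        then have "(\<Sum>d<D. hom_part d f) \<in> P'" by (intro ideal_set_sum[OF A])
        then show "f \<in> P" using e mem[OF f] by simp
      qed
    qed
    show ?thesis using ver iff ideal_mpoly_subset[OF idP] by blast
  qed
  ultimately show ?thesis using k by blast
qed

lemma rational_normal_curve_curve_mat:
  assumes "k \<le> n"
  shows "rational_normal_curve n k
    ((\<lambda>Q. {f \<in> polys {..n}. veronese_subst k (curve_mat n k :: nat \<Rightarrow> nat \<Rightarrow> 'k::field_char_0) f \<in> Q}) ` Proj 1 {0})"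
  unfolding rational_normal_curve_def
  using curve_mat_inj[OF assms] by (intro exI[of _ "curve_mat n k"]) blast

theorem theorem1p4:
  fixes n :: nat
  assumes "n \<ge> 1"
  shows "(\<forall>a::'k::field_char_0. \<exists>I. point_scheme n (R_alg n a) I) \<and>
    (\<forall>(a::'k) b I I'.
       point_scheme n (R_alg n a) I \<and> point_scheme n (R_alg n b) I' \<longrightarrow>
       scheme_iso n I n I') \<and>
    (\<forall>(a::'k) I. point_scheme n (R_alg n a) I \<longrightarrow>
       (\<exists>C. (\<forall>k\<in>{1..n}. rational_normal_curve n k (C k)) \<and>
            Proj n I = (\<Union>k\<in>{1..n}. C k)))"
proof (intro conjI allI impI)
  fix a :: 'k
  show "\<exists>I. point_scheme n (R_alg n a) I" using point_scheme_chain_ideal by blast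
next
  fix a b :: 'k and I I'
  assume "point_scheme n (R_alg n a) I \<and> point_scheme n (R_alg n b) I'"
  \<comment> \<open>Uniqueness turns the isomorphism into an equality of ideals, so the identity
    serves as the map.\<close>
  then have "I = chain_ideal n a" "I' = chain_ideal n b"
    using point_scheme_unique point_scheme_chain_ideal by blast+
  then show "scheme_iso n I n I'"
    using chain_ideal_param[of n a b] scheme_iso_refl by simp
next
  fix a :: 'k and I
  assume "point_scheme n (R_alg n a) I"
  then have I: "I = chain_ideal n a"
    using point_scheme_unique point_scheme_chain_ideal by blast
  define C where "C k = (\<lambda>Q. {f \<in> polys {..n}. veronese_subst k (curve_mat n k) f \<in> Q}) ` Proj 1 {0 :: 'k mpoly}" for k
  have "Proj n I = (\<Union>k\<in>{1..n}. C k)"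
    unfolding I C_def using Proj_subset_curves[OF assms] curve_subset_Proj by (intro equalityI subsetI) (auto, blast)
  moreover have "\<forall>k\<in>{1..n}. rational_normal_curve n k (C k)"
    unfolding C_def using rational_normal_curve_curve_mat by auto
  ultimately show "\<exists>C. (\<forall>k\<in>{1..n}. rational_normal_curve n k (C k)) \<and> Proj n I = (\<Union>k\<in>{1..n}. C k)"
    by blast
qed

end
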